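(* Let $n\ge 1$, and let $z_1,\dots,z_n$ be the linear coordinates on the $n$ factors of $\widetilde E^{\,n}=\mathbb{C}^n$ in the relative configuration space $\widetilde E^{\,n}\times \mathrm{Conf}_n(E)\to\widetilde E^{\,n}$. For $m\ge 0$ let $\mathbf{B}_m(z)=\mathbf{B}_m(\mathcal{E}^*_1(z),\dots,\mathcal{E}^*_m(z))$ be the $m$-th complete Bell polynomial in the Eisenstein–Kronecker series $\mathcal{E}^*_k(z)$, $k\ge 1$. For $j\in[n]=\{1,\dots,n\}$ let $\Pi_{[n]\setminus\{j\}}$ be the set of set partitions $\pi=\{\pi_1,\dots,\pi_\ell\}$ of $[n]\setminus\{j\}$. Then $$\langle \gamma_n^{\mathrm{GW}},\varphi_n^{\mathrm{GW}}\rangle=\sum_{j\in[n]}\ \sum_{\pi\in\Pi_{[n]\setminus\{j\}}}\ \prod_{k=1}^{\ell}\frac{\mathbf{B}_{|\pi_k|}\big(\sum_{i\in\pi_k}z_i\big)}{|\pi_k|}$$ (an equality of meromorphic functions of $z_1,\dots,z_n$; for $n=1$ the only partition of the empty set is the empty one, contributing $1$).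
   Context: Fix $\tau$ with $\mathrm{Im}\,\tau>0$, $q=e^{2\pi i\tau}$, $\Lambda_\tau=2\pi i\mathbb{Z}\oplus 2\pi i\tau\mathbb{Z}$, $E=\mathbb{C}/\Lambda_\tau$, $\widetilde E=\mathbb{C}$ its universal cover. Let $$\theta(z)=\frac{\sum_{m\in\mathbb{Z}}(-1)^m q^{\frac12(m+\frac12)^2}e^{(m+\frac12)z}}{\sum_{m\in\mathbb{Z}}(-1)^m (m+\frac12)q^{\frac12(m+\frac12)^2}}$$ be the odd Jacobi theta function normalized by $\theta'(0)=1$. Complete Bell polynomials: $\mathbf{B}_m(x_1,\dots,x_m)=m!\,[t^m]\exp\big(\sum_{k\ge1}\frac{t^k}{k!}x_k\big)$. Eisenstein–Kronecker series: for $m\ge 1$, $$\mathcal{E}^*_m(z)=(-1)^{m-1}(m-1)!\Big(\frac1{z^m}+\sum_{\lambda\in\Lambda_\tau\setminus\{0\}}\Big(\frac1{(z+\lambda)^m}+(-1)^{m-1}\frac1{\lambda^m}\Big)\Big)=(\ln\theta)^{(m)}(z)+2\mathbb{G}_m,$$ where $2\mathbb{G}_m=(m-1)!\sum_{\lambda\ne0}\lambda^{-m}$ for $m$ even and $\mathbb{G}_m=0$ for $m$ odd; conditionally convergent sums use Eisenstein summation (first over the $2\pi i$ direction, then over the $2\pi i\tau$ direction). The pairing. Write $u_k=e^{z_k}$, $v_k=e^{w_k}$, where $w_1,\dots,w_n$ are linear coordinates on the $n$ points of $\mathrm{Conf}_n(E)$. Consider $$C_{2n}=\frac{\theta(c+\sum_k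 z_k)}{\theta(c)}\cdot\frac{\prod_{i<j}\theta(z_i+w_i-z_j-w_j)\,\theta(w_i-w_j)}{\prod_i\theta(z_i)\ \prod_{i<j}\theta(z_i+w_i-w_j)\,\theta(w_i-z_j-w_j)}$$ (the free fermion $2n$-point function, a section constructed from the Poincaré bundle with parameter $c\in\mathrm{Pic}^0(E)$), and its residue at $c=0$, $$\varpi=\theta\Big(\sum_k z_k\Big)\cdot\frac{\prod_{i<j}\theta(z_i+w_i-z_j-w_j)\,\theta(w_i-w_j)}{\prod_i\theta(z_i)\ \prod_{i<j}\theta(z_i+w_i-w_j)\,\theta(w_i-z_j-w_j)},$$ which is $\Lambda_\tau$-periodic in each $w_i$. The class $\varphi_n^{\mathrm{GW}}$ is the relative (fiberwise, with $z$ fixed) de Rham cohomology class of the holomorphic $n$-form $\varpi\,dw_1\wedge\cdots\wedge dw_n$ on the complement of its poles. The class $\gamma_n^{\mathrm{GW}}$ is represented, for given $u$, by the image in $E^n$ of a product of counterclockwise circles $\{v\in(\mathbb{C}^* )^n: |v_j|=\text{const}_j\}$ with $1<|u_iv_i/v_j|<|q|^{-1}$ and $1<|v_i/(u_jv_j)|<|q|^{-1}$ for all $i<j$. The pairing is the fiberwise integral $$\langle \gamma_n^{\mathrm{GW}},\varphi_n^{\mathrm{GW}}\rangle=\Big(\frac1{2\pi i}\Big)^n\int_{\gamma_n^{\mathrm{GW}}}\varpi\;\frac{dv_1}{v_1}\cdots\frac{dv_n}{v_n},$$ defined on the nonempty open set of $u$ for which such circles exist and extended by analytic continuation to a meromorphic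 function of $(z_1,\dots,z_n)$. *)

theory Defs
  imports
    "HOL-Analysis.Analysis"
    "HOL-Library.Disjoint_Sets"
    "HOL-Computational_Algebra.Formal_Power_Series"
begin

section \<open>Theta function, Eisenstein--Kronecker series, Bell polynomials\<close>

text \<open>
  The power \<open>q\<^bsup>(m + 1/2)\<^sup>2 / 2\<^esup>\<close> is read as \<open>exp (2 \<pi> \<i> \<tau> (m + 1/2)\<^sup>2 / 2)\<close>.
\<close>

definition theta_coeff :: "complex \<Rightarrow> int \<Rightarrow> complex" where
  "theta_coeff \<tau> m =
     (-1) powi m * exp (2 * of_real pi * \<i> * \<tau> * ((of_int m + 1/2)\<^sup>2 / 2))"

definition theta :: "complex \<Rightarrow> complex \<Rightarrow> complex" where
  "theta \<tau> z =
     (\<Sum>\<^sub>\<infinity>m::int. theta_coeff \<tau> m * exp ((of_int m + 1/2) * z)) /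
     (\<Sum>\<^sub>\<infinity>m::int. theta_coeff \<tau> m * (of_int m + 1/2))"

text \<open>
  Eisenstein summation of \<open>f\<close> over the nonzero points of the lattice
  \<open>2 \<pi> \<i> \<int> \<oplus> 2 \<pi> \<i> \<tau> \<int>\<close>: both limits are taken along symmetric partial sums, the inner
  one in the direction \<open>2 \<pi> \<i>\<close> and the outer one in the direction \<open>2 \<pi> \<i> \<tau>\<close>.
\<close>

definition eisenstein_sum :: "complex \<Rightarrow> (complex \<Rightarrow> complex) \<Rightarrow> complex" where
  "eisenstein_sum \<tau> f =
     lim (\<lambda>M. \<Sum>b = - int M..int M. lim (\<lambda>N. \<Sum>a = - int N..int N.
       if a = 0 \<and> b = 0 then 0 else f (2 * of_real pi * \<i> * (of_int a + of_int b * \<tau>))))"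

text \<open>Only used for \<open>m \<ge> 1\<close>, and meaningful only for \<open>z\<close> outside the lattice.\<close>

definition eisenstein_kronecker :: "complex \<Rightarrow> nat \<Rightarrow> complex \<Rightarrow> complex" where
  "eisenstein_kronecker \<tau> m z =
     (-1) ^ (m - 1) * fact (m - 1) *
       (1 / z ^ m + eisenstein_sum \<tau> (\<lambda>l. 1 / (z + l) ^ m + (-1) ^ (m - 1) * (1 / l ^ m)))"

text \<open>
  The arguments \<open>x\<^sub>1, x\<^sub>2, \<dots>\<close> are passed as a sequence, of which \<open>x 0\<close> is ignored; the
  value depends on \<open>x 1, \<dots>, x m\<close> only.
\<close>

definition complete_bell :: "nat \<Rightarrow> (nat \<Rightarrow> complex) \<Rightarrow> complex" where
  "complete_bell m x =
     fact m * fps_nth (fps_compose (fps_exp 1) (Abs_fps (\<lambda>k. if k = 0 then 0 else x k / fact k))) m"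

definition bell_EK :: "complex \<Rightarrow> nat \<Rightarrow> complex \<Rightarrow> complex" where
  "bell_EK \<tau> m z = complete_bell m (\<lambda>k. eisenstein_kronecker \<tau> k z)"


section \<open>Meromorphic functions on \<open>\<complex>\<^sup>n\<close>\<close>

definition holomorphic_Cn :: "(complex ^ 'n \<Rightarrow> complex) \<Rightarrow> (complex ^ 'n) set \<Rightarrow> bool" where
  "holomorphic_Cn f U \<longleftrightarrow> open U \<and>
     (\<forall>z\<in>U. \<exists>D. (f has_derivative D) (at z) \<and> (\<forall>c v. D (c *s v) = c * D v))"

text \<open>
  A meromorphic function is locally a quotient \<open>g / h\<close> of holomorphic functions, where \<open>h\<close> does
  not vanish identically near any point. It is represented by a total function, whose values
  on the zero sets of the local denominators are irrelevant; accordingly, two representatives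
  stand for the same meromorphic function if they agree on a dense open set.
\<close>

definition meromorphic_Cn :: "(complex ^ 'n \<Rightarrow> complex) \<Rightarrow> bool" where
  "meromorphic_Cn f \<longleftrightarrow>
     (\<forall>a. \<exists>U g h. a \<in> U \<and> holomorphic_Cn g U \<and> holomorphic_Cn h U \<and>
        U \<subseteq> closure {z \<in> U. h z \<noteq> 0} \<and> (\<forall>z\<in>U. h z \<noteq> 0 \<longrightarrow> f z = g z / h z))"

definition meromorphic_eq :: "(complex ^ 'n \<Rightarrow> complex) \<Rightarrow> (complex ^ 'n \<Rightarrow> complex) \<Rightarrow> bool" where
  "meromorphic_eq f g \<longleftrightarrow> meromorphic_Cn f \<and> meromorphic_Cn g \<and>
     (\<exists>U. open U \<and> closure U = UNIV \<and> (\<forall>z\<in>U. f z = g z))"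


section \<open>The pairing\<close>

text \<open>
  The index set \<open>{1, \<dots>, n}\<close> is the finite linearly ordered type \<open>'n\<close>, with \<open>n = CARD('n)\<close>.
\<close>

definition varpi :: "complex \<Rightarrow> complex ^ ('n :: {finite, linorder}) \<Rightarrow> complex ^ ('n :: {finite, linorder}) \<Rightarrow> complex" where
  "varpi \<tau> z w =
     theta \<tau> (\<Sum>k\<in>UNIV. z $ k) *
     ((\<Prod>(i, j) | i < j. theta \<tau> (z $ i + w $ i - z $ j - w $ j) * theta \<tau> (w $ i - w $ j)) /
      ((\<Prod>i\<in>UNIV. theta \<tau> (z $ i)) *
       (\<Prod>(i, j) | i < j. theta \<tau> (z $ i + w $ i - w $ j) * theta \<tau> (w $ i - z $ j - w $ j))))"

text \<open>
  \<open>r\<close> is the vector of radii of the circles \<open>\<bar>v\<^sub>j\<bar> = r\<^sub>j\<close>, and \<open>\<bar>u\<^sub>j\<bar> = \<bar>exp z\<^sub>j\<bar>\<close>.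
\<close>

definition admissible_radii :: "complex \<Rightarrow> complex ^ ('n :: {finite, linorder}) \<Rightarrow> real ^ ('n :: {finite, linorder}) \<Rightarrow> bool" where
  "admissible_radii \<tau> z r \<longleftrightarrow>
     (let q = exp (2 * of_real pi * \<i> * \<tau>) in
      (\<forall>j. 0 < r $ j) \<and>
      (\<forall>i j. i < j \<longrightarrow>
         1 < norm (exp (z $ i)) * r $ i / r $ j \<and>
         norm (exp (z $ i)) * r $ i / r $ j < 1 / norm q \<and>
         1 < r $ i / (norm (exp (z $ j)) * r $ j) \<and>
         r $ i / (norm (exp (z $ j)) * r $ j) < 1 / norm q))"

text \<open>
  The torus is parametrized by \<open>v\<^sub>j = r\<^sub>j exp (\<i> t\<^sub>j)\<close> with \<open>0 \<le> t\<^sub>j \<le> 2 \<pi>\<close>, so that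
  \<open>w\<^sub>j = ln r\<^sub>j + \<i> t\<^sub>j\<close> and \<open>dv\<^sub>j / v\<^sub>j = \<i> dt\<^sub>j\<close>; the product of the latter is the factor \<open>\<i>\<^sup>n\<close>.
\<close>

definition torus_integral :: "complex \<Rightarrow> complex ^ ('n :: {finite, linorder}) \<Rightarrow> real ^ ('n :: {finite, linorder}) \<Rightarrow> complex" where
  "torus_integral \<tau> z r =
     (1 / (2 * of_real pi * \<i>)) ^ CARD('n) *
     integral (cbox 0 (\<chi> j. 2 * pi))
       (\<lambda>t. varpi \<tau> z (\<chi> j. of_real (ln (r $ j)) + \<i> * of_real (t $ j)) * \<i> ^ CARD('n))"

text \<open>
  \<open>P\<close> is the pairing of \<open>\<gamma>\<^sub>n\<^sup>G\<^sup>W\<close> with \<open>\<phi>\<^sub>n\<^sup>G\<^sup>W\<close>: a meromorphic function on \<open>\<complex>\<^sup>n\<close> given by the torus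
  integral wherever admissible circles exist. The region of such \<open>z\<close> meets the polar divisor
  of the factor \<open>1 / (\<Prod>i. \<theta>(z\<^sub>i))\<close> of the integrand, which has to be left out.
\<close>

definition is_gw_pairing :: "complex \<Rightarrow> (complex ^ ('n :: {finite, linorder}) \<Rightarrow> complex) \<Rightarrow> bool" where
  "is_gw_pairing \<tau> P \<longleftrightarrow> meromorphic_Cn P \<and>
     (\<forall>z r. admissible_radii \<tau> z r \<and> (\<forall>i. theta \<tau> (z $ i) \<noteq> 0) \<longrightarrow> P z = torus_integral \<tau> z r)"

end

theory Submission
  imports Defs "HOL-Complex_Analysis.Complex_Analysis"
begin

text \<open>
  For a parameter \<open>c\<close> let \<open>F(c, x) = \<theta>(c + x) / (\<theta>(c) \<theta>(x))\<close>. By the Frobenius determinant formula,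
  \<open>det F(c, z\<^sub>i + w\<^sub>i - w\<^sub>j)\<close> is a multiple of the integrand, with a factor that does not depend on the
  \<open>w\<^sub>i\<close>. On admissible circles the off-diagonal entries have the Fourier expansions of Kronecker,
  \<open>F(c, x) = \<Sum>\<^sub>n a\<^sub>n e\<^bsup>n x\<^esup>\<close> or \<open>\<Sum>\<^sub>n (a\<^sub>n - 1) e\<^bsup>n x\<^esup>\<close> with \<open>a\<^sub>n = 1 / (1 - e\<^bsup>-c\<^esup> q\<^bsup>-n\<^esup>)\<close>. Integration keeps the
  permutations that preserve the fibers of \<open>i \<mapsto> n\<^sub>i\<close>; each fiber contributes an elementary
  determinant, which is the exponential (for the convolution of set functions) of the derivatives
  of \<open>a\<^sub>n\<close> with respect to \<open>c\<close>. Hence the average of the determinant is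
  \<open>\<Sum>\<^sub>\<pi> \<Prod>\<^bsub>B \<in> \<pi>\<^esub> \<partial>\<^sub>c\<^bsup>card B - 1\<^esup> F(c, z\<^sub>B)\<close> with \<open>z\<^sub>B = \<Sum>\<^bsub>i \<in> B\<^esub> z\<^sub>i\<close>, and the residue at \<open>c = 0\<close> gives the
  claim, because \<open>t F(t, z)\<close> is the exponential generating function of the Bell polynomials in the
  Eisenstein--Kronecker series.
\<close>

text \<open>The parameter c does not occur in the integrand. For nonzero c the averaged determinant
  has two descriptions, and the unknown average of the c-free factor \<open>fgt\<close> is read off
  from them as c tends to 0. Single terms have poles of order up to n there, which cancel down to
  order one. Convergence is the obstacle. The diagonal entries involve only \<open>z $ i\<close>,
  which admissibility does not confine to the strip \<open>\<bar>Re x\<bar> < ell\<close>, so they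
  stay unexpanded. The sums over larger blocks do lie in the strip, but possibly on
  \<open>Re x = 0\<close> or in the wrong half, where only c-derivatives of the partial sums
  converge; the blocks with at least two elements carry exactly such derivatives. Theta enters
  through its product \<open>P\<close>, which shows the position and the simplicity of its zeros.
  The identities for \<open>P\<close> are obtained by one method: divide by a function with simple
  zeros, observe that the quotient is periodic up to a multiplier, and conclude from the maximum
  principle that it is constant or zero.\<close>

no_notation fps_nth (infixl "$" 75)

section \<open>Sums over set partitions\<close>

text \<open>This is the exponential of \<open>p\<close> with respect to the convolution of set functions.\<close>

definition set_exp :: "('a set \<Rightarrow> 'b::comm_ring_1) \<Rightarrow> 'a set \<Rightarrow> 'b" where
  "set_exp p T = (\<Sum>\<pi> | partition_on T \<pi>. \<Prod>B\<in>\<pi>. p B)"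

lemma set_exp_empty [simp]: "set_exp p {} = 1"
  by (simp add: set_exp_def partition_on_empty)

text \<open>A partition of \<open>T\<close> amounts to its block \<open>B\<close> through
  \<open>m\<close> and a partition of \<open>T - B\<close>. This recursion carries the inductions
  below.\<close>

lemma set_exp_rec:
  assumes "finite T" "m \<in> T"
  shows "set_exp p T = (\<Sum>B | m \<in> B \<and> B \<subseteq> T. p B * set_exp p (T - B))"
proof -
  have fin: "finite {B. m \<in> B \<and> B \<subseteq> T}"
    using assms by simp
  have "(\<Sum>B | m \<in> B \<and> B \<subseteq> T. p B * set_exp p (T - B)) =
      (\<Sum>B | m \<in> B \<and> B \<subseteq> T. \<Sum>\<rho> | partition_on (T - B) \<rho>. p B * (\<Prod>C\<in>\<rho>. p C))"
    by (simp add: set_exp_def sum_distrib_left)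
  also have "\<dots> = (\<Sum>(B, \<rho>)\<in>Sigma {B. m \<in> B \<and> B \<subseteq> T} (\<lambda>B. {\<rho>. partition_on (T - B) \<rho>}).
      p B * (\<Prod>C\<in>\<rho>. p C))"
    using assms by (intro sum.Sigma) (auto intro: finitely_many_partition_on)
  also have "\<dots> = set_exp p T"
    unfolding set_exp_def
  proof (rule sum.reindex_bij_witness[where j = "\<lambda>(B, \<rho>). insert B \<rho>"
        and i = "\<lambda>\<pi>. (THE B. B \<in> \<pi> \<and> m \<in> B, \<pi> - {THE B. B \<in> \<pi> \<and> m \<in> B})"], goal_cases)
    case (1 x)
    then obtain B \<rho> where x: "x = (B, \<rho>)" and B: "m \<in> B" "B \<subseteq> T" and \<rho>: "partition_on (T - B) \<rho>"
      by auto
    have "B \<notin> \<rho>" using partition_onD1[OF \<rho>] B by auto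
    moreover have "(THE C. C \<in> insert B \<rho> \<and> m \<in> C) = B"
      using partition_onD1[OF \<rho>] B by (intro the_equality) auto
    ultimately show ?case by (simp add: x)
  next
    case (2 x)
    then obtain B \<rho> where x: "x = (B, \<rho>)" and B: "m \<in> B" "B \<subseteq> T" and \<rho>: "partition_on (T - B) \<rho>"
      by auto
    have "disjnt B (\<Union>\<rho>)" using partition_onD1[OF \<rho>] by (auto simp: disjnt_def)
    then show ?case using B \<rho> by (auto simp: x partition_on_insert)
  next
    case (3 \<pi>)
    then have \<pi>: "partition_on T \<pi>" by simp
    then obtain B where B: "B \<in> \<pi>" "m \<in> B" using assms partition_onD1 by blast
    have "(THE B. B \<in> \<pi> \<and> m \<in> B) = B"
      using B partition_onD2[OF \<pi>] by (intro the_equality) (auto simp: disjoint_def)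
    then show ?case using B by auto
  next
    case (4 \<pi>)
    then have \<pi>: "partition_on T \<pi>" by simp
    then obtain B where B: "B \<in> \<pi>" "m \<in> B" using assms partition_onD1 by blast
    have the: "(THE B. B \<in> \<pi> \<and> m \<in> B) = B"
      using B partition_onD2[OF \<pi>] by (intro the_equality) (auto simp: disjoint_def)
    have "disjnt B (\<Union>(\<pi> - {B}))"
      using partition_onD2[OF \<pi>] B by (force simp: disjnt_def disjoint_def)
    from partition_on_insert[OF this, of T] have "partition_on (T - B) (\<pi> - {B})" "B \<subseteq> T"
      using \<pi> B by (simp_all add: insert_absorb)
    then show ?case using B by (simp add: the)
  next
    case (5 x)
    then obtain B \<rho> where x: "x = (B, \<rho>)" and B: "m \<in> B" "B \<subseteq> T" and \<rho>: "partition_on (T - B) \<rho>"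
      by auto
    have "B \<notin> \<rho>" using partition_onD1[OF \<rho>] B by auto
    moreover have "finite \<rho>" using \<rho> assms by (meson finite_Diff finite_elements)
    ultimately show ?case by (simp add: x)
  qed
  finally show ?thesis by simp
qed

text \<open>Both sides run over the chains \<open>B \<subseteq> S \<subseteq> T\<close> with
  \<open>m \<in> B\<close>, indexed by \<open>S\<close> or by \<open>S - B\<close>. This is the
  interchange of sums in \<open>set_exp_add\<close>.\<close>

lemma sum_subsets_containing:
  assumes "finite T" "m \<in> T"
  shows "(\<Sum>S | m \<in> S \<and> S \<subseteq> T. \<Sum>B | m \<in> B \<and> B \<subseteq> S. g B (S - B)) =
    (\<Sum>B | m \<in> B \<and> B \<subseteq> T. \<Sum>S\<in>Pow (T - B). (g B S :: 'b::comm_monoid_add))"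
proof -
  have fin: "finite {B. m \<in> B \<and> B \<subseteq> S}" if "S \<subseteq> T" for S
    by (rule finite_subset[of _ "Pow T"]) (use that assms(1) in auto)
  have "(\<Sum>S | m \<in> S \<and> S \<subseteq> T. \<Sum>B | m \<in> B \<and> B \<subseteq> S. g B (S - B)) =
     (\<Sum>(S, B)\<in>Sigma {S. m \<in> S \<and> S \<subseteq> T} (\<lambda>S. {B. m \<in> B \<and> B \<subseteq> S}). g B (S - B))"
    using assms(1) fin by (intro sum.Sigma) simp_all
  also have "\<dots> = (\<Sum>(B, S)\<in>Sigma {B. m \<in> B \<and> B \<subseteq> T} (\<lambda>B. Pow (T - B)). g B S)"
    by (rule sum.reindex_bij_witness[where i = "\<lambda>(B, S). (B \<union> S, B)" and j = "\<lambda>(S, B). (B, S - B)"])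
       (auto simp: Diff_triv Un_Diff)
  also have "\<dots> = (\<Sum>B | m \<in> B \<and> B \<subseteq> T. \<Sum>S\<in>Pow (T - B). g B S)"
    using assms by (intro sum.Sigma [symmetric]) (auto intro: finite_subset)
  finally show ?thesis .
qed

lemma sum_Pow_split_elem:
  assumes "finite T" "m \<in> T"
  shows "(\<Sum>S\<in>Pow T. (g S :: 'b::comm_monoid_add)) =
    (\<Sum>S | m \<in> S \<and> S \<subseteq> T. g S) + (\<Sum>S | m \<in> S \<and> S \<subseteq> T. g (T - S))"
proof -
  have "Pow T = {S. m \<in> S \<and> S \<subseteq> T} \<union> {S. m \<notin> S \<and> S \<subseteq> T}" by auto
  then have "(\<Sum>S\<in>Pow T. g S) = (\<Sum>S | m \<in> S \<and> S \<subseteq> T. g S) + (\<Sum>S | m \<notin> S \<and> S \<subseteq> T. g S)"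
    using assms by (simp only:) (subst sum.union_disjoint; auto)
  also have "(\<Sum>S | m \<notin> S \<and> S \<subseteq> T. g S) = (\<Sum>S | m \<in> S \<and> S \<subseteq> T. g (T - S))"
    using assms by (intro sum.reindex_bij_witness[where i = "\<lambda>S. T - S" and j = "\<lambda>S. T - S"])
      (auto simp: double_diff)
  finally show ?thesis .
qed

text \<open>Splitting off the block through \<open>m\<close> acts like a derivation: the recursion
  for one factor gives the subsets \<open>S\<close> that contain \<open>m\<close>, the recursion for
  the other those that do not, as in the product rule for exponentials.\<close>

lemma set_exp_add:
  assumes "finite T"
  shows "set_exp (\<lambda>B. p B + r B) T = (\<Sum>S\<in>Pow T. set_exp p S * set_exp r (T - S))"
  using assms
proof (induction "card T" arbitrary: T rule: less_induct)
  case less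
  show ?case
  proof (cases "T = {}")
    case True
    then show ?thesis by simp
  next
    case False
    then obtain m where m: "m \<in> T" by auto
    let ?I = "{B. m \<in> B \<and> B \<subseteq> T}"
    have *: "(\<Sum>S\<in>?I. set_exp p' S * set_exp r' (T - S)) =
        (\<Sum>B\<in>?I. \<Sum>S\<in>Pow (T - B). p' B * (set_exp p' S * set_exp r' (T - B - S)))"
      for p' r' :: "'a set \<Rightarrow> 'b"
    proof -
      have "(\<Sum>S\<in>?I. set_exp p' S * set_exp r' (T - S)) = 
        (\<Sum>S\<in>?I. \<Sum>B | m \<in> B \<and> B \<subseteq> S. p' B * (set_exp p' (S - B) * set_exp r' (T - B - (S - B))))"
      proof (rule sum.cong [OF refl])
        fix S assume S: "S \<in> ?I"
        have fS: "finite S" using less(2) S by (auto intro: finite_subset)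
        have eq: "T - B - (S - B) = T - S" if "B \<subseteq> S" for B using that by auto
        have "set_exp p' S = (\<Sum>B | m \<in> B \<and> B \<subseteq> S. p' B * set_exp p' (S - B))"
          using S fS by (intro set_exp_rec) auto
        then show "set_exp p' S * set_exp r' (T - S) = (\<Sum>B | m \<in> B \<and> B \<subseteq> S.
            p' B * (set_exp p' (S - B) * set_exp r' (T - B - (S - B))))"
          by (auto simp: sum_distrib_right mult.assoc eq intro!: sum.cong)
      qed
      also have "\<dots> = (\<Sum>B\<in>?I. \<Sum>S\<in>Pow (T - B). p' B * (set_exp p' S * set_exp r' (T - B - S)))"
        by (rule sum_subsets_containing[OF less(2) m,
              of "\<lambda>B S. p' B * (set_exp p' S * set_exp r' (T - B - S))"])
      finally show ?thesis .
    qed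
    have IH: "set_exp (\<lambda>B. p B + r B) (T - B) = (\<Sum>S\<in>Pow (T - B). set_exp p S * set_exp r (T - B - S))"
      if "B \<in> ?I" for B
    proof (rule less(1))
      show "card (T - B) < card T" using that m less(2) by (intro psubset_card_mono) auto
    qed (use less(2) in auto)
    have flip: "(\<Sum>S\<in>Pow U. set_exp p S * set_exp r (U - S)) = (\<Sum>S\<in>Pow U. set_exp r S * set_exp p (U - S))" for U
      by (rule sum.reindex_bij_witness[where i = "\<lambda>S. U - S" and j = "\<lambda>S. U - S"])
         (auto simp: double_diff mult.commute)
    have "set_exp (\<lambda>B. p B + r B) T =
       (\<Sum>B\<in>?I. (p B + r B) * (\<Sum>S\<in>Pow (T - B). set_exp p S * set_exp r (T - B - S)))"
      by (subst set_exp_rec[OF less(2) m]) (intro sum.cong refl, simp add: IH)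
    also have "\<dots> = (\<Sum>B\<in>?I. \<Sum>S\<in>Pow (T - B). p B * (set_exp p S * set_exp r (T - B - S))) +
        (\<Sum>B\<in>?I. r B * (\<Sum>S\<in>Pow (T - B). set_exp p S * set_exp r (T - B - S)))"
      by (simp add: distrib_right sum.distrib sum_distrib_left)
    also have "(\<Sum>B\<in>?I. r B * (\<Sum>S\<in>Pow (T - B). set_exp p S * set_exp r (T - B - S))) =
        (\<Sum>B\<in>?I. \<Sum>S\<in>Pow (T - B). r B * (set_exp r S * set_exp p (T - B - S)))"
      by (simp add: flip sum_distrib_left)
    also have "(\<Sum>B\<in>?I. \<Sum>S\<in>Pow (T - B). p B * (set_exp p S * set_exp r (T - B - S))) +
        (\<Sum>B\<in>?I. \<Sum>S\<in>Pow (T - B). r B * (set_exp r S * set_exp p (T - B - S))) =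
        (\<Sum>S\<in>?I. set_exp p S * set_exp r (T - S)) + (\<Sum>S\<in>?I. set_exp r S * set_exp p (T - S))"
      by (simp add: *)
    also have "\<dots> = (\<Sum>S\<in>Pow T. set_exp p S * set_exp r (T - S))"
      by (subst sum_Pow_split_elem[OF less(2) m])
         (auto simp: double_diff mult.commute intro!: sum.cong arg_cong2[where f = "(+)"])
    finally show ?thesis .
  qed
qed

lemma set_exp_zero:
  assumes "finite T"
  shows "set_exp (\<lambda>B. 0) T = (if T = {} then 1 else 0)"
proof (cases "T = {}")
  case False
  then obtain m where "m \<in> T" by auto
  then show ?thesis using set_exp_rec[OF assms, of m "\<lambda>B. 0"] by auto
qed simp

text \<open>Expanding the sum lets each block choose a summand \<open>n\<close>; the choices colour
  the elements, and the fibers of the colouring \<open>f\<close> are partitioned independently. The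
  same maps \<open>f\<close> index the Fourier modes in
  \<open>integral_det_truncated\<close>.\<close>

lemma set_exp_sum:
  assumes "finite I" "finite T"
  shows "set_exp (\<lambda>B. \<Sum>n\<in>I. p n B) T = (\<Sum>f\<in>T \<rightarrow>\<^sub>E I. \<Prod>n\<in>I. set_exp (p n) {i\<in>T. f i = n})"
  using assms
proof (induction I arbitrary: T rule: finite_induct)
  case empty
  then show ?case by (auto simp: set_exp_zero PiE_eq_empty_iff)
next
  case (insert n I)
  have "set_exp (\<lambda>B. \<Sum>n\<in>insert n I. p n B) T =
     (\<Sum>S\<in>Pow T. set_exp (p n) S * (\<Sum>f\<in>(T - S) \<rightarrow>\<^sub>E I. \<Prod>k\<in>I. set_exp (p k) {i\<in>T - S. f i = k}))"
    using insert by (simp add: set_exp_add)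
  also have "\<dots> = (\<Sum>S\<in>Pow T. \<Sum>f\<in>(T - S) \<rightarrow>\<^sub>E I. set_exp (p n) S * (\<Prod>k\<in>I. set_exp (p k) {i\<in>T - S. f i = k}))"
    by (simp add: sum_distrib_left)
  also have "\<dots> = (\<Sum>(S, f)\<in>Sigma (Pow T) (\<lambda>S. (T - S) \<rightarrow>\<^sub>E I).
        set_exp (p n) S * (\<Prod>k\<in>I. set_exp (p k) {i\<in>T - S. f i = k}))"
    using insert by (intro sum.Sigma) (auto intro!: finite_PiE)
  also have "\<dots> = (\<Sum>f\<in>T \<rightarrow>\<^sub>E insert n I. \<Prod>k\<in>insert n I. set_exp (p k) {i\<in>T. f i = k})"
  proof (rule sum.reindex_bij_witness[where i = "\<lambda>g. ({i\<in>T. g i = n}, restrict g {i\<in>T. g i \<noteq> n})"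
        and j = "\<lambda>(S, f). (\<lambda>i. if i \<in> S then n else f i)"], goal_cases)
    case (1 x)
    then obtain S f where x: "x = (S, f)" "S \<subseteq> T" "f \<in> (T - S) \<rightarrow>\<^sub>E I" by auto
    have *: "{i \<in> T. (if i \<in> S then n else f i) = n} = S"
      using x insert(2) by (auto simp: PiE_iff split: if_splits)
    have **: "{i \<in> T. (if i \<in> S then n else f i) \<noteq> n} = T - S"
      using x insert(2) by (auto simp: PiE_iff split: if_splits)
    show ?case using x by (auto simp: * ** restrict_def fun_eq_iff PiE_iff extensional_def)
  next
    case (2 x)
    then show ?case by (auto simp: PiE_iff extensional_def)
  next
    case (3 g)
    then show ?case by (auto simp: PiE_iff extensional_def fun_eq_iff)
  next
    case (4 g)
    then show ?case by (auto simp: PiE_iff extensional_def)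
  next
    case (5 x)
    then obtain S f where x: "x = (S, f)" "S \<subseteq> T" "f \<in> (T - S) \<rightarrow>\<^sub>E I" by auto
    have *: "{i \<in> T. (if i \<in> S then n else f i) = n} = S"
      using x insert(2) by (auto simp: PiE_iff split: if_splits)
    have **: "{i \<in> T. (if i \<in> S then n else f i) = k} = {i \<in> T - S. f i = k}" if "k \<in> I" for k
      using x insert(2) that by (auto simp: PiE_iff split: if_splits)
    show ?case using insert by (simp add: x * **)
  qed
  finally show ?case .
qed

lemma set_exp_singletons:
  assumes "finite T" "\<And>B. card B \<noteq> 1 \<Longrightarrow> p B = 0"
  shows "set_exp p T = (\<Prod>i\<in>T. p {i})"
  using assms(1)
proof (induction T rule: finite_induct)
  case (insert m T)
  have "set_exp p (insert m T) = (\<Sum>B | m \<in> B \<and> B \<subseteq> insert m T. p B * set_exp p (insert m T - B))"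
    using insert by (intro set_exp_rec) auto
  also have "\<dots> = (\<Sum>B\<in>{{m}}. p B * set_exp p (insert m T - B))"
  proof (rule sum.mono_neutral_right)
    show "\<forall>B\<in>{B. m \<in> B \<and> B \<subseteq> insert m T} - {{m}}. p B * set_exp p (insert m T - B) = 0"
    proof
      fix B assume B: "B \<in> {B. m \<in> B \<and> B \<subseteq> insert m T} - {{m}}"
      then have "card B \<noteq> 1" by (auto simp: card_1_singleton_iff)
      then show "p B * set_exp p (insert m T - B) = 0" using assms(2) by simp
    qed
  qed (use insert in auto)
  finally show ?case using insert by simp
qed simp

lemma sum_Pow_card:
  assumes "finite T"
  shows "(\<Sum>S\<in>Pow T. g (card S)) = (\<Sum>j\<le>card T. of_nat (card T choose j) * (g j :: 'b::comm_ring_1))"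
proof -
  have "(\<Sum>S\<in>Pow T. g (card S)) = (\<Sum>j\<le>card T. \<Sum>S | S \<in> Pow T \<and> card S = j. g (card S))"
    using assms by (intro sum.group [symmetric]) (auto intro: card_mono)
  also have "\<dots> = (\<Sum>j\<le>card T. of_nat (card T choose j) * g j)"
  proof (rule sum.cong [OF refl])
    fix j
    have "(\<Sum>S | S \<in> Pow T \<and> card S = j. g (card S)) = (\<Sum>S | S \<in> Pow T \<and> card S = j. g j)"
      by (rule sum.cong) auto
    then show "(\<Sum>S | S \<in> Pow T \<and> card S = j. g (card S)) = of_nat (card T choose j) * g j"
      using n_subsets[OF assms, of j] by (simp add: Pow_def)
  qed
  finally show ?thesis .
qed

text \<open>For the exponential generating functions E of \<open>e\<close> and L of \<open>p\<close>
  the recursion says E' = L' E, so E is the exponential of L. The index \<open>Suc j\<close> is the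
  size of the block through a fixed element.\<close>

lemma set_exp_card:
  assumes "finite T" "e 0 = 1"
    and e: "\<And>k. e (Suc k) = (\<Sum>j\<le>k. of_nat (k choose j) * p (Suc j) * e (k - j))"
  shows "set_exp (\<lambda>B. p (card B)) T = e (card T)"
  using assms(1)
proof (induction "card T" arbitrary: T rule: less_induct)
  case less
  show ?case
  proof (cases "T = {}")
    case True
    then show ?thesis by (simp add: assms)
  next
    case False
    then obtain m where m: "m \<in> T" by auto
    define T' where "T' = T - {m}"
    have T': "finite T'" "m \<notin> T'" "T = insert m T'"
      using less(2) m by (auto simp: T'_def)
    then have cT: "card T = Suc (card T')" by simp
    have "set_exp (\<lambda>B. p (card B)) T = (\<Sum>B | m \<in> B \<and> B \<subseteq> T. p (card B) * e (card (T - B)))"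
    proof (subst set_exp_rec[OF less(2) m], intro sum.cong refl arg_cong2[where f = "(*)"])
      fix B assume "B \<in> {B. m \<in> B \<and> B \<subseteq> T}"
      then have "card (T - B) < card T" using m less(2) by (intro psubset_card_mono) auto
      then show "set_exp (\<lambda>B. p (card B)) (T - B) = e (card (T - B))"
        using less by auto
    qed
    also have "\<dots> = (\<Sum>S\<in>Pow T'. p (Suc (card S)) * e (card T' - card S))"
    proof (rule sum.reindex_bij_witness[where i = "insert m" and j = "\<lambda>B. B - {m}"], goal_cases)
      case (5 B)
      then have fB: "finite B" using less(2) by (auto intro: finite_subset)
      have "Suc (card (B - {m})) = card B" using 5 fB by (intro card_Suc_Diff1) auto
      moreover have "T - B = T' - (B - {m})" using 5 by (auto simp: T'_def)
      moreover have "card (T' - (B - {m})) = card T' - card (B - {m})"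
        using 5 fB by (intro card_Diff_subset) (auto simp: T'_def)
      ultimately show ?case by simp
    qed (use T'(2,3) in auto)
    also have "\<dots> = e (card T)"
      using sum_Pow_card[OF T'(1), of "\<lambda>j. p (Suc j) * e (card T' - j)"]
      by (simp add: cT e mult.assoc)
    finally show ?thesis .
  qed
qed

text \<open>Off singletons \<open>q\<close> agrees with the weights \<open>p\<close>, whose
  exponential is \<open>a\<close> on every nonempty set by the recursion; the excess on singletons
  exponentiates to a product. The convolution of the two is \<open>a\<close> times an expanded
  product, corrected at \<open>S = {}\<close>. The result has the form of one fiber in
  \<open>det_fiber_matrix\<close>.\<close>

lemma set_exp_eps:
  assumes "finite T" and e: "\<And>k. a = (\<Sum>j\<le>k. of_nat (k choose j) * p (Suc j) * (if j = k then 1 else a))"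
    and "\<And>B. card B \<noteq> 1 \<Longrightarrow> B \<noteq> {} \<Longrightarrow> q B = p (card B)"
  shows "set_exp q T = a * (\<Prod>i\<in>T. q {i} - p 1 + 1) + (1 - a) * (\<Prod>i\<in>T. q {i} - p 1)"
proof -
  \<comment> \<open>Formally the moments of a variable with values 0 and 1 and mean
    \<open>a\<close>, so that \<open>p\<close> lists its cumulants.\<close>
  define e' where "e' = (\<lambda>k::nat. if k = 0 then 1 else a)"
  define y where "y = (\<lambda>B. if card B = 1 then q B - p 1 else 0)"
  have q: "q B = p (card B) + y B" if "B \<noteq> {}" for B
    using assms(3)[of B] that by (auto simp: y_def)
  have "set_exp q T = set_exp (\<lambda>B. p (card B) + y B) T"
    unfolding set_exp_def
    by (intro sum.cong prod.cong refl q) (auto dest: partition_onD3)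
  also have "\<dots> = (\<Sum>S\<in>Pow T. set_exp (\<lambda>B. p (card B)) S * set_exp y (T - S))"
    using assms(1) by (rule set_exp_add)
  also have "\<dots> = (\<Sum>S\<in>Pow T. (if S = {} then 1 else a) * (\<Prod>i\<in>T - S. q {i} - p 1))"
  proof (intro sum.cong refl arg_cong2[where f = "(*)"])
    fix S assume "S \<in> Pow T"
    then have fS: "finite S" using assms(1) by (auto intro: finite_subset)
    have "set_exp (\<lambda>B. p (card B)) S = e' (card S)"
    proof (rule set_exp_card[OF fS])
      fix k show "e' (Suc k) = (\<Sum>j\<le>k. of_nat (k choose j) * p (Suc j) * e' (k - j))"
        using e[of k] by (simp add: e'_def eq_commute[of k])
    qed (simp add: e'_def)
    then show "set_exp (\<lambda>B. p (card B)) S = (if S = {} then 1 else a)"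
      using fS by (simp add: e'_def)
    show "set_exp y (T - S) = (\<Prod>i\<in>T - S. q {i} - p 1)"
      using assms(1) by (subst set_exp_singletons) (auto simp: y_def)
  qed
  also have "\<dots> = (\<Sum>S\<in>Pow T. a * (\<Prod>i\<in>T - S. q {i} - p 1) + (if S = {} then (1 - a) * (\<Prod>i\<in>T - S. q {i} - p 1) else 0))"
    by (intro sum.cong refl) (auto simp: algebra_simps)
  also have "\<dots> = a * (\<Sum>S\<in>Pow T. \<Prod>i\<in>T - S. q {i} - p 1) + (1 - a) * (\<Prod>i\<in>T. q {i} - p 1)"
    using assms(1) by (simp add: sum.distrib sum_distrib_left sum.delta)
  also have "(\<Sum>S\<in>Pow T. \<Prod>i\<in>T - S. q {i} - p 1) = (\<Prod>i\<in>T. q {i} - p 1 + 1)"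
    using prod_add[OF assms(1), of "\<lambda>_. 1" "\<lambda>i. q {i} - p 1"] by (simp add: add.commute)
  finally show ?thesis .
qed

section \<open>Determinants\<close>

text \<open>A permutation contributing to the determinant never lowers \<open>g\<close>, while the
  sum of \<open>g\<close> over all indices is unchanged; hence it raises no value and is the
  identity. Ties in \<open>g\<close> are allowed, and \<open>det_elim_matrix\<close> has
  them.\<close>

lemma det_ranked:
  fixes A :: "'a::comm_ring_1 ^ 'n ^ 'n" and g :: "'n \<Rightarrow> int"
  assumes "\<And>i j. A $ i $ j \<noteq> 0 \<Longrightarrow> i = j \<or> g i < g j"
  shows "det A = (\<Prod>i\<in>UNIV. A $ i $ i)"
proof -
  have zero: "(\<Prod>i\<in>UNIV. A $ i $ \<sigma> i) = 0" if \<sigma>: "\<sigma> permutes UNIV" and "\<sigma> \<noteq> id" for \<sigma>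
  proof (rule ccontr)
    assume "\<not> ?thesis"
    then have nz: "A $ i $ \<sigma> i \<noteq> 0" for i
      by (metis UNIV_I finite prod_zero)
    have le: "i = \<sigma> i \<or> g i < g (\<sigma> i)" for i using assms[OF nz] .
    obtain i0 where "\<sigma> i0 \<noteq> i0" using \<open>\<sigma> \<noteq> id\<close> by (auto simp: fun_eq_iff)
    then have "g i0 < g (\<sigma> i0)" using le[of i0] by auto
    moreover have "g i \<le> g (\<sigma> i)" for i using le[of i] by auto
    ultimately have "sum g UNIV < (\<Sum>i\<in>UNIV. g (\<sigma> i))"
      by (intro sum_strict_mono_ex1) auto
    moreover have "(\<Sum>i\<in>UNIV. g (\<sigma> i)) = sum g UNIV"
      using sum.permute[OF \<sigma>, of g] by (simp add: o_def)
    ultimately show False by simp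
  qed
  have "det A = (\<Sum>\<sigma>\<in>{id}. of_int (sign \<sigma>) * (\<Prod>i\<in>UNIV. A $ i $ \<sigma> i))"
    unfolding det_def by (rule sum.mono_neutral_right) (auto simp: zero permutes_id finite_permutations)
  then show ?thesis by (simp add: sign_id)
qed

lemma det_row_affine:
  fixes A B C :: "'a::comm_ring_1 ^ 'n ^ 'n"
  assumes "\<And>i. i \<noteq> k \<Longrightarrow> A $ i = B $ i" "\<And>i. i \<noteq> k \<Longrightarrow> A $ i = C $ i"
    and "\<And>j. A $ k $ j = s * B $ k $ j + (1 - s) * C $ k $ j"
  shows "det A = s * det B + (1 - s) * det C"
proof -
  have A: "A = (\<chi> i. if i = k then s *s B $ k + (1 - s) *s C $ k else A $ i)"
    using assms(3) by (simp add: vec_eq_iff algebra_simps)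
  have B: "B = (\<chi> i. if i = k then B $ k else A $ i)"
    using assms(1) by (auto simp: vec_eq_iff)
  have C: "C = (\<chi> i. if i = k then C $ k else A $ i)"
    using assms(2) by (auto simp: vec_eq_iff)
  have "det A = det (\<chi> i. if i = k then s *s B $ k else A $ i) + det (\<chi> i. if i = k then (1 - s) *s C $ k else A $ i)"
    by (subst A, subst det_row_add) (rule refl)
  also have "det (\<chi> i. if i = k then s *s B $ k else A $ i) = s * det B"
    by (subst det_row_mul) (use B in simp)
  also have "det (\<chi> i. if i = k then (1 - s) *s C $ k else A $ i) = (1 - s) * det C"
    by (subst det_row_mul) (use C in simp)
  finally show ?thesis .
qed

definition elim_matrix :: "('n \<Rightarrow> 'a::comm_ring_1) \<Rightarrow> 'n \<Rightarrow> 'a ^ 'n ^ 'n" where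
  "elim_matrix l k = (\<chi> i j. (if i = j then 1 else 0) - (if j = k then l i else 0))"

lemma elim_matrix_mult:
  "(elim_matrix l k ** A) $ i $ j = A $ i $ j - l i * A $ k $ j"
proof -
  have "(elim_matrix l k ** A) $ i $ j =
     (\<Sum>m\<in>UNIV. (if i = m then A $ m $ j else 0) - (if m = k then l i * A $ m $ j else 0))"
    unfolding matrix_matrix_mult_def elim_matrix_def vec_lambda_beta
    by (rule sum.cong) (simp_all add: left_diff_distrib)
  also have "\<dots> = A $ i $ j - l i * A $ k $ j"
    by (simp add: sum_subtractf)
  finally show ?thesis .
qed

lemma det_elim_matrix:
  fixes l :: "'n::finite \<Rightarrow> 'a::comm_ring_1"
  assumes "l k = 0"
  shows "det (elim_matrix l k) = 1"
proof -
  have "det (elim_matrix l k) = (\<Prod>i\<in>UNIV. elim_matrix l k $ i $ i)"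
    by (rule det_ranked[where g = "\<lambda>i. if i = k then 1 else 0"])
       (use assms in \<open>auto simp: elim_matrix_def split: if_splits\<close>)
  also have "\<dots> = 1"
    by (rule prod.neutral) (use assms in \<open>auto simp: elim_matrix_def\<close>)
  finally show ?thesis .
qed

lemma det_row_elimination:
  fixes A :: "'a::comm_ring_1 ^ 'n ^ 'n"
  assumes "l k = 0"
  shows "det (\<chi> i j. A $ i $ j - l i * A $ k $ j) = det A"
proof -
  have "(\<chi> i j. A $ i $ j - l i * A $ k $ j) = elim_matrix l k ** A"
    by (simp add: vec_eq_iff elim_matrix_mult)
  then show ?thesis using assms by (simp add: det_mul det_elim_matrix)
qed

text \<open>The determinant is affine in every single \<open>a n\<close>, and triangular up to reordering if all the
  \<open>a n\<close> are \<open>0\<close> or \<open>1\<close>.\<close>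

definition fiber_matrix :: "('n::{finite,linorder} \<Rightarrow> 'l) \<Rightarrow> ('n::{finite,linorder} \<Rightarrow> 'a::comm_ring_1) \<Rightarrow>
    ('l \<Rightarrow> 'a) \<Rightarrow> 'a ^ 'n::{finite,linorder} ^ 'n::{finite,linorder}" where
  "fiber_matrix f y a = (\<chi> i j. if f i = f j then a (f i) + (if i = j then y i else if j < i then -1 else 0) else 0)"

lemma det_fiber_matrix_affine:
  fixes a :: "'l \<Rightarrow> 'a::comm_ring_1" and f :: "'n::{finite,linorder} \<Rightarrow> 'l"
  shows "det (fiber_matrix f y a) =
    a n * det (fiber_matrix f y (a(n := 1))) + (1 - a n) * det (fiber_matrix f y (a(n := 0)))"
proof (cases "n \<in> range f")
  case False
  then have "fiber_matrix f y (a(n := s)) = fiber_matrix f y a" for s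
    by (auto simp: fiber_matrix_def vec_eq_iff)
  then show ?thesis by (simp add: algebra_simps)
next
  case True
  then obtain k where k: "f k = n" by auto
  \<comment> \<open>Subtracting row \<open>k\<close> from the other rows of its fiber confines
    \<open>a n\<close> to row \<open>k\<close>, which makes the determinant affine in
    \<open>a n\<close>.\<close>
  define l :: "'n \<Rightarrow> 'a" where "l = (\<lambda>i. if f i = n \<and> i \<noteq> k then 1 else 0)"
  define M where "M = (\<lambda>a. (\<chi> i j. fiber_matrix f y a $ i $ j - l i * fiber_matrix f y a $ k $ j))"
  have det: "det (fiber_matrix f y a') = det (M a')" for a'
    unfolding M_def by (rule det_row_elimination[symmetric]) (simp add: l_def)
  have "det (M a) = a n * det (M (a(n := 1))) + (1 - a n) * det (M (a(n := 0)))"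
  proof (rule det_row_affine[where k = k])
    have "fiber_matrix f y (a(n := s)) $ i $ j - l i * fiber_matrix f y (a(n := s)) $ k $ j =
        fiber_matrix f y (a(n := t)) $ i $ j - l i * fiber_matrix f y (a(n := t)) $ k $ j"
      if "i \<noteq> k" for i j s t
      using that by (cases "f i = n"; cases "f i = f j") (simp_all add: fiber_matrix_def l_def k)
    from this[of _ "a n"] show "M a $ i = M (a(n := 1)) $ i" "M a $ i = M (a(n := 0)) $ i"
      if "i \<noteq> k" for i
      using that by (auto simp: M_def vec_eq_iff)
    show "M a $ k $ j = a n * M (a(n := 1)) $ k $ j + (1 - a n) * M (a(n := 0)) $ k $ j" for j
      by (cases "f j = n") (simp_all add: M_def fiber_matrix_def l_def k algebra_simps)
  qed
  then show ?thesis by (simp add: det)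
qed

lemma det_fiber_matrix_01:
  fixes a :: "'l \<Rightarrow> 'a::comm_ring_1" and f :: "'n::{finite,linorder} \<Rightarrow> 'l"
  assumes "\<And>i. a (f i) = 0 \<or> a (f i) = 1"
  shows "det (fiber_matrix f y a) = (\<Prod>i\<in>UNIV. a (f i) + y i)"
proof -
  have rank: "int (card {k. k < i}) < int (card {k. k < j})" if "i < j" for i j :: 'n
    using that by (simp, intro psubset_card_mono) auto
  have "det (fiber_matrix f y a) = (\<Prod>i\<in>UNIV. fiber_matrix f y a $ i $ i)"
  \<comment> \<open>Within a fiber the matrix is lower triangular where \<open>a\<close> is 0, and
    upper triangular where \<open>a\<close> is 1, because the entries \<open>a - 1\<close> below the
    diagonal vanish. The sign of the rank reverses the order accordingly.\<close>
  proof (rule det_ranked[where g = "\<lambda>i. (if a (f i) = 0 then - 1 else 1) * int (card {k. k < i})"])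
    fix i j assume nz: "fiber_matrix f y a $ i $ j \<noteq> 0"
    then have f: "f i = f j" by (auto simp: fiber_matrix_def split: if_splits)
    have nz': "a (f j) + (if i = j then y i else if j < i then -1 else 0) \<noteq> 0"
      using nz by (simp add: fiber_matrix_def f)
    from assms[of i] nz' rank[of i j] rank[of j i] show "i = j \<or> (if a (f i) = 0 then - 1 else 1) * int (card {k. k < i})
      < (if a (f j) = 0 then - 1 else 1) * int (card {k. k < j})"
      by (cases i j rule: linorder_cases) (auto simp: f split: if_splits)
  qed
  then show ?thesis by (simp add: fiber_matrix_def)
qed

text \<open>Both sides are affine in each \<open>a n\<close>, so the claim is interpolated from the
  values 0 and 1, one index at a time; the set \<open>K\<close> holds the indices that are still
  unrestricted.\<close>

lemma det_fiber_matrix: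
  fixes a :: "'l \<Rightarrow> 'a::comm_ring_1" and f :: "'n::{finite,linorder} \<Rightarrow> 'l"
  assumes "finite I" "range f \<subseteq> I"
  shows "det (fiber_matrix f y a) =
    (\<Prod>n\<in>I. a n * (\<Prod>i | f i = n. y i + 1) + (1 - a n) * (\<Prod>i | f i = n. y i))"
proof -
  have "det (fiber_matrix f y a) = (\<Prod>n\<in>I. a n * (\<Prod>i | f i = n. y i + 1) + (1 - a n) * (\<Prod>i | f i = n. y i))"
    if "finite K" "\<And>n. n \<in> I - K \<Longrightarrow> a n = 0 \<or> a n = 1" for K a
    using that
  proof (induction K arbitrary: a rule: finite_induct)
    case empty
    have "det (fiber_matrix f y a) = (\<Prod>i\<in>UNIV. a (f i) + y i)"
      using empty assms by (intro det_fiber_matrix_01) auto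
    also have "\<dots> = (\<Prod>n\<in>I. \<Prod>i | i \<in> UNIV \<and> f i = n. a (f i) + y i)"
      using assms by (intro prod.group [symmetric]) auto
    also have "\<dots> = (\<Prod>n\<in>I. a n * (\<Prod>i | f i = n. y i + 1) + (1 - a n) * (\<Prod>i | f i = n. y i))"
    proof (rule prod.cong [OF refl])
      fix n assume n: "n \<in> I"
      have eq: "(\<Prod>i | i \<in> UNIV \<and> f i = n. a (f i) + y i) = (\<Prod>i | f i = n. y i + a n)"
        by (rule prod.cong) (auto simp: add.commute)
      show "(\<Prod>i | i \<in> UNIV \<and> f i = n. a (f i) + y i) =
        a n * (\<Prod>i | f i = n. y i + 1) + (1 - a n) * (\<Prod>i | f i = n. y i)"
        unfolding eq using empty(1)[of n] n by auto
    qed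
    finally show ?case .
  next
    case (insert n K)
    define G where "G = (\<lambda>a n. a * (\<Prod>i | f i = n. y i + 1) + (1 - a) * (\<Prod>i | f i = n. y i) :: 'a)"
    have IH: "det (fiber_matrix f y (a(n := s))) = (\<Prod>k\<in>I. G ((a(n := s)) k) k)"
      if "s = 0 \<or> s = 1" for s
      unfolding G_def
    proof (rule insert(3))
      fix k assume "k \<in> I - K"
      then show "(a(n := s)) k = 0 \<or> (a(n := s)) k = 1"
        using insert(4)[of k] that by (cases "k = n") simp_all
    qed
    show ?case
    proof (cases "n \<in> I")
      case True
      have "(\<Prod>k\<in>I. G ((a(n := s)) k) k) = G s n * (\<Prod>k\<in>I - {n}. G (a k) k)" for s
        using assms(1) True by (subst prod.remove[of I n]) auto
      then have "det (fiber_matrix f y a) = (a n * G 1 n + (1 - a n) * G 0 n) * (\<Prod>k\<in>I - {n}. G (a k) k)"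
        by (subst det_fiber_matrix_affine[of f y a n]) (simp add: IH algebra_simps)
      also have "a n * G 1 n + (1 - a n) * G 0 n = G (a n) n" by (simp add: G_def)
      also have "G (a n) n * (\<Prod>k\<in>I - {n}. G (a k) k) = (\<Prod>k\<in>I. G (a k) k)"
        using assms(1) True by (simp add: prod.remove)
      finally show ?thesis by (simp add: G_def)
    qed (use insert in auto)
  qed
  then show ?thesis using assms(1) by blast
qed

section \<open>Quasi-periodic functions\<close>

text \<open>At a zero of \<open>g\<close>, which is simple, both functions are divided by
  \<open>z - a\<close>; the quotient of the results continues \<open>f / g\<close>, with the value
  given by l'Hopital's rule.\<close>

lemma holomorphic_quotient:
  assumes S: "open S" and f: "f holomorphic_on S" and g: "g holomorphic_on S"
    and zero: "\<And>z. z \<in> S \<Longrightarrow> g z = 0 \<Longrightarrow> f z = 0 \<and> deriv g z \<noteq> 0"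
  obtains h where "h holomorphic_on S" "\<And>z. z \<in> S \<Longrightarrow> f z = g z * h z"
proof
  define h where "h = (\<lambda>z. if g z = 0 then deriv f z / deriv g z else f z / g z)"
  show "h holomorphic_on S"
  proof (subst analytic_on_open[OF S, symmetric], subst analytic_on_analytic_at, safe)
    fix a assume a: "a \<in> S"
    show "h analytic_on {a}"
    proof (cases "g a = 0")
      case False
      have "(\<lambda>z. f z / g z) analytic_on {a}"
        using f g S a False by (intro analytic_intros) (auto intro: analytic_on_subset simp: analytic_on_open[OF S, symmetric])
      moreover have "eventually (\<lambda>z. g z \<noteq> 0) (nhds a)"
        using g S a False
        by (metis (full_types) continuous_on_eq_continuous_at holomorphic_on_imp_continuous_on
            tendsto_imp_eventually_ne isCont_def continuous_within tendsto_at_iff_tendsto_nhds)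
      then have "eventually (\<lambda>z. f z / g z = h z) (nhds a)"
        by eventually_elim (simp add: h_def)
      ultimately show ?thesis
        by (metis analytic_at_cong)
    next
      case True
      define f1 where "f1 = (\<lambda>z. if z = a then deriv f a else f z / (z - a))"
      define g1 where "g1 = (\<lambda>z. if z = a then deriv g a else g z / (z - a))"
      have f1: "f1 holomorphic_on S"
        by (rule pole_theorem_open_0[OF f S, of a]) (use zero[OF a True] in \<open>auto simp: f1_def\<close>)
      have g1: "g1 holomorphic_on S"
        by (rule pole_theorem_open_0[OF g S, of a]) (use True in \<open>auto simp: g1_def\<close>)
      have ne: "g1 a \<noteq> 0" using zero[OF a True] by (simp add: g1_def)
      have an: "(\<lambda>z. f1 z / g1 z) analytic_on {a}"
        using f1 g1 S a ne by (intro analytic_intros) (auto intro: analytic_on_subset simp: analytic_on_open[OF S, symmetric])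
      have "eventually (\<lambda>z. g1 z \<noteq> 0) (nhds a)"
        using g1 S a ne
        by (metis (full_types) continuous_on_eq_continuous_at holomorphic_on_imp_continuous_on
            tendsto_imp_eventually_ne isCont_def continuous_within tendsto_at_iff_tendsto_nhds)
      then have "eventually (\<lambda>z. f1 z / g1 z = h z) (nhds a)"
      proof eventually_elim
        case (elim z)
        then show ?case using True by (auto simp: f1_def g1_def h_def split: if_splits)
      qed
      with an show ?thesis by (metis analytic_at_cong)
    qed
  qed
  show "f z = g z * h z" if "z \<in> S" for z
    using zero[OF that] by (auto simp: h_def)
qed

lemma integral_exp_period:
  "((\<lambda>t. exp (\<i> * of_int k * of_real t)) has_integral (if k = 0 then 2 * of_real pi else 0)) {0..2 * pi}"
proof (cases "k = 0")
  case True
  then show ?thesis using has_integral_const_real[of "1 :: complex" 0 "2 * pi"] by (simp add: scaleR_conv_of_real)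
next
  case False
  have "((\<lambda>t. exp (\<i> * of_int k * of_real t)) has_integral
     (exp (\<i> * of_int k * of_real (2 * pi)) / (\<i> * of_int k) - exp (\<i> * of_int k * of_real 0) / (\<i> * of_int k))) {0..2 * pi}"
  proof (rule fundamental_theorem_of_calculus)
    fix t
    show "((\<lambda>t. exp (\<i> * of_int k * of_real t) / (\<i> * of_int k)) has_vector_derivative exp (\<i> * of_int k * of_real t)) (at t within {0..2 * pi})"
      using False by (auto intro!: derivative_eq_intros has_vector_derivative_real_field)
  qed auto
  moreover have "exp (\<i> * of_int k * of_real (2 * pi)) = 1"
    using exp_integer_2pi[of "of_int k"] by (simp add: mult_ac)
  ultimately show ?thesis using False by simp
qed

definition pairs :: "'n::linorder set \<Rightarrow> ('n \<times> 'n) set" where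
  "pairs S = {(i, j). i \<in> S \<and> j \<in> S \<and> i < j}"

lemma prod_pairs_insert:
  assumes "finite S" "\<And>i. i \<in> S \<Longrightarrow> i < m"
  shows "(\<Prod>(i, j)\<in>pairs (insert m S). g i j) = (\<Prod>(i, j)\<in>pairs S. g i j) * (\<Prod>i\<in>S. g i m)"
proof -
  have eq: "pairs (insert m S) = pairs S \<union> (\<lambda>i. (i, m)) ` S"
    using assms(2) by (auto simp: pairs_def dest: less_asym)
  have "finite (pairs S)"
    by (rule finite_subset[of _ "S \<times> S"]) (use assms in \<open>auto simp: pairs_def\<close>)
  moreover have "pairs S \<inter> (\<lambda>i. (i, m)) ` S = {}"
    using assms(2) by (auto simp: pairs_def)
  ultimately show ?thesis
    unfolding eq using assms(1)
    by (subst prod.union_disjoint) (auto simp: prod.reindex inj_on_def)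
qed

lemma prod_square_pairs:
  fixes g :: "'n::linorder \<Rightarrow> 'n \<Rightarrow> 'a::comm_monoid_mult"
  assumes "finite S"
  shows "(\<Prod>i\<in>S. \<Prod>j\<in>S. g i j) = (\<Prod>i\<in>S. g i i) * (\<Prod>(i, j)\<in>pairs S. g i j * g j i)"
  using assms
proof (induction S rule: finite_linorder_max_induct)
  case empty
  then show ?case by (simp add: pairs_def)
next
  case (insert m S)
  then have m: "m \<notin> S" by auto
  show ?case
    using insert m prod_pairs_insert[of S m "\<lambda>i j. g i j * g j i"]
    by (simp add: prod.distrib mult_ac)
qed

locale half_plane =
  fixes \<tau> :: complex
  assumes Im_tau: "Im \<tau> > 0"
begin

text \<open>Here \<open>exp om\<close> is \<open>q\<close>, and \<open>ell\<close> is \<open>- ln \<bar>q\<bar>\<close>.\<close>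

definition ell :: real where "ell = 2 * pi * Im \<tau>"
definition om :: complex where "om = 2 * of_real pi * \<i> * \<tau>"
definition strip :: "complex set" where "strip = {x. \<bar>Re x\<bar> < ell}"

lemma ell_pos: "ell > 0"
  using Im_tau by (simp add: ell_def)

lemma Re_om [simp]: "Re om = - ell"
  by (simp add: om_def ell_def)

lemma open_strip: "open strip"
proof -
  have "strip = {x. Re x < ell} \<inter> {x. Re x > - ell}" by (auto simp: strip_def)
  then show ?thesis by (simp add: open_Int open_halfspace_Re_lt open_halfspace_Re_gt)
qed

lemma connected_strip: "connected strip"
proof -
  have "strip = {x. Re x < ell} \<inter> {x. Re x > - ell}" by (auto simp: strip_def)
  then show ?thesis
    by (simp add: convex_Int convex_connected convex_halfspace_Re_lt convex_halfspace_Re_gt)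
qed

text \<open>After multiplication by a suitable exponential, the modulus of \<open>D\<close> is doubly periodic, so that it
  attains its maximum on the strip.\<close>

lemma strip_quasi_periodic:
  assumes D: "D holomorphic_on strip"
    and per1: "\<And>x. x \<in> strip \<Longrightarrow> D (x + 2 * of_real pi * \<i>) = D x"
    and per2: "\<And>x. 0 < Re x \<Longrightarrow> Re x < ell \<Longrightarrow> D (x + om) = exp (- c) * D x"
  obtains C where "\<And>x. x \<in> strip \<Longrightarrow> D x = C * exp (of_real (Re c / ell) * x)"
proof -
  \<comment> \<open>Translation by \<open>om\<close> lowers the real part by \<open>ell\<close>, so
    the exponential factor of \<open>H\<close> gains the modulus
    \<open>exp (\<beta> * ell) = exp (Re c)\<close>, which offsets the multiplier
    \<open>exp (- c)\<close>.\<close>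
  define \<beta> where "\<beta> = Re c / ell"
  define H where "H = (\<lambda>x. D x * exp (- (of_real \<beta> * x)))"
  have H: "H holomorphic_on strip"
    unfolding H_def by (intro holomorphic_intros D)
  have norm_H: "norm (H x) = norm (D x) * exp (- \<beta> * Re x)" for x
    by (simp add: H_def norm_mult)
  have N1: "norm (H (x + 2 * of_real pi * \<i>)) = norm (H x)" if "x \<in> strip" for x
    using per1[OF that] by (simp add: norm_H)
  have N2: "norm (H (x + om)) = norm (H x)" if "0 < Re x" "Re x < ell" for x
  proof -
    have "- Re c + (- \<beta> * (Re x - ell)) = - \<beta> * Re x"
      using ell_pos by (simp add: \<beta>_def field_simps)
    then show ?thesis
      using per2[OF that] by (simp add: norm_H norm_mult algebra_simps flip: exp_add)
  qed
  have N1n: "norm (H (x + of_nat k * (2 * of_real pi * \<i>))) = norm (H x)" if "x \<in> strip" for x k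
  proof (induction k)
    case (Suc k)
    have "norm (H ((x + of_nat k * (2 * of_real pi * \<i>)) + 2 * of_real pi * \<i>)) = norm (H (x + of_nat k * (2 * of_real pi * \<i>)))"
      by (rule N1) (use that in \<open>simp add: strip_def\<close>)
    then show ?case using Suc by (simp add: algebra_simps)
  qed simp
  have N1i: "norm (H (x + of_int k * (2 * of_real pi * \<i>))) = norm (H x)" if "x \<in> strip" for x k
  proof (cases "k \<ge> 0")
    case True
    then show ?thesis using N1n[OF that, of "nat k"] by simp
  next
    case False
    have "norm (H ((x + of_int k * (2 * of_real pi * \<i>)) + of_nat (nat (- k)) * (2 * of_real pi * \<i>))) = norm (H (x + of_int k * (2 * of_real pi * \<i>)))"
      by (rule N1n) (use that in \<open>simp add: strip_def\<close>)
    then show ?thesis using False by (simp add: algebra_simps)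
  qed
  \<comment> \<open>A compact subset of the open strip that meets every orbit under the two
    translations: at most one step by \<open>om\<close> leads to
    \<open>\<bar>Re x\<bar> \<le> ell/2\<close>, and multiples of the period adjust the imaginary
    part. A maximum on \<open>K\<close> is thus a maximum on the strip.\<close>
  define K where "K = cbox (Complex (- (ell/2)) 0) (Complex (ell/2) (2 * pi))"
  have K: "x \<in> K \<longleftrightarrow> \<bar>Re x\<bar> \<le> ell/2 \<and> 0 \<le> Im x \<and> Im x \<le> 2 * pi" for x
    by (auto simp: K_def in_cbox_complex_iff)
  have Kstrip: "K \<subseteq> strip"
    using ell_pos by (auto simp: K strip_def)
  have "\<exists>p\<in>K. \<forall>x\<in>K. norm (H x) \<le> norm (H p)"
  proof (rule continuous_attains_sup)
    show "compact K" by (simp add: K_def)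
    have "0 \<in> K" using ell_pos by (auto simp: K)
    then show "K \<noteq> {}" by auto
    show "continuous_on K (\<lambda>x. norm (H x))"
      using H Kstrip by (intro continuous_intros) (meson continuous_on_subset holomorphic_on_imp_continuous_on)
  qed
  then obtain p where p: "p \<in> K" "\<And>x. x \<in> K \<Longrightarrow> norm (H x) \<le> norm (H p)" by blast
  have "norm (H x) \<le> norm (H p)" if x: "x \<in> strip" for x
  proof -
    obtain y where y: "\<bar>Re y\<bar> \<le> ell/2" "norm (H y) = norm (H x)"
    proof -
      consider "\<bar>Re x\<bar> \<le> ell/2" | "Re x > ell/2" | "Re x < - (ell/2)" by linarith
      then show ?thesis
      proof cases
        case 1 then show ?thesis using that by blast
      next
        case 2
        then show ?thesis using that[of "x + om"] N2[of x] x ell_pos by (auto simp: strip_def)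
      next
        case 3
        then show ?thesis using that[of "x - om"] N2[of "x - om"] x ell_pos by (auto simp: strip_def)
      qed
    qed
    define k where "k = - \<lfloor>Im y / (2 * pi)\<rfloor>"
    define y' where "y' = y + of_int k * (2 * of_real pi * \<i>)"
    have "norm (H y') = norm (H y)"
      unfolding y'_def by (rule N1i) (use y ell_pos in \<open>auto simp: strip_def\<close>)
    have "Im y' = Im y - of_int \<lfloor>Im y / (2 * pi)\<rfloor> * (2 * pi)" by (simp add: y'_def k_def)
    moreover have "of_int \<lfloor>Im y / (2 * pi)\<rfloor> * (2 * pi) \<le> Im y"
      by (intro floor_divide_lower) simp
    moreover have "Im y < (of_int \<lfloor>Im y / (2 * pi)\<rfloor> + 1) * (2 * pi)"
      by (intro floor_divide_upper) simp
    ultimately have "0 \<le> Im y'" "Im y' \<le> 2 * pi" by (auto simp: algebra_simps)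
    moreover have "Re y' = Re y" by (simp add: y'_def)
    ultimately have "y' \<in> K" using y by (simp add: K)
    then show ?thesis using p(2)[of y'] \<open>norm (H y') = norm (H y)\<close> y by simp
  qed
  then have "H constant_on strip"
    using maximum_modulus_principle[OF H open_strip connected_strip open_strip subset_refl, of p] p(1) Kstrip
    by blast
  then obtain C where C: "\<And>x. x \<in> strip \<Longrightarrow> H x = C" by (auto simp: constant_on_def)
  show ?thesis
  proof
    fix x assume "x \<in> strip"
    from C[OF this] have "D x * exp (- (of_real \<beta> * x)) = C" by (simp add: H_def)
    then show "D x = C * exp (of_real (Re c / ell) * x)"
      by (simp add: \<beta>_def exp_minus field_simps)
  qed
qed

text \<open>If the constant is nonzero, periodicity forces \<open>Re c / ell\<close> to be an
  integer, and \<open>c \<in> strip\<close> makes it 0. Then \<open>D\<close> is constant, which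
  contradicts a multiplier \<open>exp (- c)\<close> different from 1.\<close>

lemma strip_quasi_periodic_zero:
  assumes D: "D holomorphic_on strip"
    and per1: "\<And>x. x \<in> strip \<Longrightarrow> D (x + 2 * of_real pi * \<i>) = D x"
    and per2: "\<And>x. 0 < Re x \<Longrightarrow> Re x < ell \<Longrightarrow> D (x + om) = exp (- c) * D x"
    and c: "c \<in> strip" "exp c \<noteq> 1" and x: "x \<in> strip"
  shows "D x = 0"
proof -
  obtain C where C: "\<And>x. x \<in> strip \<Longrightarrow> D x = C * exp (of_real (Re c / ell) * x)"
    using strip_quasi_periodic[OF D per1 per2] by blast
  have "C = 0"
  proof (rule ccontr)
    assume "C \<noteq> 0"
    have "0 \<in> strip" "2 * of_real pi * \<i> \<in> strip" using ell_pos by (auto simp: strip_def)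
    then have "exp (of_real (Re c / ell) * (2 * of_real pi * \<i>)) = 1"
      using C[of 0] C[of "2 * of_real pi * \<i>"] per1[of 0] \<open>C \<noteq> 0\<close> by simp
    then obtain n :: int where "Im (of_real (Re c / ell) * (2 * of_real pi * \<i>)) = of_int (2 * n) * pi"
      by (auto simp: exp_eq_1)
    then have n: "Re c = of_int n * ell" using ell_pos by (simp add: field_simps)
    have "\<bar>real_of_int n\<bar> * ell < ell" using c(1) ell_pos n by (simp add: strip_def abs_mult)
    then have "n = 0" using ell_pos by simp
    then have "Re c = 0" using n by simp
    then have D: "D x = C" if "x \<in> strip" for x using C[OF that] by simp
    have "of_real (ell/2) \<in> strip" "of_real (ell/2) + om \<in> strip"
      using ell_pos by (auto simp: strip_def)
    then have "C = exp (- c) * C"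
      using per2[of "of_real (ell/2)"] ell_pos by (simp add: D)
    then show False using \<open>C \<noteq> 0\<close> c(2) by (simp add: exp_minus)
  qed
  then show ?thesis using C[OF x] by simp
qed

section \<open>The product expansion of the theta function\<close>

definition fac :: "nat \<Rightarrow> complex \<Rightarrow> complex" where
  "fac n x = (1 - exp (of_nat (Suc n) * om) * exp x) * (1 - exp (of_nat (Suc n) * om) * exp (- x))"

lemma norm_exp_om: "norm (exp (of_nat n * om)) = exp (- ell) ^ n"
  by (simp add: exp_of_nat_mult[symmetric] algebra_simps)

lemma fac_bound:
  assumes "norm (exp x) \<le> B" "norm (exp (- x)) \<le> B"
  shows "norm (fac n x - 1) \<le> (2 * B + 1) * exp (- ell) ^ n"
proof -
  define Q where "Q = exp (of_nat (Suc n) * om)"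
  have nQ: "norm Q = exp (- ell) ^ Suc n" unfolding Q_def by (rule norm_exp_om)
  have l1: "exp (- ell) \<le> 1" using ell_pos by simp
  have Q1: "norm Q \<le> exp (- ell) ^ n"
    unfolding nQ using l1 by (simp add: mult_left_le_one_le)
  have Q2: "norm Q \<le> 1" unfolding nQ using l1 by (intro power_le_one) auto
  have e: "exp x * exp (- x) = 1" by (simp add: exp_minus)
  have "fac n x - 1 = (1 - Q * exp x) * (1 - Q * exp (- x)) - 1"
    by (simp add: fac_def Q_def)
  also have "\<dots> = Q * (Q - exp x - exp (- x))"
    using e by algebra
  finally have "fac n x - 1 = Q * (Q - exp x - exp (- x))" .
  then have eq: "norm (fac n x - 1) = norm Q * norm (Q - exp x - exp (- x))" by (simp add: norm_mult)
  have le: "norm (Q - exp x - exp (- x)) \<le> 1 + B + B"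
    using norm_triangle_ineq4[of "Q - exp x" "exp (- x)"] norm_triangle_ineq4[of Q "exp x"] Q2 assms by linarith
  have "norm (fac n x - 1) \<le> exp (- ell) ^ n * (1 + B + B)"
    unfolding eq by (rule mult_mono[OF Q1 le]) auto
  then show ?thesis by (simp add: algebra_simps)
qed

lemma uniformly_convergent_fac:
  assumes K: "compact K"
  shows "uniformly_convergent_on K (\<lambda>N x. \<Prod>n<N. fac n x)"
proof -
  have "bounded ((\<lambda>x. exp x) ` K)" "bounded ((\<lambda>x. exp (- x)) ` K)"
    by (intro compact_imp_bounded compact_continuous_image continuous_intros K)+
  then obtain B1 B2 where B: "\<And>x. x \<in> K \<Longrightarrow> norm (exp x) \<le> B1" "\<And>x. x \<in> K \<Longrightarrow> norm (exp (- x)) \<le> B2"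
    unfolding bounded_iff by auto
  define B where "B = max B1 B2"
  show ?thesis
  proof (rule uniformly_convergent_on_prod')
    show "continuous_on K (fac n)" for n
      unfolding fac_def by (intro continuous_intros)
    show "compact K" by (rule K)
    show "uniformly_convergent_on K (\<lambda>N x. \<Sum>n<N. norm (fac n x - 1))"
    proof (rule Weierstrass_m_test')
      show "norm (norm (fac n x - 1)) \<le> (2 * B + 1) * exp (- ell) ^ n" if "x \<in> K" for n x
        using fac_bound[of x B n] B[OF that] by (auto simp: B_def)
      show "summable (\<lambda>n. (2 * B + 1) * exp (- ell) ^ n)"
        using ell_pos by (intro summable_mult summable_geometric) simp
    qed
  qed
qed

definition Phi0 :: "complex \<Rightarrow> complex" where
  "Phi0 x = lim (\<lambda>N. \<Prod>n<N. fac n x)"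

lemma uniform_limit_Phi0: "compact K \<Longrightarrow> uniform_limit K (\<lambda>N x. \<Prod>n<N. fac n x) Phi0 sequentially"
  using uniformly_convergent_fac[of K] unfolding Phi0_def uniformly_convergent_uniform_limit_iff .

lemma tendsto_Phi0: "(\<lambda>N. \<Prod>n<N. fac n x) \<longlonglongrightarrow> Phi0 x"
  using tendsto_uniform_limitI[OF uniform_limit_Phi0[of "{x}"]] by simp

lemma holomorphic_Phi0: "Phi0 holomorphic_on A"
proof (rule holomorphic_on_subset)
  show "Phi0 holomorphic_on UNIV"
  proof (rule holomorphic_uniform_sequence)
    show "(\<lambda>x. \<Prod>n<N. fac n x) holomorphic_on UNIV" for N
      unfolding fac_def by (intro holomorphic_intros)
    show "\<exists>d>0. cball x d \<subseteq> UNIV \<and> uniform_limit (cball x d) (\<lambda>N x. \<Prod>n<N. fac n x) Phi0 sequentially" for x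
      by (intro exI[of _ 1]) (auto intro: uniform_limit_Phi0)
  qed auto
qed auto

lemma exp_om_ne_1:
  assumes "x \<in> strip"
  shows "exp (of_nat (Suc n) * om) * exp x \<noteq> 1"
proof
  assume "exp (of_nat (Suc n) * om) * exp x = 1"
  then have "exp (of_nat (Suc n) * om + x) = 1" by (simp add: exp_add)
  then have "Re (of_nat (Suc n) * om + x) = 0" by (simp only: exp_eq_1)
  then have "Re x = real (Suc n) * ell" by (simp add: algebra_simps)
  moreover have "real (Suc n) * ell \<ge> 1 * ell" using ell_pos by (intro mult_right_mono) auto
  ultimately show False using assms by (auto simp: strip_def)
qed

lemma uminus_in_strip [simp]: "- x \<in> strip \<longleftrightarrow> x \<in> strip"
  by (simp add: strip_def)

lemma fac_nonzero: "x \<in> strip \<Longrightarrow> fac n x \<noteq> 0"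
  using exp_om_ne_1[of x n] exp_om_ne_1[of "- x" n] by (auto simp: fac_def)

lemma Phi0_nonzero:
  assumes "x \<in> strip"
  shows "Phi0 x \<noteq> 0"
proof -
  define B where "B = max (norm (exp x)) (norm (exp (- x)))"
  have "summable (\<lambda>n. norm (fac n x - 1))"
  proof (rule summable_comparison_test')
    show "summable (\<lambda>n. (2 * B + 1) * exp (- ell) ^ n)"
      using ell_pos by (intro summable_mult summable_geometric) simp
    show "norm (norm (fac n x - 1)) \<le> (2 * B + 1) * exp (- ell) ^ n" for n
      using fac_bound[of x B n] by (auto simp: B_def)
  qed
  then have conv: "convergent_prod (\<lambda>n. fac n x)"
    by (intro abs_convergent_prod_imp_convergent_prod summable_imp_abs_convergent_prod)
  then have "(\<lambda>N. \<Prod>n\<le>N. fac n x) \<longlonglongrightarrow> prodinf (\<lambda>n. fac n x)"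
    by (rule convergent_prod_LIMSEQ)
  then have "Phi0 x = prodinf (\<lambda>n. fac n x)"
    using tendsto_Phi0[of x] by (metis LIMSEQ_lessThan_iff_atMost LIMSEQ_unique)
  then show ?thesis
    using prodinf_nonzero[OF conv] fac_nonzero[OF assms] by simp
qed

text \<open>In the finite products the translation moves one of the two families of factors up by
  one index and the other down, so only boundary factors differ. The identity is stated without
  division because the factors may vanish.\<close>

lemma Phi0_quasi:
  "Phi0 (x + om) * (1 - exp om * exp x) = Phi0 x * (1 - exp (- x))"
proof -
  have fin: "(\<Prod>n<N. fac n (x + om)) * ((1 - exp om * exp x) * (1 - exp (of_nat N * om) * exp (- x))) =
     (\<Prod>n<N. fac n x) * ((1 - exp (of_nat (Suc N) * om) * exp x) * (1 - exp (- x)))" for N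
  proof (induction N)
    case (Suc N)
    have f1: "fac N (x + om) = (1 - exp (of_nat (Suc (Suc N)) * om) * exp x) * (1 - exp (of_nat N * om) * exp (- x))"
    proof -
      have "exp (of_nat (Suc N) * om) * exp (x + om) = exp (of_nat (Suc (Suc N)) * om) * exp x"
        "exp (of_nat (Suc N) * om) * exp (- (x + om)) = exp (of_nat N * om) * exp (- x)"
        by (simp_all flip: exp_add) (simp_all add: algebra_simps)
      then show ?thesis by (simp add: fac_def)
    qed
    have f2: "fac N x = (1 - exp (of_nat (Suc N) * om) * exp x) * (1 - exp (of_nat (Suc N) * om) * exp (- x))"
      by (simp add: fac_def)
    have "(\<Prod>n<Suc N. fac n (x + om)) * ((1 - exp om * exp x) * (1 - exp (of_nat (Suc N) * om) * exp (- x))) =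
      ((\<Prod>n<N. fac n (x + om)) * ((1 - exp om * exp x) * (1 - exp (of_nat N * om) * exp (- x)))) *
      ((1 - exp (of_nat (Suc (Suc N)) * om) * exp x) * (1 - exp (of_nat (Suc N) * om) * exp (- x)))"
      by (simp only: prod.lessThan_Suc f1 mult_ac)
    also have "\<dots> = (\<Prod>n<Suc N. fac n x) * ((1 - exp (of_nat (Suc (Suc N)) * om) * exp x) * (1 - exp (- x)))"
      by (subst Suc.IH) (simp only: prod.lessThan_Suc f2 mult_ac)
    finally show ?case .
  qed (simp add: mult_ac)
  have q0: "(\<lambda>N. exp (of_nat N * om)) \<longlonglongrightarrow> 0"
  proof (rule tendsto_norm_zero_cancel)
    show "(\<lambda>N. norm (exp (of_nat N * om))) \<longlonglongrightarrow> 0"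
      unfolding norm_exp_om using ell_pos by (intro LIMSEQ_realpow_zero) auto
  qed
  have "(\<lambda>N. (\<Prod>n<N. fac n (x + om)) * ((1 - exp om * exp x) * (1 - exp (of_nat N * om) * exp (- x))))
      \<longlonglongrightarrow> Phi0 (x + om) * ((1 - exp om * exp x) * (1 - 0 * exp (- x)))"
    by (intro tendsto_intros tendsto_Phi0 q0)
  moreover have "(\<lambda>N. (\<Prod>n<N. fac n x) * ((1 - exp (of_nat (Suc N) * om) * exp x) * (1 - exp (- x))))
      \<longlonglongrightarrow> Phi0 x * ((1 - 0 * exp x) * (1 - exp (- x)))"
    by (intro tendsto_intros tendsto_Phi0 LIMSEQ_Suc[OF q0])
  ultimately show ?thesis
    unfolding fin by (auto dest: LIMSEQ_unique)
qed

lemma Phi0_uminus: "Phi0 (- x) = Phi0 x"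
  unfolding Phi0_def fac_def by (simp add: mult.commute)

lemma Phi0_2pii: "Phi0 (x + 2 * of_real pi * \<i>) = Phi0 x"
  unfolding Phi0_def fac_def by (simp add: exp_add exp_minus exp_diff)

text \<open>\<open>sh x\<close> is \<open>2 * sinh (x / 2)\<close>, and \<open>P\<close> is the
  Jacobi product for theta; division by \<open>Phi0 0\<close> makes its derivative at 0 equal to
  1.\<close>

definition Phi :: "complex \<Rightarrow> complex" where "Phi x = Phi0 x / Phi0 0"
definition sh :: "complex \<Rightarrow> complex" where "sh x = exp (x / 2) - exp (- (x / 2))"
definition P :: "complex \<Rightarrow> complex" where "P x = sh x * Phi x"

lemma zero_in_strip [simp]: "0 \<in> strip"
  using ell_pos by (simp add: strip_def)

lemma holomorphic_Phi [holomorphic_intros]: "Phi holomorphic_on A"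
  unfolding Phi_def using Phi0_nonzero[of 0] by (intro holomorphic_intros holomorphic_Phi0) auto

lemma holomorphic_sh [holomorphic_intros]: "sh holomorphic_on A"
  unfolding sh_def by (intro holomorphic_intros) auto

lemma holomorphic_P: "P holomorphic_on A"
  unfolding P_def by (intro holomorphic_intros)

lemma Phi_0 [simp]: "Phi 0 = 1"
  using Phi0_nonzero[of 0] by (simp add: Phi_def)

lemma Phi_nonzero: "x \<in> strip \<Longrightarrow> Phi x \<noteq> 0"
  using Phi0_nonzero by (simp add: Phi_def)

lemma sh_uminus: "sh (- x) = - sh x"
  by (simp add: sh_def)

lemma P_uminus: "P (- x) = - P x"
  by (simp add: P_def Phi_def Phi0_uminus sh_uminus)

lemma exp_half_add_pii: "exp ((x + 2 * of_real pi * \<i>) / 2) = - exp (x / 2)"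
proof -
  have "exp ((x + 2 * of_real pi * \<i>) / 2) = exp (x / 2 + of_real pi * \<i>)"
    by (rule arg_cong[where f = exp]) (simp add: field_simps)
  then show ?thesis by (simp add: exp_add)
qed

lemma sh_2pii: "sh (x + 2 * of_real pi * \<i>) = - sh x"
  by (simp add: sh_def exp_half_add_pii exp_minus del: add_divide_distrib)

lemma P_2pii: "P (x + 2 * of_real pi * \<i>) = - P x"
  by (simp add: P_def Phi_def Phi0_2pii sh_2pii)

lemma exp_half_sq: "exp (x / 2) * exp (x / 2) = exp (x :: complex)"
  by (simp flip: exp_add)

lemma sh_eq: "sh x = - exp (- (x / 2)) * (1 - exp x)" "sh x = exp (x / 2) * (1 - exp (- x))"
  using exp_half_sq[of x] exp_half_sq[of "- x"]
  by (auto simp: sh_def field_simps exp_minus)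

lemma sh_eq_0_iff: "sh x = 0 \<longleftrightarrow> exp x = 1"
  by (simp add: sh_eq)

lemma P_om: "P (x + om) = - exp (- (om / 2)) * exp (- x) * P x"
proof (cases "exp (x + om) = 1")
  case True
  then have "sh (x + om) = 0" by (simp add: sh_eq_0_iff)
  moreover have "exp om * exp x = 1" using True by (simp add: exp_add mult.commute)
  then have "Phi0 x * (1 - exp (- x)) = 0" using Phi0_quasi[of x] by simp
  moreover have "exp (- x) \<noteq> 1"
  proof
    assume "exp (- x) = 1"
    then have "exp om = 1" using \<open>exp om * exp x = 1\<close> by (simp add: exp_minus)
    then show False using ell_pos by (simp add: exp_eq_1)
  qed
  ultimately show ?thesis by (simp add: P_def Phi_def)
next
  case False
  have "P (x + om) = - exp (- ((x + om) / 2)) * ((Phi0 (x + om) * (1 - exp om * exp x)) / Phi0 0)"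
    by (simp add: P_def Phi_def sh_eq(1)[of "x + om"] exp_add[of x om] mult_ac)
  also have "\<dots> = - exp (- ((x + om) / 2)) * (1 - exp (- x)) * Phi x"
    unfolding Phi0_quasi by (simp add: Phi_def mult_ac)
  also have "exp (- ((x + om) / 2)) = exp (- (om / 2)) * exp (- x) * exp (x / 2)"
  proof -
    have "- ((x + om) / 2) = - (om / 2) + - x + x / 2" by (simp add: field_simps)
    then show ?thesis by (simp only: exp_add)
  qed
  finally show ?thesis by (simp add: P_def sh_eq(2)[of x] mult_ac)
qed

lemma P_eq_0_strip: "x \<in> strip \<Longrightarrow> P x = 0 \<longleftrightarrow> exp x = 1"
  using Phi_nonzero[of x] by (simp add: P_def sh_eq_0_iff)

lemma deriv_P_strip:
  assumes "exp x = 1"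
  shows "deriv P x = exp (x / 2) * Phi x"
proof -
  have "(Phi has_field_derivative deriv Phi x) (at x)"
    using holomorphic_Phi[of UNIV] by (intro holomorphic_derivI) auto
  moreover have "(sh has_field_derivative (exp (x / 2) + exp (- (x / 2))) / 2) (at x)"
    unfolding sh_def by (auto intro!: derivative_eq_intros simp: field_simps)
  ultimately have "(P has_field_derivative (sh x * deriv Phi x + (exp (x / 2) + exp (- (x / 2))) / 2 * Phi x)) (at x)"
    unfolding P_def by (auto intro!: derivative_eq_intros)
  moreover have "sh x = 0" using assms by (simp add: sh_eq_0_iff)
  moreover from this have "exp (- (x / 2)) = exp (x / 2)" by (simp add: sh_def)
  ultimately show ?thesis by (auto dest: DERIV_imp_deriv)
qed

lemma P_0 [simp]: "P 0 = 0"
  by (simp add: P_eq_0_strip)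

lemma deriv_P_0: "deriv P 0 = 1"
  by (simp add: deriv_P_strip)


section \<open>The theta series as a multiple of the product\<close>

definition scoeff :: "nat \<Rightarrow> complex" where
  "scoeff n = (-1) ^ n * exp (om * (of_nat n + 1/2)\<^sup>2 / 2)"

text \<open>The indices \<open>n\<close> and \<open>- 1 - n\<close> of the theta series carry
  opposite coefficients and opposite exponents; \<open>sterm n\<close> is the sum of the two
  terms.\<close>

definition sterm :: "nat \<Rightarrow> complex \<Rightarrow> complex" where
  "sterm n x = scoeff n * (exp ((of_nat n + 1/2) * x) - exp (- ((of_nat n + 1/2) * x)))"

definition ser :: "complex \<Rightarrow> complex" where
  "ser x = (\<Sum>n. sterm n x)"

lemma norm_scoeff: "norm (scoeff n) = exp (- (ell * (real n + 1/2)\<^sup>2 / 2))"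
proof -
  have "Re (om * (of_nat n + 1/2)\<^sup>2 / 2) = - (ell * (real n + 1/2)\<^sup>2 / 2)"
  proof -
    have "om * (of_nat n + 1/2)\<^sup>2 / 2 = om * of_real ((real n + 1/2)\<^sup>2 / 2)" by simp
    then show ?thesis by (simp only: Re_complex_of_real Im_complex_of_real times_complex.sel Re_om)
  qed
  then show ?thesis by (simp add: scoeff_def norm_mult norm_power)
qed

text \<open>Completing the square bounds \<open>(R + 1) * t - ell * t\<^sup>2 / 2\<close> by
  \<open>(R + 1)\<^sup>2 / (2 * ell)\<close> for \<open>t = n + 1/2\<close>. The 1 added to
  \<open>R\<close> leaves the factor \<open>exp (- t)\<close>, which is geometric in
  \<open>n\<close>.\<close>

definition gbound :: "real \<Rightarrow> nat \<Rightarrow> real" where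
  "gbound R n = exp ((R + 1)\<^sup>2 / (2 * ell)) * exp (- 1/2) * exp (- 1) ^ n"

lemma summable_gbound: "summable (gbound R)"
  unfolding gbound_def by (intro summable_mult summable_geometric) simp

lemma scoeff_bound: "norm (scoeff n) * exp (R * (real n + 1/2)) \<le> gbound R n"
proof -
  define t where "t = real n + 1/2"
  have "0 \<le> (ell * t - (R + 1))\<^sup>2 / (2 * ell)" using ell_pos by simp
  also have "\<dots> = (R + 1)\<^sup>2 / (2 * ell) - (R + 1) * t + ell * t\<^sup>2 / 2"
    using ell_pos by (simp add: field_simps power2_eq_square)
  also have "(R + 1) * t = R * t + (real n + 1/2)" by (simp add: t_def algebra_simps)
  finally have "- (ell * t\<^sup>2 / 2) + R * t \<le> (R + 1)\<^sup>2 / (2 * ell) + (- 1/2) + real n * (- 1)"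
    by linarith
  then have "exp (- (ell * t\<^sup>2 / 2) + R * t) \<le> exp ((R + 1)\<^sup>2 / (2 * ell) + (- 1/2) + real n * (- 1))"
    by simp
  then show ?thesis
    by (simp only: norm_scoeff gbound_def exp_add exp_of_nat_mult t_def)
qed

lemma sterm_bound:
  assumes "\<bar>Re x\<bar> \<le> R"
  shows "norm (scoeff n * exp ((of_nat n + 1/2) * x)) \<le> gbound R n"
    "norm (scoeff n * exp (- ((of_nat n + 1/2) * x))) \<le> gbound R n"
    "norm (sterm n x) \<le> 2 * gbound R n"
proof -
  have e: "norm (exp ((of_nat n + 1/2) * x)) \<le> exp (R * (real n + 1/2))"
    "norm (exp (- ((of_nat n + 1/2) * x))) \<le> exp (R * (real n + 1/2))"
  proof -
    have "(real n + 1/2) * Re x \<le> (real n + 1/2) * R" "(real n + 1/2) * (- Re x) \<le> (real n + 1/2) * R"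
      using assms by (intro mult_left_mono; auto)+
    then show "norm (exp ((of_nat n + 1/2) * x)) \<le> exp (R * (real n + 1/2))"
      "norm (exp (- ((of_nat n + 1/2) * x))) \<le> exp (R * (real n + 1/2))"
      by (simp_all add: algebra_simps)
  qed
  show 1: "norm (scoeff n * exp ((of_nat n + 1/2) * x)) \<le> gbound R n"
    unfolding norm_mult by (rule order_trans[OF mult_left_mono[OF e(1)] scoeff_bound]) simp
  show 2: "norm (scoeff n * exp (- ((of_nat n + 1/2) * x))) \<le> gbound R n"
    unfolding norm_mult by (rule order_trans[OF mult_left_mono[OF e(2)] scoeff_bound]) simp
  show "norm (sterm n x) \<le> 2 * gbound R n"
    unfolding sterm_def right_diff_distrib
    using norm_triangle_ineq4 1 2 by (smt (verit, best))
qed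

lemma uniform_limit_ser: "uniform_limit {x. \<bar>Re x\<bar> \<le> R} (\<lambda>N x. \<Sum>n<N. sterm n x) ser sequentially"
  unfolding ser_def
proof (rule Weierstrass_m_test)
  show "norm (sterm n x) \<le> 2 * gbound R n" if "x \<in> {x. \<bar>Re x\<bar> \<le> R}" for n x
    using sterm_bound(3) that by simp
qed (intro summable_mult summable_gbound)

lemma holomorphic_ser: "ser holomorphic_on A"
proof (rule holomorphic_on_subset)
  show "ser holomorphic_on UNIV"
  proof (rule holomorphic_uniform_sequence)
    show "(\<lambda>x. \<Sum>n<N. sterm n x) holomorphic_on UNIV" for N
      unfolding sterm_def by (intro holomorphic_intros)
    show "\<exists>d>0. cball x d \<subseteq> UNIV \<and> uniform_limit (cball x d) (\<lambda>N x. \<Sum>n<N. sterm n x) ser sequentially" for x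
    proof (intro exI[of _ 1] conjI)
      have "cball x 1 \<subseteq> {y. \<bar>Re y\<bar> \<le> \<bar>Re x\<bar> + 1}"
      proof
        fix y assume "y \<in> cball x 1"
        then have "\<bar>Re (x - y)\<bar> \<le> 1" using abs_Re_le_cmod[of "x - y"] by (simp add: dist_norm)
        then show "y \<in> {y. \<bar>Re y\<bar> \<le> \<bar>Re x\<bar> + 1}" by simp
      qed
      then show "uniform_limit (cball x 1) (\<lambda>N x. \<Sum>n<N. sterm n x) ser sequentially"
        using uniform_limit_on_subset[OF uniform_limit_ser] by blast
    qed auto
  qed auto
qed auto

lemma ser_summable:
  "summable (\<lambda>n. norm (scoeff n * exp ((of_nat n + 1/2) * x)))"
  "summable (\<lambda>n. norm (scoeff n * exp (- ((of_nat n + 1/2) * x))))"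
  by (rule summable_comparison_test'[OF summable_gbound[of "\<bar>Re x\<bar>"]],
      use sterm_bound[of x "\<bar>Re x\<bar>"] in auto)+

lemma has_sum_int_nat:
  fixes f :: "int \<Rightarrow> 'a :: banach"
  assumes "summable (\<lambda>n. norm (f (int n)))" "summable (\<lambda>n. norm (f (- 1 - int n)))"
  shows "(f has_sum ((\<Sum>n. f (int n)) + (\<Sum>n. f (- 1 - int n)))) UNIV"
proof -
  have 1: "(f has_sum (\<Sum>n. f (int n))) (range int)"
    using norm_summable_imp_has_sum[OF assms(1) summable_sums[OF summable_norm_cancel[OF assms(1)]]]
    by (subst has_sum_reindex) (auto simp: o_def)
  have 2: "(f has_sum (\<Sum>n. f (- 1 - int n))) (range (\<lambda>n. - 1 - int n))"
    using norm_summable_imp_has_sum[OF assms(2) summable_sums[OF summable_norm_cancel[OF assms(2)]]]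
    by (subst has_sum_reindex) (auto simp: o_def inj_on_def)
  have "x \<in> range int \<union> range (\<lambda>n. - 1 - int n)" for x
  proof (cases "x \<ge> 0")
    case True then show ?thesis by (auto intro: image_eqI[of _ _ "nat x"])
  next
    case False
    then have "x = - 1 - int (nat (- 1 - x))" by simp
    then show ?thesis by blast
  qed
  then have "range int \<union> range (\<lambda>n. - 1 - int n) = UNIV" by blast
  moreover have "int n \<noteq> - 1 - int m" for n m by linarith
  then have "range int \<inter> range (\<lambda>n. - 1 - int n) = {}" by blast
  ultimately show ?thesis
    using has_sum_Un_disjoint[OF 1 2] by simp
qed

lemma theta_coeff_eq:
  "theta_coeff \<tau> (int n) = scoeff n" "theta_coeff \<tau> (- 1 - int n) = - scoeff n"
proof -
  show "theta_coeff \<tau> (int n) = scoeff n"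
    by (simp add: theta_coeff_def scoeff_def om_def)
  have "(-1 :: complex) powi (- 1 - int n) = - ((-1) ^ n)"
    using power_int_minus[of "-1 :: complex" "int (Suc n)"]
    by (simp add: power_inverse[symmetric] del: power_inverse)
       (simp add: power_int_def algebra_simps nat_add_distrib flip: power_inverse)
  moreover have "(of_int (- 1 - int n) + 1/2 :: complex)\<^sup>2 = (of_nat n + 1/2)\<^sup>2"
    by (simp add: power2_eq_square algebra_simps)
  ultimately show "theta_coeff \<tau> (- 1 - int n) = - scoeff n"
    by (simp add: theta_coeff_def scoeff_def om_def)
qed

lemma infsum_theta_num: "(\<Sum>\<^sub>\<infinity>m::int. theta_coeff \<tau> m * exp ((of_int m + 1/2) * x)) = ser x"
proof -
  let ?f = "\<lambda>m::int. theta_coeff \<tau> m * exp ((of_int m + 1/2) * x)"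
  have f1: "?f (int n) = scoeff n * exp ((of_nat n + 1/2) * x)" for n
    by (simp add: theta_coeff_eq)
  have f2: "?f (- 1 - int n) = - (scoeff n * exp (- ((of_nat n + 1/2) * x)))" for n
  proof -
    have "(of_int (- 1 - int n) + 1/2) * x = - ((of_nat n + 1/2) * x)" by (simp add: algebra_simps)
    then show ?thesis by (simp only: theta_coeff_eq) simp
  qed
  have "(?f has_sum ((\<Sum>n. ?f (int n)) + (\<Sum>n. ?f (- 1 - int n)))) UNIV"
    by (rule has_sum_int_nat) (use ser_summable[of x] in \<open>simp_all only: f1 f2 norm_minus_cancel\<close>)
  then have "infsum ?f UNIV = (\<Sum>n. ?f (int n)) + (\<Sum>n. ?f (- 1 - int n))" by (rule infsumI)
  also have "\<dots> = (\<Sum>n. scoeff n * exp ((of_nat n + 1/2) * x) + - (scoeff n * exp (- ((of_nat n + 1/2) * x))))"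
    unfolding f1 f2 using ser_summable[of x, THEN summable_norm_cancel]
    by (intro suminf_add summable_minus) auto
  also have "\<dots> = ser x" by (simp add: ser_def sterm_def right_diff_distrib)
  finally show ?thesis .
qed

lemma summable_scoeff: "summable (\<lambda>n. norm (scoeff n * (of_nat n + 1/2)))"
proof (rule summable_comparison_test'[OF summable_gbound[of 1]])
  fix n
  have "norm (of_nat n + 1/2 :: complex) = real n + 1/2"
  proof -
    have "(of_nat n + 1/2 :: complex) = of_real (real n + 1/2)" by simp
    then show ?thesis by (simp only: norm_of_real)
  qed
  also have "\<dots> \<le> exp (1 * (real n + 1/2))" using exp_ge_add_one_self[of "real n + 1/2"] by simp
  finally show "norm (norm (scoeff n * (of_nat n + 1/2))) \<le> gbound 1 n"
    by (auto simp: norm_mult intro: order_trans[OF mult_left_mono scoeff_bound])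
qed

text \<open>Uniform convergence near 0 permits termwise differentiation, where the two indices
  folded into one term contribute equally. The normalization of theta is thus division by
  \<open>deriv ser 0\<close>.\<close>

lemma infsum_theta_den: "(\<Sum>\<^sub>\<infinity>m::int. theta_coeff \<tau> m * (of_int m + 1/2)) = deriv ser 0"
proof -
  let ?f = "\<lambda>m::int. theta_coeff \<tau> m * (of_int m + 1/2)"
  have f1: "?f (int n) = scoeff n * (of_nat n + 1/2)" for n
    by (simp add: theta_coeff_eq)
  have f2: "?f (- 1 - int n) = scoeff n * (of_nat n + 1/2)" for n
    by (simp only: theta_coeff_eq) (simp add: algebra_simps)
  have "(?f has_sum ((\<Sum>n. ?f (int n)) + (\<Sum>n. ?f (- 1 - int n)))) UNIV"
    by (rule has_sum_int_nat) (use summable_scoeff in \<open>simp_all only: f1 f2\<close>)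
  then have "infsum ?f UNIV = (\<Sum>n. ?f (int n)) + (\<Sum>n. ?f (- 1 - int n))" by (rule infsumI)
  also have "\<dots> = (\<Sum>n. scoeff n * (of_nat n + 1/2) + scoeff n * (of_nat n + 1/2))"
    unfolding f1 f2 using summable_scoeff[THEN summable_norm_cancel] by (intro suminf_add) auto
  finally have *: "infsum ?f UNIV = (\<Sum>n. scoeff n * (of_nat n + 1/2) + scoeff n * (of_nat n + 1/2))" .
  have "(\<lambda>N. (deriv ^^ 1) (\<lambda>x. \<Sum>n<N. sterm n x) 0) \<longlonglongrightarrow> (deriv ^^ 1) ser 0"
  proof (rule higher_deriv_complex_uniform_limit)
    show "uniform_limit (ball 0 1) (\<lambda>N x. \<Sum>n<N. sterm n x) ser sequentially"
    proof (rule uniform_limit_on_subset[OF uniform_limit_ser[of 1]])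
      show "ball 0 1 \<subseteq> {x. \<bar>Re x\<bar> \<le> 1}"
        by (auto intro: order_trans[OF abs_Re_le_cmod])
    qed
    show "\<forall>\<^sub>F N in sequentially. (\<lambda>x. \<Sum>n<N. sterm n x) holomorphic_on ball 0 1"
      unfolding sterm_def by (intro always_eventually allI holomorphic_intros)
  qed auto
  moreover have "deriv (\<lambda>x. \<Sum>n<N. sterm n x) 0 = (\<Sum>n<N. scoeff n * (of_nat n + 1/2) + scoeff n * (of_nat n + 1/2))" for N
  proof (rule DERIV_imp_deriv)
    have "(sterm n has_field_derivative (scoeff n * (of_nat n + 1/2) + scoeff n * (of_nat n + 1/2))) (at 0)" for n
    proof -
      have "((\<lambda>x. scoeff n * (exp (a * x) - exp (- (a * x)))) has_field_derivative
          scoeff n * (exp (a * 0) * a - exp (- (a * 0)) * - a)) (at 0)" for a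
        by (intro derivative_intros DERIV_cmult)
           (auto intro!: derivative_eq_intros)
      from this[of "of_nat n + 1/2"] show ?thesis
        by (simp add: sterm_def[abs_def] distrib_left mult_ac)
    qed
    then show "((\<lambda>x. \<Sum>n<N. sterm n x) has_field_derivative
        (\<Sum>n<N. scoeff n * (of_nat n + 1/2) + scoeff n * (of_nat n + 1/2))) (at 0)"
      by (intro DERIV_sum)
  qed
  ultimately have "(\<lambda>N. \<Sum>n<N. scoeff n * (of_nat n + 1/2) + scoeff n * (of_nat n + 1/2)) \<longlonglongrightarrow> deriv ser 0"
    by simp
  then have "(\<lambda>n. scoeff n * (of_nat n + 1/2) + scoeff n * (of_nat n + 1/2)) sums deriv ser 0"
    by (simp only: sums_def)
  then show ?thesis unfolding * by (rule sums_unique[symmetric])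
qed

lemma ser_uminus: "ser (- x) = - ser x"
proof -
  have "sterm n (- x) = - sterm n x" for n by (simp add: sterm_def algebra_simps)
  moreover have "summable (\<lambda>n. sterm n x)"
    using sterm_bound(3)[of x "\<bar>Re x\<bar>"]
    by (intro summable_comparison_test'[OF summable_mult[OF summable_gbound]]) auto
  ultimately show ?thesis by (simp add: ser_def suminf_minus)
qed

lemma ser_2pii: "ser (x + 2 * of_real pi * \<i>) = - ser x"
proof -
  have e: "exp ((of_nat n + 1/2) * (x + 2 * of_real pi * \<i>)) = - exp ((of_nat n + 1/2) * x)" for n
  proof -
    have "(of_nat n + 1/2) * (x + 2 * of_real pi * \<i>) = (of_nat n + 1/2) * x + of_real pi * \<i> + of_nat n * (2 * of_real pi * \<i>)"
      by (simp add: algebra_simps)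
    then show ?thesis by (simp add: exp_add exp_of_nat_mult)
  qed
  have "sterm n (x + 2 * of_real pi * \<i>) = - sterm n x" for n
    by (simp only: sterm_def e exp_minus) (simp add: algebra_simps)
  moreover have "summable (\<lambda>n. sterm n x)"
    using sterm_bound(3)[of x "\<bar>Re x\<bar>"]
    by (intro summable_comparison_test'[OF summable_mult[OF summable_gbound]]) auto
  ultimately show ?thesis by (simp add: ser_def suminf_minus)
qed

text \<open>Completing the square in the exponent turns the translation by \<open>om\<close> into
  the shift \<open>m + 1\<close> of the summation index. The shift needs the sum over all integers,
  hence the return from \<open>sterm\<close> to it.\<close>

lemma ser_om: "ser (x + om) = - exp (- (om / 2)) * exp (- x) * ser x"
proof -
  define g where "g = (\<lambda>y m. theta_coeff \<tau> m * exp ((of_int m + 1/2) * y))"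
  have ser: "ser y = (\<Sum>\<^sub>\<infinity>m::int. g y m)" for y
    unfolding g_def by (rule infsum_theta_num[symmetric])
  have shift: "g (x + om) m = - exp (- (om / 2)) * exp (- x) * g x (m + 1)" for m
  proof -
    have "(-1 :: complex) powi (m + 1) = - ((-1) powi m)"
      by (subst power_int_add) auto
    moreover have "2 * of_real pi * \<i> * \<tau> * ((of_int m + 1/2)\<^sup>2 / 2) + (of_int m + 1/2) * (x + om) =
       - (om / 2) + - x + (2 * of_real pi * \<i> * \<tau> * ((of_int (m + 1) + 1/2)\<^sup>2 / 2) + (of_int (m + 1) + 1/2) * x)"
      by (simp add: om_def power2_eq_square field_simps)
    then have "exp (2 * of_real pi * \<i> * \<tau> * ((of_int m + 1/2)\<^sup>2 / 2)) * exp ((of_int m + 1/2) * (x + om)) =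
       exp (- (om / 2)) * exp (- x) * (exp (2 * of_real pi * \<i> * \<tau> * ((of_int (m + 1) + 1/2)\<^sup>2 / 2)) * exp ((of_int (m + 1) + 1/2) * x))"
      by (simp only: flip: exp_add)
    ultimately show ?thesis
      by (simp add: g_def theta_coeff_def mult_ac)
  qed
  have "ser (x + om) = (\<Sum>\<^sub>\<infinity>m::int. - exp (- (om / 2)) * exp (- x) * g x (m + 1))"
    by (simp only: ser shift)
  also have "\<dots> = - exp (- (om / 2)) * exp (- x) * (\<Sum>\<^sub>\<infinity>m::int. g x (m + 1))"
    by (rule infsum_cmult_right')
  also have "(\<Sum>\<^sub>\<infinity>m::int. g x (m + 1)) = ser x"
    unfolding ser by (rule infsum_reindex_bij_witness[where i = "\<lambda>m. m - 1" and j = "\<lambda>m. m + 1"]) auto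
  finally show ?thesis .
qed

text \<open>The Fourier coefficient of index \<open>1/2\<close> of the series is not zero.\<close>

lemma ser_nonzero: "\<exists>x. ser x \<noteq> 0"
proof (rule ccontr)
  assume "\<not> ?thesis"
  then have zero: "ser x = 0" for x by simp
  \<comment> \<open>The exponential factor makes all frequencies integral: they become
    \<open>n\<close> and \<open>- 1 - n\<close>, and only \<open>n = 0\<close> has a nonzero
    mean.\<close>
  define f where "f = (\<lambda>N t. (\<Sum>n<N. sterm n (\<i> * of_real t)) * exp (- (\<i> * of_real t / 2)))"
  have "uniform_limit {0..2 * pi} (\<lambda>N t. (\<Sum>n<N. sterm n (\<i> * of_real t))) (\<lambda>t. ser (\<i> * of_real t)) sequentially"
  proof (rule uniform_limitI)
    fix e :: real assume "e > 0"
    from uniform_limitD[OF uniform_limit_ser[of 0] this]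
    show "\<forall>\<^sub>F N in sequentially. \<forall>t\<in>{0..2 * pi}. dist (\<Sum>n<N. sterm n (\<i> * of_real t)) (ser (\<i> * of_real t)) < e"
      by eventually_elim simp
  qed
  then have "uniform_limit {0..2 * pi} f (\<lambda>t. ser (\<i> * of_real t) * exp (- (\<i> * of_real t / 2))) sequentially"
    unfolding f_def
    by (rule uniform_lim_mult[OF _ uniform_limit_const])
       (auto simp: zero bounded_iff intro!: exI[of _ 1])
  then have lim: "uniform_limit {0..2 * pi} f (\<lambda>t. 0) sequentially" by (simp add: zero)
  have "continuous_on {0..2 * pi} (f N)" for N
    unfolding f_def sterm_def by (intro continuous_intros) auto
  then obtain I J where I: "\<And>N. (f N has_integral I N) {0..2 * pi}" and J: "((\<lambda>t. 0) has_integral J) {0..2 * pi}" and IJ: "I \<longlonglongrightarrow> J"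
    using uniform_limit_integral[OF lim] by (metis (no_types, lifting) sequentially_bot)
  have "J = 0" using J by (simp add: has_integral_iff)
  have "I N = 2 * of_real pi * scoeff 0" if "N > 0" for N
  proof -
    have f: "f N t = (\<Sum>n<N. scoeff n * (exp (\<i> * of_int (int n) * of_real t) - exp (\<i> * of_int (- 1 - int n) * of_real t)))" for t
    proof -
      have "(exp ((of_nat n + 1/2) * (\<i> * of_real t)) - exp (- ((of_nat n + 1/2) * (\<i> * of_real t)))) * exp (- (\<i> * of_real t / 2)) =
         exp (\<i> * of_int (int n) * of_real t) - exp (\<i> * of_int (- 1 - int n) * of_real t)" for n
        unfolding left_diff_distrib exp_add[symmetric]
        by (rule arg_cong2[where f = "(-)"]; rule arg_cong[where f = exp]) (simp_all add: field_simps)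
      then show ?thesis unfolding f_def sterm_def sum_distrib_right by (simp add: mult.assoc)
    qed
    have "(f N has_integral (\<Sum>n<N. scoeff n * ((if int n = 0 then 2 * of_real pi else 0) - (if - 1 - int n = 0 then 2 * of_real pi else 0)))) {0..2 * pi}"
      unfolding f[abs_def]
      by (intro has_integral_sum has_integral_mult_right has_integral_diff integral_exp_period) auto
    also have "(\<Sum>n<N. scoeff n * ((if int n = 0 then 2 * of_real pi else 0) - (if - 1 - int n = 0 then 2 * of_real pi else 0))) =
       (\<Sum>n<N. if n = 0 then 2 * of_real pi * scoeff 0 else 0)"
      by (rule sum.cong) auto
    also have "\<dots> = 2 * of_real pi * scoeff 0" using that by simp
    finally show ?thesis using I[of N] by (metis has_integral_unique)
  qed
  then have "I \<longlonglongrightarrow> 2 * of_real pi * scoeff 0"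
    by (intro tendsto_eventually) (auto simp: eventually_at_top_dense intro!: exI[of _ 0])
  then have "2 * of_real pi * scoeff 0 = 0" using IJ \<open>J = 0\<close> LIMSEQ_unique by blast
  then show False by (simp add: scoeff_def)
qed

text \<open>The zeros of \<open>P\<close> on the strip are simple, and the series vanishes there
  because it is odd and changes sign under \<open>2 \<pi> \<i>\<close>. The quotient is invariant
  under both translations, hence a constant, which cancels against
  \<open>deriv ser 0\<close>.\<close>

lemma theta_eq_P: "theta \<tau> = P"
proof -
  have ser0: "ser x = 0" if "x \<in> strip" "P x = 0" for x
  proof -
    have zeron: "ser (of_nat k * (2 * of_real pi * \<i>)) = 0" for k
    proof (induction k)
      case 0
      show ?case using ser_uminus[of 0] by simp
    next
      case (Suc k)
      then show ?case using ser_2pii[of "of_nat k * (2 * of_real pi * \<i>)"] by (simp add: algebra_simps)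
    qed
    have zero: "ser (of_int k * (2 * of_real pi * \<i>)) = 0" for k :: int
      using zeron[of "nat k"] zeron[of "nat (- k)"] ser_uminus[of "of_nat (nat (- k)) * (2 * of_real pi * \<i>)"]
      by (cases "k \<ge> 0") auto
    have "exp x = 1" using that by (simp add: P_eq_0_strip)
    then obtain n :: int where "Re x = 0" "Im x = of_int (2 * n) * pi" by (auto simp: exp_eq_1)
    then have "x = of_int n * (2 * of_real pi * \<i>)" by (simp add: complex_eq_iff)
    then show ?thesis using zero by simp
  qed
  obtain h where h: "h holomorphic_on strip" "\<And>x. x \<in> strip \<Longrightarrow> ser x = P x * h x"
  proof (rule holomorphic_quotient[OF open_strip holomorphic_ser holomorphic_P])
    fix x assume x: "x \<in> strip" "P x = 0"
    then have "exp x = 1" by (simp add: P_eq_0_strip)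
    then show "ser x = 0 \<and> deriv P x \<noteq> 0" using ser0[OF x] Phi_nonzero[OF x(1)] by (simp add: deriv_P_strip)
  qed auto
  have gen: "h (x + 2 * of_real pi * \<i>) = h x" if "x \<in> strip" "P x \<noteq> 0" for x
  proof -
    have "x + 2 * of_real pi * \<i> \<in> strip" using that by (simp add: strip_def)
    then show ?thesis using h(2)[of x] h(2)[of "x + 2 * of_real pi * \<i>"] that by (simp add: ser_2pii P_2pii)
  qed
  have per1: "h (x + 2 * of_real pi * \<i>) = h x" if "x \<in> strip" for x
  proof (rule analytic_continuation_open[of "strip \<inter> {x. Re x > 0}" strip "\<lambda>x. h (x + 2 * of_real pi * \<i>)" h x])
    show "open (strip \<inter> {x. Re x > 0})" by (intro open_Int open_strip open_halfspace_Re_gt)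
    have "of_real (ell / 2) \<in> strip \<inter> {x. Re x > 0}" using ell_pos by (simp add: strip_def)
    then show "strip \<inter> {x. Re x > 0} \<noteq> {}" by blast
    show "(\<lambda>x. h (x + 2 * of_real pi * \<i>)) holomorphic_on strip"
      by (rule holomorphic_on_compose_gen[OF _ h(1), unfolded o_def]) (auto intro!: holomorphic_intros simp: strip_def)
    fix z assume "z \<in> strip \<inter> {x. Re x > 0}"
    then show "h (z + 2 * of_real pi * \<i>) = h z" by (intro gen) (auto simp: P_eq_0_strip exp_eq_1)
  qed (use h that open_strip connected_strip in auto)
  have per2: "h (x + om) = exp (- 0) * h x" if "0 < Re x" "Re x < ell" for x
  proof -
    have x: "x \<in> strip" "x + om \<in> strip" using that by (auto simp: strip_def)
    have "P x \<noteq> 0" using x that by (auto simp: P_eq_0_strip exp_eq_1)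
    then show ?thesis using h(2)[OF x(1)] h(2)[OF x(2)] by (simp add: ser_om P_om)
  qed
  obtain C where C: "\<And>x. x \<in> strip \<Longrightarrow> h x = C * exp (of_real (Re 0 / ell) * x)"
    using strip_quasi_periodic[OF h(1) per1 per2] by blast
  have ser: "ser x = C * P x" for x
  proof (rule analytic_continuation_open[of strip UNIV ser "\<lambda>x. C * P x" x])
    show "strip \<noteq> {}" using zero_in_strip by blast
    show "ser holomorphic_on UNIV" by (rule holomorphic_ser)
    show "(\<lambda>x. C * P x) holomorphic_on UNIV" by (intro holomorphic_intros holomorphic_P)
    fix z assume "z \<in> strip"
    then show "ser z = C * P z" using C h(2) by simp
  qed (auto simp: open_strip)
  then have "C \<noteq> 0" using ser_nonzero by auto
  have "(P has_field_derivative 1) (at 0)"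
    using holomorphic_derivI[OF holomorphic_P[of UNIV], of 0] by (simp add: deriv_P_0)
  then have "(ser has_field_derivative C) (at 0)"
    unfolding ser by (auto intro!: derivative_eq_intros)
  then have "deriv ser 0 = C" by (rule DERIV_imp_deriv)
  then show ?thesis
    using \<open>C \<noteq> 0\<close> by (simp add: fun_eq_iff theta_def infsum_theta_num infsum_theta_den ser)
qed

end

section \<open>Cancellation of factors and higher derivatives in one variable\<close>

lemma holomorphic_eq_off_zeros:
  assumes "open S" "connected S" "f holomorphic_on S" "h holomorphic_on S" "g holomorphic_on S"
    and "w \<in> S" "g w \<noteq> 0" and eq: "\<And>z. z \<in> S \<Longrightarrow> g z * f z = g z * h z" and "z \<in> S"
  shows "f z = h z"
proof (rule analytic_continuation_open[of "{z\<in>S. g z \<noteq> 0}" S f h z])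
  have "continuous_on S g" using assms by (intro holomorphic_on_imp_continuous_on)
  then have "open (S \<inter> g -` (- {0}))"
    using \<open>open S\<close> by (intro continuous_open_preimage) auto
  moreover have "{z\<in>S. g z \<noteq> 0} = S \<inter> g -` (- {0})" by auto
  ultimately show "open {z\<in>S. g z \<noteq> 0}" by simp
qed (use assms in auto)

lemma higher_deriv_exp_shift:
  "(deriv ^^ n) (\<lambda>s. a * exp (s - c)) = (\<lambda>s. a * exp (s - c :: complex))"
proof (induction n)
  case (Suc n)
  have "deriv (\<lambda>s. a * exp (s - c)) s = a * exp (s - c)" for s
    by (rule DERIV_imp_deriv) (auto intro!: derivative_eq_intros)
  then have "deriv (\<lambda>s. a * exp (s - c)) = (\<lambda>s. a * exp (s - c))" by (rule ext)
  then show ?case using Suc by simp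
qed simp

lemma higher_deriv_sum:
  assumes "finite I" "\<And>i. i \<in> I \<Longrightarrow> f i holomorphic_on S" "open S" "z \<in> S"
  shows "(deriv ^^ n) (\<lambda>w. \<Sum>i\<in>I. f i w) z = (\<Sum>i\<in>I. (deriv ^^ n) (f i) z)"
  using assms(1,2)
proof (induction I rule: finite_induct)
  case (insert i I)
  then show ?case
    using assms(3,4) by (simp add: higher_deriv_add[of "f i" S] holomorphic_on_sum)
qed simp

lemma sum_symmetric_int:
  "(\<Sum>k = - int N..int N. f k) = f 0 + (\<Sum>n<N. f (int (Suc n)) + f (- int (Suc n)))"
  for f :: "int \<Rightarrow> 'a::ab_group_add"
proof (induction N)
  case (Suc N)
  have "{- int (Suc N)..int (Suc N)} = insert (int (Suc N)) (insert (- int (Suc N)) {- int N..int N})"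
    by auto
  then show ?case using Suc by (simp add: algebra_simps)
qed simp

context half_plane
begin

section \<open>Zeros of the product on the whole plane\<close>

definition lat :: "int \<Rightarrow> int \<Rightarrow> complex" where
  "lat m n = of_int m * (2 * of_real pi * \<i>) + of_int n * om"

lemma shift_to_strip: "\<exists>n. x - of_int n * om \<in> strip"
proof -
  define n where "n = \<lfloor>- Re x / ell\<rfloor>"
  have "of_int n * ell \<le> - Re x" "- Re x < (of_int n + 1) * ell"
    unfolding n_def using floor_divide_lower[OF ell_pos] floor_divide_upper[OF ell_pos] by blast+
  then have "x - of_int n * om \<in> strip"
    by (simp add: strip_def algebra_simps)
  then show ?thesis by blast
qed

lemma P_derivative: "(P has_field_derivative deriv P x) (at x)"
  using holomorphic_derivI[OF holomorphic_P[of UNIV]] by simp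

lemma P_has_derivative_chain [derivative_intros]:
  "(f has_field_derivative f') (at x within A) \<Longrightarrow>
    ((\<lambda>x. P (f x)) has_field_derivative deriv P (f x) * f') (at x within A)"
  by (rule DERIV_chain2[OF P_derivative])

lemma holomorphic_P' [holomorphic_intros]: "f holomorphic_on A \<Longrightarrow> (\<lambda>x. P (f x)) holomorphic_on A"
  using holomorphic_on_compose[of f A P] holomorphic_P by (simp add: o_def)

lemma continuous_P [continuous_intros]: "continuous_on A f \<Longrightarrow> continuous_on A (\<lambda>x. P (f x))"
  using holomorphic_on_imp_continuous_on[OF holomorphic_P[of UNIV]]
  by (rule continuous_on_compose2) auto

lemma P_om_zero: "P (x + om) = 0 \<longleftrightarrow> P x = 0" "P x = 0 \<Longrightarrow> deriv P (x + om) = 0 \<longleftrightarrow> deriv P x = 0"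
proof -
  show "P (x + om) = 0 \<longleftrightarrow> P x = 0" by (simp add: P_om)
  assume x: "P x = 0"
  have "((\<lambda>x. P (x + om)) has_field_derivative deriv P (x + om)) (at x)"
    by (auto intro!: derivative_eq_intros)
  moreover have "((\<lambda>x. - exp (- (om / 2)) * exp (- x) * P x) has_field_derivative
      - exp (- (om / 2)) * exp (- x) * deriv P x) (at x)"
    by (rule derivative_eq_intros P_derivative refl | simp add: x)+
  ultimately have "deriv P (x + om) = - exp (- (om / 2)) * exp (- x) * deriv P x"
    using DERIV_unique by (simp add: P_om) blast
  then show "deriv P (x + om) = 0 \<longleftrightarrow> deriv P x = 0" by simp
qed

lemma P_shift_om:
  "(P (x + of_int n * om) = 0 \<longleftrightarrow> P x = 0) \<and> (P x = 0 \<longrightarrow> (deriv P (x + of_int n * om) = 0 \<longleftrightarrow> deriv P x = 0))"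
proof -
  have nat: "(P (x + of_nat n * om) = 0 \<longleftrightarrow> P x = 0) \<and> (P x = 0 \<longrightarrow> (deriv P (x + of_nat n * om) = 0 \<longleftrightarrow> deriv P x = 0))" for n x
  proof (induction n)
    case (Suc n)
    then show ?case using P_om_zero[of "x + of_nat n * om"] by (simp add: algebra_simps)
  qed simp
  show ?thesis
  proof (cases "n \<ge> 0")
    case True
    then show ?thesis using nat[of x "nat n"] by simp
  next
    case False
    then show ?thesis using nat[of "x + of_int n * om" "nat (- n)"] by auto
  qed
qed

text \<open>A multiple of \<open>om\<close> brings the zero into the strip, where only
  \<open>sh\<close> can vanish; the multipliers of \<open>P\<close> have no zeros, so simplicity is
  carried back.\<close>

lemma P_eq_0_imp:
  assumes "P x = 0"
  shows "\<exists>m n. x = lat m n" "deriv P x \<noteq> 0"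
proof -
  obtain n where n: "x - of_int n * om \<in> strip" using shift_to_strip by blast
  define y where "y = x - of_int n * om"
  have y: "P y = 0" "deriv P x = 0 \<longleftrightarrow> deriv P y = 0"
    using P_shift_om[of y n] assms by (auto simp: y_def)
  have e: "exp y = 1" using y n by (simp add: P_eq_0_strip y_def)
  then obtain m :: int where m: "Re y = 0" "Im y = of_int (2 * m) * pi" by (auto simp: exp_eq_1)
  then have "y = of_int m * (2 * of_real pi * \<i>)" by (simp add: complex_eq_iff)
  then have "x = lat m n" by (simp add: y_def lat_def algebra_simps)
  then show "\<exists>m n. x = lat m n" by blast
  show "deriv P x \<noteq> 0" using y(2) e deriv_P_strip[OF e] Phi_nonzero n by (simp add: y_def)
qed

lemma periodic_lat:
  assumes "\<And>x. f (x + 2 * of_real pi * \<i>) = (0::complex) \<longleftrightarrow> f x = 0" "\<And>x. f (x + om) = 0 \<longleftrightarrow> f x = 0"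
  shows "f (x + lat m n) = 0 \<longleftrightarrow> f x = 0"
proof -
  have nat: "f (x + of_nat n * w) = 0 \<longleftrightarrow> f x = 0" if "\<And>x. f (x + w) = 0 \<longleftrightarrow> f x = 0" for n x w
  proof (induction n)
    case (Suc n)
    then show ?case using that[of "x + of_nat n * w"] by (simp add: algebra_simps)
  qed simp
  have int: "f (x + of_int n * w) = 0 \<longleftrightarrow> f x = 0" if "\<And>x. f (x + w) = 0 \<longleftrightarrow> f x = 0" for n x w
  proof (cases "n \<ge> 0")
    case True
    then show ?thesis using nat[OF that, of x "nat n"] by simp
  next
    case False
    then show ?thesis using nat[OF that, of "x + of_int n * w" "nat (- n)"] by auto
  qed
  show ?thesis
    using int[of om "x + of_int m * (2 * of_real pi * \<i>)" n] int[of "2 * of_real pi * \<i>" x m] assms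
    by (simp add: lat_def algebra_simps)
qed

lemma P_lat: "P (x + lat m n) = 0 \<longleftrightarrow> P x = 0"
  by (rule periodic_lat) (simp_all add: P_2pii P_om)

lemma P_not_identically_0: "\<exists>x. P (a + b * x) \<noteq> 0" if "b \<noteq> 0"
proof -
  have "P (a + b * ((of_real (ell / 2) - a) / b)) \<noteq> 0"
    using that ell_pos by (simp add: P_eq_0_strip strip_def exp_eq_1)
  then show ?thesis by blast
qed

section \<open>The three-term identity of Weierstrass\<close>

definition weier :: "complex \<Rightarrow> complex \<Rightarrow> complex \<Rightarrow> complex \<Rightarrow> complex" where
  "weier a b c d = P (a + b) * P (a - b) * P (c + d) * P (c - d) - P (a + c) * P (a - c) * P (b + d) * P (b - d)
     + P (a + d) * P (a - d) * P (b + c) * P (b - c)"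

lemma P_pair_2pii: "P (a + 2 * of_real pi * \<i> + b) * P (a + 2 * of_real pi * \<i> - b) = P (a + b) * P (a - b)"
  using P_2pii[of "a + b"] P_2pii[of "a - b"] by (simp add: algebra_simps)

lemma P_pair_om: "P (a + om + b) * P (a + om - b) = exp (- om) * exp (- (2 * a)) * (P (a + b) * P (a - b))"
proof -
  have "exp (- (om / 2)) * exp (- (om / 2)) = exp (- om)" "exp (- (a + b)) * exp (- (a - b)) = exp (- (2 * a))"
    by (simp_all flip: exp_add)
  moreover have "P (a + om + b) = - exp (- (om / 2)) * exp (- (a + b)) * P (a + b)"
    "P (a + om - b) = - exp (- (om / 2)) * exp (- (a - b)) * P (a - b)"
    using P_om[of "a + b"] P_om[of "a - b"] by (simp_all add: algebra_simps)
  ultimately show ?thesis by (simp add: mult_ac)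
qed

lemma weier_2pii: "weier (a + 2 * of_real pi * \<i>) b c d = weier a b c d"
  unfolding weier_def P_pair_2pii by (rule refl)

lemma weier_om: "weier (a + om) b c d = exp (- om) * exp (- (2 * a)) * weier a b c d"
  unfolding weier_def P_pair_om by (simp add: algebra_simps)

lemma weier_b: "weier b b c d = 0" "weier (- b) b c d = 0" "weier c b c d = 0"
  using P_uminus[of "b - c"] P_uminus[of "b + c"] P_uminus[of "b - d"] P_uminus[of "b + d"] P_uminus[of "c - b"]
  by (simp_all add: weier_def algebra_simps)

text \<open>As a function of \<open>a\<close>, \<open>weier\<close> has the multipliers of
  \<open>P (a + b) * P (a - b)\<close> and vanishes at its zeros, which are simple because
  \<open>P (2 * b) \<noteq> 0\<close>. The quotient is constant, and the value at
  \<open>a = c\<close> shows that the constant is 0.\<close>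

lemma weier_generic:
  assumes b: "P (2 * b) \<noteq> 0" and c: "P (c + b) \<noteq> 0" "P (c - b) \<noteq> 0"
  shows "weier a b c d = 0"
proof -
  define g where "g = (\<lambda>a. P (a + b) * P (a - b))"
  have wlat: "weier (a + lat m n) b c d = 0 \<longleftrightarrow> weier a b c d = 0" for a m n
    by (rule periodic_lat) (simp_all add: weier_2pii weier_om)
  have hol: "(\<lambda>a. weier a b c d) holomorphic_on A" "g holomorphic_on A" for A
    unfolding weier_def g_def by (intro holomorphic_intros)+
  obtain h where h: "h holomorphic_on UNIV" "\<And>z. weier z b c d = g z * h z"
  proof (rule holomorphic_quotient[of UNIV "\<lambda>a. weier a b c d" g])
    fix z assume z: "g z = 0"
    have dg: "deriv g z = deriv P (z + b) * P (z - b) + P (z + b) * deriv P (z - b)"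
      unfolding g_def by (rule DERIV_imp_deriv) (auto intro!: derivative_eq_intros)
    from z consider "P (z + b) = 0" | "P (z - b) = 0" by (auto simp: g_def)
    then show "weier z b c d = 0 \<and> deriv g z \<noteq> 0"
    proof cases
      case 1
      then obtain m n where mn: "z + b = lat m n" using P_eq_0_imp by blast
      then have "z = - b + lat m n" by (simp add: algebra_simps)
      then have "weier z b c d = 0" by (simp only: wlat weier_b)
      have "z - b = - (2 * b) + lat m n" using mn by (simp add: algebra_simps)
      then have "P (z - b) \<noteq> 0"
        using b by (simp only: P_lat P_uminus neg_equal_0_iff_equal not_False_eq_True)
      then show ?thesis using 1 P_eq_0_imp(2)[OF 1] dg \<open>weier z b c d = 0\<close> by simp
    next
      case 2
      then obtain m n where mn: "z - b = lat m n" using P_eq_0_imp by blast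
      then have "z = b + lat m n" by (simp add: algebra_simps)
      then have "weier z b c d = 0" by (simp only: wlat weier_b)
      have "z + b = 2 * b + lat m n" using mn by (simp add: algebra_simps)
      then have "P (z + b) \<noteq> 0"
        using b by (simp only: P_lat P_uminus neg_equal_0_iff_equal not_False_eq_True)
      then show ?thesis using 2 P_eq_0_imp(2)[OF 2] dg \<open>weier z b c d = 0\<close> by simp
    qed
  qed (use hol in auto)
  have gc: "g c \<noteq> 0" using c by (simp add: g_def)
  have g1: "g (z + 2 * of_real pi * \<i>) = g z" for z
    unfolding g_def by (rule P_pair_2pii)
  have g2: "g (z + om) = exp (- om) * exp (- (2 * z)) * g z" for z
    unfolding g_def by (rule P_pair_om)
  have shift: "(\<lambda>z. h (z + w)) holomorphic_on UNIV" for w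
    by (rule holomorphic_on_compose[OF _ holomorphic_on_subset[OF h(1)], unfolded o_def])
       (auto intro!: holomorphic_intros)
  have per1: "h (z + 2 * of_real pi * \<i>) = h z" for z
    by (rule holomorphic_eq_off_zeros[of UNIV "\<lambda>z. h (z + 2 * of_real pi * \<i>)" h g c])
       (use shift h hol gc weier_2pii g1 in \<open>auto simp flip: h(2)\<close>, metis g1 h(2) weier_2pii)
  have per2: "h (z + om) = h z" for z
  proof (rule holomorphic_eq_off_zeros[of UNIV "\<lambda>z. h (z + om)" h g c])
    fix z
    have "exp (- om) * exp (- (2 * z)) * (g z * h (z + om)) = exp (- om) * exp (- (2 * z)) * (g z * h z)"
      using h(2)[of "z + om"] h(2)[of z] by (simp only: weier_om g2 mult.assoc)
    then show "g z * h (z + om) = g z * h z" by simp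
  qed (use shift h hol gc in auto)
  obtain C where "\<And>x. x \<in> strip \<Longrightarrow> h x = C * exp (of_real (Re 0 / ell) * x)"
    using strip_quasi_periodic[OF holomorphic_on_subset[OF h(1)], of 0] per1 per2 by auto
  then have C: "h x = C" if "x \<in> strip" for x using that by simp
  have strip_ne: "strip \<noteq> {}" using zero_in_strip by blast
  have C: "h x = C" for x
    by (rule analytic_continuation_open[of strip UNIV h "\<lambda>_. C"])
       (use C h(1) open_strip strip_ne in auto)
  have "C = 0" using h(2)[of c] gc by (simp add: C weier_b)
  then show ?thesis by (simp add: h(2) C)
qed

text \<open>\<open>weier\<close> is entire in \<open>b\<close>, so the genericity conditions of
  \<open>weier_generic\<close> are removed by continuation in \<open>b\<close>; their product
  \<open>g\<close> is not identically zero.\<close>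

lemma weierstrass_identity: "weier a b c d = 0"
proof -
  \<comment> \<open>The arguments are spelled as \<open>a + b * x\<close> to match
    \<open>P_not_identically_0\<close>.\<close>
  define g where "g = (\<lambda>b. P (0 + 2 * b) * (P (c + 1 * b) * P (c + (-1) * b)))"
  have hol: "g holomorphic_on UNIV" "(\<lambda>b. weier a b c d) holomorphic_on UNIV"
    unfolding g_def weier_def by (intro holomorphic_intros)+
  have "\<exists>w. g w \<noteq> 0"
  proof (rule ccontr)
    assume "\<not> ?thesis"
    then have zero: "P (0 + 2 * b) * (P (c + 1 * b) * P (c + (-1) * b)) = 0" for b by (simp add: g_def)
    obtain x1 where x1: "P (0 + 2 * x1) \<noteq> 0" using P_not_identically_0[of 2 0] by auto
    obtain x2 where x2: "P (c + 1 * x2) \<noteq> 0" using P_not_identically_0[of 1 c] by auto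
    obtain x3 where x3: "P (c + (-1) * x3) \<noteq> 0" using P_not_identically_0[of "-1" c] by auto
    have "P (c + 1 * b) * P (c + (-1) * b) = 0" for b
      by (rule holomorphic_eq_off_zeros[of UNIV "\<lambda>b. P (c + 1 * b) * P (c + (-1) * b)" "\<lambda>_. 0" "\<lambda>b. P (0 + 2 * b)" x1 b])
         (use zero x1 in \<open>auto intro!: holomorphic_intros\<close>)
    then have "P (c + (-1) * b) = 0" for b
      by (intro holomorphic_eq_off_zeros[of UNIV "\<lambda>b. P (c + (-1) * b)" "\<lambda>_. 0" "\<lambda>b. P (c + 1 * b)" x2 b])
         (use x2 in \<open>auto intro!: holomorphic_intros\<close>)
    then show False using x3 by simp
  qed
  then obtain w where w: "g w \<noteq> 0" by blast
  show ?thesis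
  proof (rule holomorphic_eq_off_zeros[of UNIV "\<lambda>b. weier a b c d" "\<lambda>_. 0" g w b])
    fix z
    show "g z * weier a z c d = g z * 0"
      using weier_generic[of z c a d] by (cases "g z = 0") (auto simp: g_def)
  qed (use hol w in auto)
qed

text \<open>The substitution in the proof solves the linear system that makes the sums and
  differences of \<open>a\<close>, \<open>b\<close>, \<open>c\<close>, \<open>d\<close> the
  arguments of this identity. In this form, after clearing denominators, it evaluates a 2 by 2 minor
  of the matrix with entries \<open>kron k (x - y)\<close>.\<close>

lemma fay_identity:
  "P (k + x - y) * P (k + x' - y') * P (x - y') * P (x' - y) - P (k + x - y') * P (k + x' - y) * P (x - y) * P (x' - y')
   = P k * P (k + x + x' - y - y') * P (x - x') * P (y' - y)"
proof -
  define a b c d where "a = k + (x + x' - y - y') / 2" and "b = (x + x' - y - y') / 2"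
    and "c = (x - x' + y' - y) / 2" and "d = (x - x' - y' + y) / 2"
  have eqs: "a + b = k + x + x' - y - y'" "a - b = k" "c + d = x - x'" "c - d = y' - y"
    "a + c = k + x - y" "a - c = k + x' - y'" "b + d = x - y'" "b - d = x' - y"
    "a + d = k + x - y'" "a - d = k + x' - y" "b + c = x - y" "b - c = x' - y'"
    by (simp_all add: a_def b_def c_def d_def field_simps)
  show ?thesis using weierstrass_identity[of a b c d] unfolding weier_def eqs by (simp add: algebra_simps)
qed

section \<open>The Frobenius determinant\<close>

definition kron :: "complex \<Rightarrow> complex \<Rightarrow> complex" where
  "kron k x = P (k + x) / (P k * P x)"

text \<open>The matrix is the identity outside \<open>S\<close>, so that the induction on \<open>S\<close> stays within one matrix type.\<close>

definition frob :: "complex \<Rightarrow> ('n \<Rightarrow> complex) \<Rightarrow> ('n \<Rightarrow> complex) \<Rightarrow> 'n set \<Rightarrow> complex ^ 'n ^ 'n" where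
  "frob k x y S = (\<chi> i j. if i \<in> S \<and> j \<in> S then kron k (x i - y j) else if i = j then 1 else 0)"

text \<open>Fay's identity divided by the denominators. The right-hand side separates into a factor
  in \<open>x\<close>, a factor in \<open>y\<close> and the same function with a shifted parameter,
  so a pivot step stays within the family.\<close>

lemma kron_schur:
  assumes "P k \<noteq> 0" "P (k + (x' - y')) \<noteq> 0"
    "P (x - y) \<noteq> 0" "P (x' - y) \<noteq> 0" "P (x - y') \<noteq> 0" "P (x' - y') \<noteq> 0"
  shows "kron k (x - y) - kron k (x - y') / kron k (x' - y') * kron k (x' - y) =
    (P (x - x') / P (x - y')) * kron (k + (x' - y')) (x - y) * (P (y' - y) / P (x' - y))"
proof -
  have "P (k + (x - y)) * P (k + (x' - y')) * P (x - y') * P (x' - y) - P (k + (x - y')) * P (k + (x' - y)) * P (x - y) * P (x' - y')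
   = P k * P (k + (x' - y') + (x - y)) * P (x - x') * P (y' - y)"
    using fay_identity[of k x y x' y'] by (simp add: algebra_simps)
  then show ?thesis
    using assms by (simp add: kron_def divide_simps) (simp add: algebra_simps)
qed

text \<open>Eliminating row and column \<open>m\<close> leaves the Schur complement on
  \<open>S\<close>, which by \<open>kron_schur\<close> is a matrix of the same kind with rows scaled
  by \<open>R\<close> and columns by \<open>Q\<close>.\<close>

lemma det_frob_step:
  fixes x y :: "'n::finite \<Rightarrow> complex"
  assumes m: "m \<notin> S" and k: "P k \<noteq> 0" "P (k + (x m - y m)) \<noteq> 0" and xy: "\<And>i j. P (x i - y j) \<noteq> 0"
  shows "det (frob k x y (insert m S)) = kron k (x m - y m) *
     (\<Prod>i\<in>S. P (x i - x m) / P (x i - y m)) * (\<Prod>j\<in>S. P (y m - y j) / P (x m - y j)) *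
     det (frob (k + (x m - y m)) x y S)"
proof -
  define p where "p = kron k (x m - y m)"
  have p: "p \<noteq> 0" using k xy by (simp add: p_def kron_def)
  define A where "A = frob k x y (insert m S)"
  define l where "l = (\<lambda>i. if i \<in> S then kron k (x i - y m) / p else 0)"
  define r where "r = (\<lambda>j. if j \<in> S then kron k (x m - y j) / p else 0)"
  define B where "B = (\<chi> i j. A $ i $ j - l i * A $ m $ j)"
  define C where "C = (\<chi> i j. B $ i $ j - r j * B $ i $ m)"
  define R where "R = (\<lambda>i. if i \<in> S then P (x i - x m) / P (x i - y m) else 1)"
  define Q where "Q = (\<lambda>j. if j \<in> S then P (y m - y j) / P (x m - y j) else 1)"
  define G where "G = frob (k + (x m - y m)) x y S"
  have "det A = det B"
    unfolding B_def using m by (intro det_row_elimination[symmetric]) (simp add: l_def)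
  also have "det B = det (transpose B)" by simp
  also have "\<dots> = det (\<chi> j i. transpose B $ j $ i - r j * transpose B $ m $ i)"
    using m by (intro det_row_elimination[symmetric]) (simp add: r_def)
  also have "(\<chi> j i. transpose B $ j $ i - r j * transpose B $ m $ i) = transpose C"
    by (simp add: vec_eq_iff C_def transpose_def)
  also have "det (transpose C) = det C" by simp
  finally have "det A = det C" .
  have Am: "A $ m $ j = (if j = m then p else if j \<in> S then kron k (x m - y j) else 0)" for j
    by (auto simp: A_def frob_def p_def)
  have Aim: "A $ i $ m = (if i = m then p else if i \<in> S then kron k (x i - y m) else 0)" for i
    by (auto simp: A_def frob_def p_def)
  have Bim: "B $ i $ m = (if i = m then p else 0)" for i
    using m p by (auto simp: B_def Am Aim l_def)
  have C: "C $ i $ j = (if i = m then p else 1) * (R i * G $ i $ j * Q j)" for i j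
  proof (cases "i = m \<or> j = m")
    case True
    then show ?thesis
      using m p by (auto simp: C_def Bim B_def Am Aim l_def r_def R_def Q_def G_def frob_def)
  next
    case False
    then have "C $ i $ j = B $ i $ j" by (simp add: C_def Bim)
    also have "\<dots> = A $ i $ j - l i * A $ m $ j" by (simp add: B_def)
    also have "\<dots> = R i * G $ i $ j * Q j"
    proof (cases "i \<in> S \<and> j \<in> S")
      case True
      then show ?thesis
        using False kron_schur[of k "x m" "y m" "x i" "y j"] k xy
        by (simp add: Am l_def R_def Q_def G_def frob_def A_def p_def)
    next
      case F: False
      then show ?thesis using False
        by (auto simp: Am l_def R_def Q_def G_def frob_def A_def)
    qed
    finally show ?thesis using False by simp
  qed
  have "C = (\<chi> i. ((if i = m then p else 1) * R i) *s ((\<chi> i j. G $ i $ j * Q j) $ i))"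
    by (simp add: vec_eq_iff C mult_ac)
  then have "det C = (\<Prod>i\<in>UNIV. (if i = m then p else 1) * R i) * det (\<chi> i. (\<chi> i j. G $ i $ j * Q j) $ i)"
    by (simp only: det_rows_mul)
  also have "(\<chi> i. (\<chi> i j. G $ i $ j * Q j) $ i) = (\<chi> i j. G $ i $ j * Q j)"
    by (simp add: vec_eq_iff)
  also have "det (\<chi> i j. G $ i $ j * Q j) = det (transpose (\<chi> i j. G $ i $ j * Q j))" by simp
  also have "transpose (\<chi> i j. G $ i $ j * Q j) = (\<chi> j. Q j *s (transpose G $ j))"
    by (simp add: vec_eq_iff transpose_def mult.commute)
  also have "det (\<chi> j. Q j *s (transpose G $ j)) = (\<Prod>j\<in>UNIV. Q j) * det (\<chi> j. transpose G $ j)"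
    by (rule det_rows_mul)
  also have "det (\<chi> j. transpose G $ j) = det G" by simp
  also have "(\<Prod>i\<in>UNIV. (if i = m then p else 1) * R i) = p * (\<Prod>i\<in>S. P (x i - x m) / P (x i - y m))"
    by (simp add: prod.distrib R_def prod.If_cases)
  also have "(\<Prod>j\<in>UNIV. Q j) = (\<Prod>j\<in>S. P (y m - y j) / P (x m - y j))"
    by (simp add: Q_def prod.If_cases)
  finally show ?thesis using \<open>det A = det C\<close> by (simp add: A_def G_def p_def)
qed

text \<open>Each pivot step moves the parameter to \<open>k + (x m - y m)\<close>; therefore the
  induction generalizes \<open>k\<close>, and the nonvanishing condition ranges over all subsets
  \<open>T\<close>.\<close>

theorem frobenius_determinant:
  fixes x y :: "'n::{finite,linorder} \<Rightarrow> complex"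
  assumes xy: "\<And>i j. P (x i - y j) \<noteq> 0"
    and k: "\<And>T. T \<subseteq> S \<Longrightarrow> P (k + (\<Sum>i\<in>T. x i - y i)) \<noteq> 0"
  shows "det (frob k x y S) = P (k + (\<Sum>i\<in>S. x i - y i)) / P k *
    ((\<Prod>(i, j)\<in>pairs S. P (x i - x j) * P (y j - y i)) / (\<Prod>i\<in>S. \<Prod>j\<in>S. P (x i - y j)))"
proof -
  have "finite S" by simp
  then show ?thesis
    using k
  proof (induction S arbitrary: k rule: finite_linorder_max_induct)
    case empty
    have "P k \<noteq> 0" using empty[of "{}"] by simp
    moreover have "frob k x y {} = mat 1"
      by (simp add: frob_def mat_def vec_eq_iff)
    ultimately show ?case by (simp add: pairs_def)
  next
    case (insert m S)
    have m: "m \<notin> S" using insert by auto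
    define k' where "k' = k + (x m - y m)"
    have "P k \<noteq> 0" using insert(4)[of "{}"] by simp
    have "P k' \<noteq> 0" using insert(4)[of "{m}"] by (simp add: k'_def)
    have k': "k + (\<Sum>i\<in>insert m T. x i - y i) = k' + (\<Sum>i\<in>T. x i - y i)" if "m \<notin> T" for T
      using that by (simp add: k'_def add.assoc)
    have IH: "det (frob k' x y S) = P (k' + (\<Sum>i\<in>S. x i - y i)) / P k' *
      ((\<Prod>(i, j)\<in>pairs S. P (x i - x j) * P (y j - y i)) / (\<Prod>i\<in>S. \<Prod>j\<in>S. P (x i - y j)))"
    proof (rule insert(3))
      fix T assume "T \<subseteq> S"
      then have "m \<notin> T" "insert m T \<subseteq> insert m S" using m by auto
      then show "P (k' + (\<Sum>i\<in>T. x i - y i)) \<noteq> 0" using insert(4)[of "insert m T"] by (simp only: k' not_False_eq_True)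
    qed
    have nz: "(\<Prod>i\<in>S. P (x i - y m)) \<noteq> 0" "(\<Prod>j\<in>S. P (x m - y j)) \<noteq> 0"
      "(\<Prod>i\<in>S. \<Prod>j\<in>S. P (x i - y j)) \<noteq> 0" "P (x m - y m) \<noteq> 0"
      using xy insert(1) by simp_all
    have den: "(\<Prod>i\<in>insert m S. \<Prod>j\<in>insert m S. P (x i - y j)) =
       P (x m - y m) * (\<Prod>j\<in>S. P (x m - y j)) * ((\<Prod>i\<in>S. P (x i - y m)) * (\<Prod>i\<in>S. \<Prod>j\<in>S. P (x i - y j)))"
      using m insert(1) by (simp add: prod.distrib)
    have num: "(\<Prod>(i, j)\<in>pairs (insert m S). P (x i - x j) * P (y j - y i)) =
       (\<Prod>(i, j)\<in>pairs S. P (x i - x j) * P (y j - y i)) * ((\<Prod>i\<in>S. P (x i - x m)) * (\<Prod>i\<in>S. P (y m - y i)))"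
      using prod_pairs_insert[of S m "\<lambda>i j. P (x i - x j) * P (y j - y i)"] insert(1,2)
      by (simp add: prod.distrib)
    have "det (frob k x y (insert m S)) = kron k (x m - y m) *
     (\<Prod>i\<in>S. P (x i - x m) / P (x i - y m)) * (\<Prod>j\<in>S. P (y m - y j) / P (x m - y j)) *
     det (frob k' x y S)"
      unfolding k'_def using m \<open>P k \<noteq> 0\<close> \<open>P k' \<noteq> 0\<close> xy by (intro det_frob_step) (simp_all add: k'_def)
    then show ?case
      unfolding den num IH prod_dividef k'[OF m] using nz \<open>P k \<noteq> 0\<close> \<open>P k' \<noteq> 0\<close>
      by (simp add: kron_def flip: k'_def) (simp add: field_simps)
  qed
qed


section \<open>Kronecker's expansion\<close>

text \<open>This is \<open>coth (x / 2) / 2\<close>, an odd function that continues the geometric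
  series of both half-planes.\<close>

definition ct :: "complex \<Rightarrow> complex" where
  "ct x = (exp x + 1) / (2 * (exp x - 1))"

definition alpha :: "int \<Rightarrow> complex \<Rightarrow> complex" where
  "alpha k c = 1 / (1 - exp (- c - of_int k * om))"

definition pstrip :: "complex set" where
  "pstrip = {c\<in>strip. exp c \<noteq> 1}"

lemma open_pstrip: "open pstrip"
proof -
  have "pstrip = strip \<inter> exp -` (- {1})" by (auto simp: pstrip_def)
  moreover have "open (strip \<inter> exp -` (- {1 :: complex}))"
    by (intro continuous_open_preimage open_strip continuous_intros)
  ultimately show ?thesis by simp
qed

lemma P_pstrip: "c \<in> pstrip \<Longrightarrow> P c \<noteq> 0"
  by (auto simp: pstrip_def P_eq_0_strip)

lemma alpha_denominator:
  assumes "c \<in> strip" "k \<noteq> 0 \<or> exp c \<noteq> 1"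
  shows "exp (- c - of_int k * om) \<noteq> 1"
proof
  assume e: "exp (- c - of_int k * om) = 1"
  then have "Re (- c - of_int k * om) = 0" by (simp only: exp_eq_1)
  then have "Re c = of_int k * ell" by simp
  then have "\<bar>real_of_int k\<bar> * ell < ell" using assms(1) ell_pos by (simp add: strip_def abs_mult)
  then have "k = 0" using ell_pos by simp
  then show False using assms(2) e by (simp add: exp_minus)
qed

lemma holomorphic_alpha: "alpha k holomorphic_on pstrip"
  unfolding alpha_def using alpha_denominator by (intro holomorphic_intros) (auto simp: pstrip_def)

lemma alpha_minus_1:
  assumes "exp (- c - of_int k * om) \<noteq> 1"
  shows "alpha k c - 1 = exp (- c - of_int k * om) * alpha k c"
  using assms by (simp add: alpha_def field_simps)

lemma alpha_pos_bound:
  assumes "\<bar>Re c\<bar> \<le> r" "r < ell"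
  shows "norm (alpha (int (Suc n)) c) \<le> exp (r - real (Suc n) * ell) / (1 - exp (r - ell))"
proof -
  define y where "y = exp (- c - of_int (int (Suc n)) * om)"
  have ny: "norm y = exp (real (Suc n) * ell - Re c)" by (simp add: y_def)
  have 1: "exp (real (Suc n) * ell - r) \<le> norm y" using assms unfolding ny by simp
  have 2: "1 \<le> exp (r - ell) * exp (real (Suc n) * ell - r)"
  proof -
    have "0 \<le> real n * ell" using ell_pos by simp
    then have "0 \<le> (r - ell) + (real (Suc n) * ell - r)" by (simp add: algebra_simps)
    then show ?thesis unfolding exp_add[symmetric] by simp
  qed
  have pos: "0 < 1 - exp (r - ell)" using assms by simp
  have "exp (real (Suc n) * ell - r) * (1 - exp (r - ell)) \<le> norm y - 1"
    using 1 2 by (simp add: algebra_simps)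
  also have "\<dots> \<le> norm (1 - y)" by (metis norm_minus_commute norm_one norm_triangle_ineq2)
  finally have le: "exp (real (Suc n) * ell - r) * (1 - exp (r - ell)) \<le> norm (1 - y)" .
  have p: "0 < exp (real (Suc n) * ell - r) * (1 - exp (r - ell))" using pos by simp
  have "norm (alpha (int (Suc n)) c) \<le> 1 / (exp (real (Suc n) * ell - r) * (1 - exp (r - ell)))"
    unfolding alpha_def y_def[symmetric] norm_divide norm_one
    by (rule divide_left_mono[OF le _ mult_pos_pos[OF less_le_trans[OF p le] p]]) simp
  also have "\<dots> = exp (r - real (Suc n) * ell) / (1 - exp (r - ell))"
  proof -
    have "exp (r - real (Suc n) * ell) = 1 / exp (real (Suc n) * ell - r)"
      by (simp add: exp_diff)
    then show ?thesis by (simp only: divide_divide_eq_left)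
  qed
  finally show ?thesis .
qed

lemma alpha_neg_bound:
  assumes "\<bar>Re c\<bar> \<le> r" "r < ell"
  shows "norm (alpha (- int (Suc n)) c - 1) \<le> exp (r - real (Suc n) * ell) / (1 - exp (r - ell))"
proof -
  define y where "y = exp (- c - of_int (- int (Suc n)) * om)"
  have ny: "norm y = exp (- Re c - real (Suc n) * ell)" by (simp add: y_def algebra_simps)
  have 1: "norm y \<le> exp (r - real (Suc n) * ell)" using assms unfolding ny by simp
  have 2: "norm y \<le> exp (r - ell)"
  proof -
    have "0 \<le> real n * ell" using ell_pos by simp
    then have "- Re c - real (Suc n) * ell \<le> r - ell"
      using assms(1) by (simp only: of_nat_Suc distrib_right)
    then show ?thesis unfolding ny by simp
  qed
  have pos: "0 < 1 - exp (r - ell)" using assms by simp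
  have 3: "1 - exp (r - ell) \<le> norm (1 - y)"
    using 2 norm_triangle_ineq2[of 1 y] by simp
  have "c \<in> strip" using assms by (simp add: strip_def)
  then have "alpha (- int (Suc n)) c - 1 = y / (1 - y)"
    using alpha_denominator[of c "- int (Suc n)"]
    by (subst alpha_minus_1) (auto simp: alpha_def y_def)
  then have "norm (alpha (- int (Suc n)) c - 1) = norm y / norm (1 - y)" by (simp add: norm_divide)
  also have "\<dots> \<le> exp (r - real (Suc n) * ell) / (1 - exp (r - ell))"
    using 1 3 pos by (intro frac_le) auto
  finally show ?thesis .
qed

text \<open>The coefficients \<open>alpha n\<close> decay as \<open>n\<close> grows and tend to 1 as
  \<open>n\<close> falls. With that limit subtracted, the terms of index \<open>n + 1\<close> and
  \<open>- n - 1\<close> are summable on the whole strip, including the line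
  \<open>Re x = 0\<close>.\<close>

definition kr :: "nat \<Rightarrow> complex \<Rightarrow> complex \<Rightarrow> complex" where
  "kr n c x = alpha (int (Suc n)) c * exp (of_nat (Suc n) * x) +
     (alpha (- int (Suc n)) c - 1) * exp (- (of_nat (Suc n) * x))"

definition krbound :: "real \<Rightarrow> nat \<Rightarrow> real" where
  "krbound r n = 2 * exp r / (1 - exp (r - ell)) * (exp (r - ell) ^ Suc n)"

lemma kr_bound:
  assumes "\<bar>Re c\<bar> \<le> r" "\<bar>Re x\<bar> \<le> r" "r < ell"
  shows "norm (kr n c x) \<le> krbound r n"
proof -
  define E where "E = exp (r - real (Suc n) * ell) / (1 - exp (r - ell))"
  have pos: "0 < 1 - exp (r - ell)" using assms by simp
  have "real (Suc n) * Re x \<le> real (Suc n) * r" "real (Suc n) * (- Re x) \<le> real (Suc n) * r"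
    using assms by (intro mult_left_mono; auto)+
  then have e: "norm (exp (of_nat (Suc n) * x)) \<le> exp (real (Suc n) * r)"
    "norm (exp (- (of_nat (Suc n) * x))) \<le> exp (real (Suc n) * r)"
    by (simp_all add: algebra_simps)
  have "norm (kr n c x) \<le> E * exp (real (Suc n) * r) + E * exp (real (Suc n) * r)"
    unfolding kr_def E_def using assms alpha_pos_bound alpha_neg_bound e pos
    by (intro norm_triangle_mono) (auto simp only: norm_mult intro!: mult_mono divide_nonneg_pos, auto)
  also have "\<dots> = 2 / (1 - exp (r - ell)) * (exp (r - real (Suc n) * ell) * exp (real (Suc n) * r))"
    by (simp add: E_def)
  also have "exp (r - real (Suc n) * ell) * exp (real (Suc n) * r) = exp r * exp (r - ell) ^ Suc n"
    unfolding exp_of_nat_mult[symmetric] exp_add[symmetric] by (simp add: algebra_simps)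
  finally show ?thesis by (simp add: krbound_def)
qed

lemma summable_krbound: "r < ell \<Longrightarrow> summable (krbound r)"
  unfolding krbound_def power_Suc by (intro summable_mult summable_geometric) simp

definition KS :: "complex \<Rightarrow> complex \<Rightarrow> complex" where
  "KS c x = (\<Sum>n. kr n c x)"

lemma uniform_limit_KS:
  assumes "r < ell"
  shows "uniform_limit ({c. \<bar>Re c\<bar> \<le> r} \<times> {x. \<bar>Re x\<bar> \<le> r}) (\<lambda>N (c, x). \<Sum>n<N. kr n c x) (\<lambda>(c, x). KS c x) sequentially"
proof -
  have "uniform_limit ({c. \<bar>Re c\<bar> \<le> r} \<times> {x. \<bar>Re x\<bar> \<le> r})
     (\<lambda>N z. \<Sum>n<N. kr n (fst z) (snd z)) (\<lambda>z. \<Sum>n. kr n (fst z) (snd z)) sequentially"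
    using kr_bound[of _ r] assms by (intro Weierstrass_m_test[OF _ summable_krbound[OF assms]]) auto
  then show ?thesis by (simp add: KS_def case_prod_unfold)
qed

lemma uniform_limit_KS_x:
  assumes "r < ell" "\<bar>Re c\<bar> \<le> r"
  shows "uniform_limit {x. \<bar>Re x\<bar> \<le> r} (\<lambda>N x. \<Sum>n<N. kr n c x) (KS c) sequentially"
proof (rule uniform_limitI)
  fix e :: real assume "e > 0"
  from uniform_limitD[OF uniform_limit_KS[OF assms(1)] this]
  show "\<forall>\<^sub>F N in sequentially. \<forall>x\<in>{x. \<bar>Re x\<bar> \<le> r}. dist (\<Sum>n<N. kr n c x) (KS c x) < e"
    by eventually_elim (use assms in auto)
qed

lemma uniform_limit_KS_c:
  assumes "r < ell" "\<bar>Re x\<bar> \<le> r"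
  shows "uniform_limit {c. \<bar>Re c\<bar> \<le> r} (\<lambda>N c. \<Sum>n<N. kr n c x) (\<lambda>c. KS c x) sequentially"
proof (rule uniform_limitI)
  fix e :: real assume "e > 0"
  from uniform_limitD[OF uniform_limit_KS[OF assms(1)] this]
  show "\<forall>\<^sub>F N in sequentially. \<forall>c\<in>{c. \<bar>Re c\<bar> \<le> r}. dist (\<Sum>n<N. kr n c x) (KS c x) < e"
    by eventually_elim (use assms in auto)
qed

lemma strip_radius:
  assumes "c \<in> strip" "x \<in> strip"
  obtains r d where "r < ell" "d > 0" "\<bar>Re c\<bar> \<le> r" "\<bar>Re x\<bar> \<le> r" "cball x d \<subseteq> {y. \<bar>Re y\<bar> \<le> r}"
proof
  define M where "M = max \<bar>Re c\<bar> \<bar>Re x\<bar>"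
  have M: "M < ell" "\<bar>Re c\<bar> \<le> M" "\<bar>Re x\<bar> \<le> M" using assms by (auto simp: M_def strip_def)
  show "(M + ell) / 2 < ell" "(ell - M) / 2 > 0" "\<bar>Re c\<bar> \<le> (M + ell) / 2" "\<bar>Re x\<bar> \<le> (M + ell) / 2"
    using M by auto
  show "cball x ((ell - M) / 2) \<subseteq> {y. \<bar>Re y\<bar> \<le> (M + ell) / 2}"
  proof
    fix y assume "y \<in> cball x ((ell - M) / 2)"
    then have "\<bar>Re x - Re y\<bar> \<le> (ell - M) / 2" using abs_Re_le_cmod[of "x - y"] by (simp add: dist_norm)
    then show "y \<in> {y. \<bar>Re y\<bar> \<le> (M + ell) / 2}" using M by (simp add: abs_if split: if_splits) 
  qed
qed

lemma holomorphic_KS: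
  assumes "c \<in> strip"
  shows "KS c holomorphic_on strip"
proof (rule holomorphic_uniform_sequence)
  show "(\<lambda>x. \<Sum>n<N. kr n c x) holomorphic_on strip" for N
    unfolding kr_def by (intro holomorphic_intros)
  fix x assume x: "x \<in> strip"
  obtain r d where r: "r < ell" "d > 0" "\<bar>Re c\<bar> \<le> r" "\<bar>Re x\<bar> \<le> r" "cball x d \<subseteq> {y. \<bar>Re y\<bar> \<le> r}"
    using strip_radius[OF assms x] .
  have "uniform_limit (cball x d) (\<lambda>N x. \<Sum>n<N. kr n c x) (KS c) sequentially"
    using uniform_limit_on_subset[OF uniform_limit_KS_x[OF r(1,3)] r(5)] .
  moreover have "cball x d \<subseteq> strip" using r by (auto simp: strip_def)
  ultimately show "\<exists>d>0. cball x d \<subseteq> strip \<and> uniform_limit (cball x d) (\<lambda>N x. \<Sum>n<N. kr n c x) (KS c) sequentially"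
    using r(2) by blast
qed (rule open_strip)

text \<open>The expansions in the two half-strips differ from \<open>KS\<close> by a geometric
  series and a constant term each; \<open>ct x + ct c\<close> is the common continuation of these
  corrections.\<close>

definition KR :: "complex \<Rightarrow> complex \<Rightarrow> complex" where
  "KR c x = ct x + ct c + KS c x"

lemma exp_ne_1_Re: "Re x \<noteq> 0 \<Longrightarrow> exp x \<noteq> 1"
  by (auto simp: exp_eq_1)

lemma uniform_limit_geometric_exp:
  assumes "\<rho> > 0"
  shows "uniform_limit {x. \<rho> \<le> Re x} (\<lambda>N x. \<Sum>n<N. exp (- (of_nat (Suc n) * x))) (\<lambda>x. ct x - 1/2) sequentially"
proof -
  have lim: "(\<Sum>n. exp (- (of_nat (Suc n) * x))) = ct x - 1/2" if "x \<in> {x. \<rho> \<le> Re x}" for x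
  proof -
    have "exp (- (of_nat (Suc n) * x)) = exp (- x) * exp (- x) ^ n" for n
      unfolding exp_of_nat_mult[symmetric] exp_add[symmetric] by (simp add: algebra_simps)
    moreover have "norm (exp (- x)) < 1" using that assms by simp
    ultimately have "(\<lambda>n. exp (- (of_nat (Suc n) * x))) sums (exp (- x) * (1 / (1 - exp (- x))))"
      using sums_mult[OF geometric_sums, of "exp (- x)" "exp (- x)"] by simp
    then have "(\<Sum>n. exp (- (of_nat (Suc n) * x))) = exp (- x) * (1 / (1 - exp (- x)))"
      by (rule sums_unique[symmetric])
    also have "\<dots> = ct x - 1/2"
      using exp_ne_1_Re[of x] that assms by (auto simp: ct_def exp_minus divide_simps) (simp_all add: algebra_simps)?
    finally show ?thesis .
  qed
  have "uniform_limit {x. \<rho> \<le> Re x} (\<lambda>N x. \<Sum>n<N. exp (- (of_nat (Suc n) * x))) (\<lambda>x. \<Sum>n. exp (- (of_nat (Suc n) * x))) sequentially"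
  proof (rule Weierstrass_m_test)
    show "norm (exp (- (of_nat (Suc n) * x))) \<le> exp (- \<rho>) ^ Suc n" if "x \<in> {x. \<rho> \<le> Re x}" for n x
    proof -
      have "real (Suc n) * \<rho> \<le> real (Suc n) * Re x" using that by (intro mult_left_mono) auto
      then show ?thesis unfolding exp_of_nat_mult[symmetric] by (simp add: algebra_simps)
    qed
    show "summable (\<lambda>n. exp (- \<rho>) ^ Suc n)"
      unfolding power_Suc using assms by (intro summable_mult summable_geometric) simp
  qed
  then show ?thesis
    by (rule uniform_limit_cong'[THEN iffD1, rotated 2]) (simp_all only: lim eventually_True)
qed

lemma ct_uminus: "ct (- x) = - ct x"
  by (cases "exp x = 1") (auto simp: ct_def exp_minus divide_simps, simp_all add: algebra_simps)

lemma alpha_0: "exp c \<noteq> 1 \<Longrightarrow> alpha 0 c = ct c + 1/2"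
  by (simp add: alpha_def ct_def exp_minus divide_simps) (simp add: algebra_simps)?

text \<open>The geometric series restored on this side sums to \<open>ct x - 1/2\<close>, and the
  constant term is \<open>ct c + 1/2\<close>, so the halves cancel. In
  \<open>uniform_limit_minus\<close> both halves have the opposite sign.\<close>

lemma uniform_limit_plus:
  assumes "c \<in> pstrip" "0 < \<rho>" "r < ell"
  shows "uniform_limit {x. \<rho> \<le> Re x \<and> Re x \<le> r} (\<lambda>N x. \<Sum>k = - int N..int N. alpha k c * exp (of_int k * x)) (KR c) sequentially"
proof -
  define r' where "r' = max r \<bar>Re c\<bar>"
  have r': "r' < ell" "\<bar>Re c\<bar> \<le> r'" using assms by (auto simp: r'_def pstrip_def strip_def)
  have sub: "{x. \<rho> \<le> Re x \<and> Re x \<le> r} \<subseteq> {x. \<bar>Re x\<bar> \<le> r'}" using assms by (auto simp: r'_def)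
  have "uniform_limit {x. \<rho> \<le> Re x \<and> Re x \<le> r}
      (\<lambda>N x. alpha 0 c + ((\<Sum>n<N. kr n c x) + (\<Sum>n<N. exp (- (of_nat (Suc n) * x)))))
      (\<lambda>x. alpha 0 c + (KS c x + (ct x - 1/2))) sequentially"
    by (intro uniform_limit_add uniform_limit_const
        uniform_limit_on_subset[OF uniform_limit_KS_x[OF r'] sub]
        uniform_limit_on_subset[OF uniform_limit_geometric_exp[OF assms(2)]]) auto
  moreover have "(\<Sum>k = - int N..int N. alpha k c * exp (of_int k * x)) =
      alpha 0 c + ((\<Sum>n<N. kr n c x) + (\<Sum>n<N. exp (- (of_nat (Suc n) * x))))" for N x
  proof -
    have "kr n c x + exp (- (of_nat (Suc n) * x)) =
        alpha (int (Suc n)) c * exp (of_int (int (Suc n)) * x) + alpha (- int (Suc n)) c * exp (of_int (- int (Suc n)) * x)" for n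
      by (simp only: kr_def of_int_minus of_int_of_nat_eq mult_minus_left left_diff_distrib mult_1_left) algebra
    then show ?thesis unfolding sum_symmetric_int sum.distrib[symmetric] by simp
  qed
  moreover have "alpha 0 c + (KS c x + (ct x - 1/2)) = KR c x" for x
    using assms(1) by (simp add: KR_def alpha_0 pstrip_def)
  ultimately show ?thesis by simp
qed

lemma uniform_limit_minus:
  assumes "c \<in> pstrip" "0 < \<rho>" "r < ell"
  shows "uniform_limit {x. - r \<le> Re x \<and> Re x \<le> - \<rho>} (\<lambda>N x. \<Sum>k = - int N..int N. (alpha k c - 1) * exp (of_int k * x)) (KR c) sequentially"
proof -
  define r' where "r' = max r \<bar>Re c\<bar>"
  have r': "r' < ell" "\<bar>Re c\<bar> \<le> r'" using assms by (auto simp: r'_def pstrip_def strip_def)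
  have sub: "{x. - r \<le> Re x \<and> Re x \<le> - \<rho>} \<subseteq> {x. \<bar>Re x\<bar> \<le> r'}" using assms by (auto simp: r'_def)
  have geo: "uniform_limit {x. - r \<le> Re x \<and> Re x \<le> - \<rho>} (\<lambda>N x. \<Sum>n<N. exp (of_nat (Suc n) * x)) (\<lambda>x. ct (- x) - 1/2) sequentially"
  proof (rule uniform_limitI)
    fix e :: real assume "e > 0"
    from uniform_limitD[OF uniform_limit_geometric_exp[OF assms(2)] this]
    show "\<forall>\<^sub>F N in sequentially. \<forall>x\<in>{x. - r \<le> Re x \<and> Re x \<le> - \<rho>}. dist (\<Sum>n<N. exp (of_nat (Suc n) * x)) (ct (- x) - 1/2) < e"
    proof eventually_elim
      case (elim N)
      show ?case
      proof
        fix x assume "x \<in> {x. - r \<le> Re x \<and> Re x \<le> - \<rho>}"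
        then show "dist (\<Sum>n<N. exp (of_nat (Suc n) * x)) (ct (- x) - 1/2) < e"
          using elim[rule_format, of "- x"] by simp
      qed
    qed
  qed
  have "uniform_limit {x. - r \<le> Re x \<and> Re x \<le> - \<rho>}
      (\<lambda>N x. (alpha 0 c - 1) + ((\<Sum>n<N. kr n c x) - (\<Sum>n<N. exp (of_nat (Suc n) * x))))
      (\<lambda>x. (alpha 0 c - 1) + (KS c x - (ct (- x) - 1/2))) sequentially"
    by (intro uniform_limit_add uniform_limit_minus uniform_limit_const
        uniform_limit_on_subset[OF uniform_limit_KS_x[OF r'] sub] geo)
  moreover have "(\<Sum>k = - int N..int N. (alpha k c - 1) * exp (of_int k * x)) =
      (alpha 0 c - 1) + ((\<Sum>n<N. kr n c x) - (\<Sum>n<N. exp (of_nat (Suc n) * x)))" for N x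
    unfolding sum_symmetric_int sum_subtractf[symmetric]
    by (intro arg_cong2[where f = "(+)"] sum.cong) (auto simp: kr_def algebra_simps)
  moreover have "(alpha 0 c - 1) + (KS c x - (ct (- x) - 1/2)) = KR c x" for x
    using assms(1) by (simp add: KR_def alpha_0 pstrip_def ct_uminus)
  ultimately show ?thesis by simp
qed

text \<open>\<open>x + om\<close> lies in the left half-strip, and
  \<open>(alpha k c - 1) * exp (of_int k * om)\<close> equals \<open>exp (- c) * alpha k c\<close>;
  so the left expansion at \<open>x + om\<close> is termwise \<open>exp (- c)\<close> times the
  right one at \<open>x\<close>.\<close>

lemma KR_om:
  assumes c: "c \<in> pstrip" and x: "0 < Re x" "Re x < ell"
  shows "KR c (x + om) = exp (- c) * KR c x"
proof -
  have "(\<lambda>N. \<Sum>k = - int N..int N. alpha k c * exp (of_int k * x)) \<longlonglongrightarrow> KR c x"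
    by (rule tendsto_uniform_limitI[OF uniform_limit_plus[OF c x]]) auto
  then have "(\<lambda>N. exp (- c) * (\<Sum>k = - int N..int N. alpha k c * exp (of_int k * x))) \<longlonglongrightarrow> exp (- c) * KR c x"
    by (rule tendsto_mult_left)
  moreover have "(\<lambda>N. \<Sum>k = - int N..int N. (alpha k c - 1) * exp (of_int k * (x + om))) \<longlonglongrightarrow> KR c (x + om)"
    by (rule tendsto_uniform_limitI[OF uniform_limit_minus[OF c, of "ell - Re x" "ell - Re x"]]) (use x in auto)
  moreover have "(alpha k c - 1) * exp (of_int k * (x + om)) = exp (- c) * (alpha k c * exp (of_int k * x))" for k
  proof -
    have "exp (- c - of_int k * om) * exp (of_int k * (x + om)) = exp (- c) * exp (of_int k * x)"
      unfolding exp_add[symmetric] by (simp add: algebra_simps)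
    moreover have "exp (- c - of_int k * om) \<noteq> 1" using c by (intro alpha_denominator) (auto simp: pstrip_def)
    ultimately show ?thesis by (simp add: alpha_minus_1 mult_ac)
  qed
  then have "(\<Sum>k = - int N..int N. (alpha k c - 1) * exp (of_int k * (x + om))) =
      exp (- c) * (\<Sum>k = - int N..int N. alpha k c * exp (of_int k * x))" for N
    by (simp add: sum_distrib_left)
  ultimately show ?thesis by (simp add: LIMSEQ_unique)
qed

text \<open>On the strip the poles of \<open>kron c\<close> and of \<open>ct\<close> have the same
  principal parts, so the difference of the two sides extends holomorphically. Its multiplier
  \<open>exp (- c)\<close> is not 1, hence it vanishes.\<close>

theorem kronecker_expansion:
  assumes c: "c \<in> pstrip" and x: "x \<in> pstrip"
  shows "kron c x = KR c x"
proof -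
  define ch where "ch = (\<lambda>x :: complex. (exp (x / 2) + exp (- (x / 2))) / 2)"
  \<comment> \<open>\<open>kron c - ct\<close> is \<open>f / sh\<close>. The zeros of
    \<open>sh\<close> are simple, so removing the poles amounts to showing that \<open>f\<close>
    vanishes there.\<close>
  define f where "f = (\<lambda>x. P (c + x) / (P c * Phi x) - ch x)"
  have Pc: "P c \<noteq> 0" using c by (rule P_pstrip)
  have cstrip: "c \<in> strip" using c by (simp add: pstrip_def)
  have ct: "ct y = ch y / sh y" for y
  proof -
    have "exp y + 1 = exp (y / 2) * (2 * ch y)" "exp y - 1 = exp (y / 2) * sh y"
      using exp_half_sq[of y] by (simp_all add: ch_def sh_def algebra_simps flip: exp_add)
    then show ?thesis by (simp add: ct_def)
  qed
  have fsh: "kron c y - ct y = f y / sh y" if "y \<in> strip" for y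
    using that Phi_nonzero[OF that] by (cases "sh y = 0") (auto simp: kron_def P_def f_def ct field_simps)
  obtain h where h: "h holomorphic_on strip" "\<And>y. y \<in> strip \<Longrightarrow> f y = sh y * h y"
  proof (rule holomorphic_quotient[OF open_strip _ holomorphic_sh, of f])
    show "f holomorphic_on strip"
      unfolding f_def ch_def using Phi_nonzero Pc by (intro holomorphic_intros) auto
    fix y assume y: "y \<in> strip" "sh y = 0"
    then have e: "exp y = 1" by (simp add: sh_eq_0_iff)
    then obtain m :: int where m: "Re y = 0" "Im y = of_int (2 * m) * pi" by (auto simp: exp_eq_1)
    then have y': "y = of_int m * (2 * of_real pi * \<i>)" by (simp add: complex_eq_iff)
    have eq: "exp (- (y / 2)) = exp (y / 2)" using y by (simp add: sh_def)
    then have ch: "ch y = exp (y / 2)" by (simp add: ch_def)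
    \<comment> \<open>At a multiple \<open>y\<close> of the period, the sign by which
      \<open>P\<close> has changed is written as \<open>exp (y / 2)\<close>, the form in which
      \<open>ch y\<close> appears.\<close>
    have per: "P (z + of_nat n * (2 * of_real pi * \<i>)) = exp (of_nat n * (2 * of_real pi * \<i>) / 2) * P z \<and>
       Phi (z + of_nat n * (2 * of_real pi * \<i>)) = Phi z" for n z
    proof (induction n)
      case (Suc n)
      have *: "z + of_nat (Suc n) * (2 * of_real pi * \<i>) = (z + of_nat n * (2 * of_real pi * \<i>)) + 2 * of_real pi * \<i>"
        by (simp add: algebra_simps)
      have **: "of_nat (Suc n) * (2 * of_real pi * \<i>) / 2 = of_nat n * (2 * of_real pi * \<i>) / 2 + of_real pi * \<i>"
        by (simp add: field_simps)
      show ?case unfolding * ** P_2pii exp_add using Suc by (simp add: Phi_def Phi0_2pii)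
    qed simp
    have "P (c + y) = exp (y / 2) * P c \<and> Phi y = 1"
    proof (cases "m \<ge> 0")
      case True
      then show ?thesis using per[of c "nat m"] per[of 0 "nat m"] by (simp add: y')
    next
      case False
      have "y + of_nat (nat (- m)) * (2 * of_real pi * \<i>) = 0" "(c + y) + of_nat (nat (- m)) * (2 * of_real pi * \<i>) = c"
        "of_nat (nat (- m)) * (2 * of_real pi * \<i>) / 2 = - (y / 2)"
        using False by (simp_all add: y')
      note e = this
      show ?thesis
        using per[of "c + y" "nat (- m)", unfolded e] per[of y "nat (- m)", unfolded e] by (simp add: exp_minus)
    qed
    then have "f y = 0" using Pc by (simp add: f_def ch)
    moreover have "(sh has_field_derivative (exp (y / 2) + exp (- (y / 2))) / 2) (at y)"
      unfolding sh_def by (auto intro!: derivative_eq_intros simp: field_simps)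
    then have "deriv sh y = exp (y / 2)" by (simp add: eq DERIV_imp_deriv)
    ultimately show "f y = 0 \<and> deriv sh y \<noteq> 0" by simp
  qed auto
  have hval: "h y = kron c y - ct y" if "y \<in> pstrip" for y
    using that h(2)[of y] fsh[of y] by (auto simp: pstrip_def sh_eq_0_iff)
  define D where "D = (\<lambda>y. h y - ct c - KS c y)"
  have D: "D y = kron c y - KR c y" if "y \<in> pstrip" for y
    using hval[OF that] by (simp add: D_def KR_def)
  have hD: "D holomorphic_on strip"
    unfolding D_def by (intro holomorphic_intros h holomorphic_KS cstrip)
  have kr_per: "kr n c (y + 2 * of_real pi * \<i>) = kr n c y" for n y
  proof -
    have "exp (of_nat (Suc n) * (2 * of_real pi * \<i>)) = 1"
      unfolding exp_of_nat_mult by simp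
    then have "exp (of_nat (Suc n) * (y + 2 * of_real pi * \<i>)) = exp (of_nat (Suc n) * y)"
      unfolding distrib_left exp_add by simp
    then show ?thesis by (simp only: kr_def exp_minus)
  qed
  have gen: "D (y + 2 * of_real pi * \<i>) = D y" if "y \<in> pstrip" for y
  proof -
    have "y + 2 * of_real pi * \<i> \<in> pstrip" using that by (simp add: pstrip_def strip_def exp_add)
    moreover have "kron c (y + 2 * of_real pi * \<i>) = kron c y"
      using P_2pii[of y] P_2pii[of "c + y"] by (simp add: kron_def add.assoc)
    moreover have "KR c (y + 2 * of_real pi * \<i>) = KR c y"
      by (simp add: KR_def ct_def KS_def kr_per exp_add)
    ultimately show ?thesis using D that by simp
  qed
  have per1: "D (y + 2 * of_real pi * \<i>) = D y" if "y \<in> strip" for y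
  proof (rule holomorphic_eq_off_zeros[OF open_strip connected_strip _ hD holomorphic_sh, of "\<lambda>y. D (y + 2 * of_real pi * \<i>)"])
    show "(\<lambda>y. D (y + 2 * of_real pi * \<i>)) holomorphic_on strip"
      by (rule holomorphic_on_compose_gen[OF _ hD, unfolded o_def]) (auto intro!: holomorphic_intros simp: strip_def)
    show "sh x \<noteq> 0" "x \<in> strip" using x by (auto simp: pstrip_def sh_eq_0_iff)
    fix z assume "z \<in> strip"
    then show "sh z * D (z + 2 * of_real pi * \<i>) = sh z * D z"
      using gen[of z] by (cases "sh z = 0") (auto simp: pstrip_def sh_eq_0_iff)
  qed (rule that)
  have per2: "D (y + om) = exp (- c) * D y" if "0 < Re y" "Re y < ell" for y
  proof -
    have "y \<in> pstrip" "y + om \<in> pstrip" using that by (auto simp: pstrip_def strip_def exp_ne_1_Re)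
    moreover have "kron c (y + om) = exp (- c) * kron c y"
    proof -
      have "P (c + (y + om)) = - exp (- (om / 2)) * exp (- (c + y)) * P (c + y)"
        using P_om[of "c + y"] by (simp add: add.assoc)
      moreover have "exp (- (c + y)) = exp (- c) * exp (- y)" by (simp flip: exp_add)
      ultimately show ?thesis by (simp add: kron_def P_om)
    qed
    ultimately show ?thesis using KR_om[OF c that] D by (simp add: right_diff_distrib)
  qed
  have "D x = 0"
    by (rule strip_quasi_periodic_zero[OF hD per1 per2]) (use c x in \<open>auto simp: pstrip_def\<close>)
  then show ?thesis using D[OF x] by simp
qed

lemma uniform_limit_kron_plus:
  assumes c: "c \<in> pstrip" and "0 < \<rho>" "\<rho> < ell"
  shows "uniform_limit {x. Re x = \<rho>} (\<lambda>N x. \<Sum>k = - int N..int N. alpha k c * exp (of_int k * x)) (kron c) sequentially"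
proof -
  have "uniform_limit {x. Re x = \<rho>} (\<lambda>N x. \<Sum>k = - int N..int N. alpha k c * exp (of_int k * x)) (KR c) sequentially"
    by (rule uniform_limit_on_subset[OF uniform_limit_plus[OF assms]]) auto
  moreover have "KR c x = kron c x" if "Re x = \<rho>" for x
    using that assms by (intro kronecker_expansion[symmetric]) (auto simp: pstrip_def strip_def exp_ne_1_Re)
  ultimately show ?thesis
    by (elim uniform_limit_cong'[THEN iffD1, rotated 2]) auto
qed

lemma uniform_limit_kron_minus:
  assumes c: "c \<in> pstrip" and "0 < \<rho>" "\<rho> < ell"
  shows "uniform_limit {x. Re x = - \<rho>} (\<lambda>N x. \<Sum>k = - int N..int N. (alpha k c - 1) * exp (of_int k * x)) (kron c) sequentially"
proof -
  have "uniform_limit {x. Re x = - \<rho>} (\<lambda>N x. \<Sum>k = - int N..int N. (alpha k c - 1) * exp (of_int k * x)) (KR c) sequentially"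
    by (rule uniform_limit_on_subset[OF uniform_limit_minus[OF assms]]) auto
  moreover have "KR c x = kron c x" if "Re x = - \<rho>" for x
    using that assms by (intro kronecker_expansion[symmetric]) (auto simp: pstrip_def strip_def exp_ne_1_Re)
  ultimately show ?thesis
    by (elim uniform_limit_cong'[THEN iffD1, rotated 2]) auto
qed

text \<open>Differentiating the expansion in the parameter removes the terms that make it diverge on
  the lines where one of the half-plane expansions is not available.\<close>

lemma kron_deriv_expansion:
  assumes c: "c \<in> pstrip" and x: "x \<in> pstrip" and m: "m > 0"
  shows "(\<lambda>N. \<Sum>k = - int N..int N. (deriv ^^ m) (alpha k) c * exp (of_int k * x)) \<longlonglongrightarrow> (deriv ^^ m) (\<lambda>c. kron c x) c"
proof -
  obtain r d where r: "r < ell" "d > 0" "\<bar>Re x\<bar> \<le> r" "\<bar>Re c\<bar> \<le> r" "cball c d \<subseteq> {y. \<bar>Re y\<bar> \<le> r}"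
    using strip_radius[of x c] c x by (auto simp: pstrip_def)
  define A where "A = ball c d \<inter> pstrip"
  have A: "open A" "c \<in> A" "A \<subseteq> {y. \<bar>Re y\<bar> \<le> r}" "A \<subseteq> pstrip"
  proof -
    have "A \<subseteq> cball c d" by (auto simp: A_def)
    then show "A \<subseteq> {y. \<bar>Re y\<bar> \<le> r}" using r(5) by (rule subset_trans)
  qed (use r c in \<open>auto simp: A_def open_pstrip\<close>)
  define f where "f = (\<lambda>N c. \<Sum>k = - int N..int N. alpha k c * exp (of_int k * x))"
  \<comment> \<open>The gap between the partial sums and the convergent regularization depends on
    \<open>N\<close> and \<open>x\<close> only. For \<open>Re x \<le> 0\<close> it has no limit in
    \<open>N\<close>, but differentiation in \<open>c\<close> removes it.\<close>
  define g where "g = (\<lambda>N. ct x - 1/2 - (\<Sum>n<N. exp (- (of_nat (Suc n) * x))))"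
  have f: "f N c' + g N = ct x + ct c' + (\<Sum>n<N. kr n c' x)" if "c' \<in> A" for N c'
  proof -
    have "kr n c' x + exp (- (of_nat (Suc n) * x)) =
        alpha (int (Suc n)) c' * exp (of_int (int (Suc n)) * x) + alpha (- int (Suc n)) c' * exp (of_int (- int (Suc n)) * x)" for n
      by (simp only: kr_def of_int_minus of_int_of_nat_eq mult_minus_left left_diff_distrib mult_1_left) algebra
    then have "f N c' = alpha 0 c' + (\<Sum>n<N. kr n c' x + exp (- (of_nat (Suc n) * x)))"
      unfolding f_def sum_symmetric_int by simp
    moreover have "alpha 0 c' = ct c' + 1/2" using that A by (intro alpha_0) (auto simp: pstrip_def)
    ultimately show ?thesis by (simp add: g_def sum.distrib)
  qed
  have "uniform_limit A (\<lambda>N c. ct x + ct c + (\<Sum>n<N. kr n c x)) (\<lambda>c. ct x + ct c + KS c x) sequentially"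
    by (intro uniform_limit_add uniform_limit_const uniform_limit_on_subset[OF uniform_limit_KS_c[OF r(1,3)] A(3)])
  then have ul: "uniform_limit A (\<lambda>N c. f N c + g N) (\<lambda>c. kron c x) sequentially"
  proof (elim uniform_limit_cong'[THEN iffD1, rotated 2])
    fix c' assume "c' \<in> A"
    then show "ct x + ct c' + KS c' x = kron c' x"
      using kronecker_expansion[of c' x] A x by (auto simp: KR_def)
  qed (simp add: f)
  have hf: "f N holomorphic_on A" for N
    unfolding f_def using holomorphic_alpha A(4) by (intro holomorphic_intros) (auto intro: holomorphic_on_subset)
  have "(\<lambda>N. (deriv ^^ m) (\<lambda>c. f N c + g N) c) \<longlonglongrightarrow> (deriv ^^ m) (\<lambda>c. kron c x) c"
    by (rule higher_deriv_complex_uniform_limit[OF ul]) (use A hf in \<open>auto intro!: always_eventually holomorphic_intros\<close>)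
  moreover have "(deriv ^^ m) (\<lambda>c. f N c + g N) c = (\<Sum>k = - int N..int N. (deriv ^^ m) (alpha k) c * exp (of_int k * x))" for N
  proof -
    have ha: "alpha k holomorphic_on A" for k using holomorphic_alpha A(4) by (rule holomorphic_on_subset)
    have "(deriv ^^ m) (\<lambda>c. f N c + g N) c = (deriv ^^ m) (f N) c + (deriv ^^ m) (\<lambda>c. g N) c"
      by (rule higher_deriv_add[OF hf _ A(1,2)]) auto
    also have "(deriv ^^ m) (\<lambda>c. g N) c = 0" using m by simp
    also have "(deriv ^^ m) (f N) c = (\<Sum>k = - int N..int N. (deriv ^^ m) (\<lambda>c. alpha k c * exp (of_int k * x)) c)"
      unfolding f_def by (rule higher_deriv_sum[OF _ _ A(1,2)]) (auto intro!: holomorphic_intros ha)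
    also have "\<dots> = (\<Sum>k = - int N..int N. (deriv ^^ m) (alpha k) c * exp (of_int k * x))"
    proof (rule sum.cong [OF refl])
      fix k
      have "(deriv ^^ m) (\<lambda>c. exp (of_int k * x) * alpha k c) c = exp (of_int k * x) * (deriv ^^ m) (alpha k) c"
        by (rule higher_deriv_cmult[OF ha A(2,1)])
      then show "(deriv ^^ m) (\<lambda>c. alpha k c * exp (of_int k * x)) c = (deriv ^^ m) (alpha k) c * exp (of_int k * x)"
        by (simp add: mult.commute)
    qed
    finally show ?thesis by simp
  qed
  ultimately show ?thesis by simp
qed

text \<open>With \<open>a = alpha k c\<close>, the function \<open>alpha k\<close> is the
  logarithmic derivative of \<open>b s = (1 - a) + a * exp (s - c)\<close>, whose value at
  \<open>c\<close> is 1 and whose derivatives of positive order there are all \<open>a\<close>.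
  Leibniz's rule for \<open>alpha k * b\<close> gives the recursion that \<open>set_exp_eps\<close>
  asks for.\<close>

lemma alpha_deriv_recurrence:
  assumes c: "c \<in> pstrip"
  shows "alpha k c = (\<Sum>j\<le>m. of_nat (m choose j) * (deriv ^^ j) (alpha k) c * (if j = m then 1 else alpha k c))"
proof -
  define a where "a = alpha k c"
  define b where "b = (\<lambda>s. (1 - a) + a * exp (s - c))"
  have hb: "b holomorphic_on pstrip" unfolding b_def by (intro holomorphic_intros)
  have id: "alpha k s * b s = a * exp (s - c)" if "s \<in> pstrip" for s
  proof -
    define y where "y = exp (- c - of_int k * om)"
    define e where "e = exp (s - c)"
    have y: "y \<noteq> 1" unfolding y_def using c by (intro alpha_denominator) (auto simp: pstrip_def)
    have "exp (- s - of_int k * om) = y / e"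
      unfolding y_def e_def exp_diff[symmetric] by (rule arg_cong[where f = exp]) simp
    moreover have "exp (- s - of_int k * om) \<noteq> 1"
      using that by (intro alpha_denominator) (auto simp: pstrip_def)
    ultimately have ne: "y / e \<noteq> 1" and as: "alpha k s = 1 / (1 - y / e)"
      by (simp_all add: alpha_def)
    have e: "e \<noteq> 0" by (simp add: e_def)
    have a: "a = 1 / (1 - y)" by (simp add: a_def alpha_def y_def)
    have "e \<noteq> y" using ne e by auto
    then show ?thesis unfolding as b_def a e_def[symmetric] using y e by (simp add: divide_simps)
  qed
  have "a = (deriv ^^ m) (\<lambda>s. a * exp (s - c)) c" by (simp add: higher_deriv_exp_shift)
  also have "\<dots> = (deriv ^^ m) (\<lambda>s. alpha k s * b s) c"
    by (rule higher_deriv_transform_within_open[OF _ _ open_pstrip c])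
       (auto simp: id intro!: holomorphic_intros holomorphic_alpha hb)
  also have "\<dots> = (\<Sum>j = 0..m. of_nat (m choose j) * (deriv ^^ j) (alpha k) c * (deriv ^^ (m - j)) b c)"
    by (rule higher_deriv_mult[OF holomorphic_alpha hb open_pstrip c])
  also have "\<dots> = (\<Sum>j\<le>m. of_nat (m choose j) * (deriv ^^ j) (alpha k) c * (if j = m then 1 else a))"
  proof (rule sum.cong)
    fix j assume j: "j \<in> {..m}"
    have "(deriv ^^ i) b c = (if i = 0 then 1 else a)" for i
    proof (cases "i = 0")
      case False
      have "(deriv ^^ i) b c = (deriv ^^ i) (\<lambda>s. 1 - a) c + (deriv ^^ i) (\<lambda>s. a * exp (s - c)) c"
        unfolding b_def by (rule higher_deriv_add[of _ UNIV]) (auto intro!: holomorphic_intros)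
      then show ?thesis using False by (simp add: higher_deriv_exp_shift)
    qed (simp add: b_def)
    then show "of_nat (m choose j) * (deriv ^^ j) (alpha k) c * (deriv ^^ (m - j)) b c =
        of_nat (m choose j) * (deriv ^^ j) (alpha k) c * (if j = m then 1 else a)"
      using j by auto
  qed auto
  finally show ?thesis unfolding a_def .
qed

end

section \<open>Logarithmic derivatives and the recursion of the Bell polynomials\<close>

definition logd :: "(complex \<Rightarrow> complex) \<Rightarrow> complex \<Rightarrow> complex" where
  "logd f x = deriv f x / f x"

lemma holomorphic_logd:
  "open A \<Longrightarrow> f holomorphic_on A \<Longrightarrow> (\<And>x. x \<in> A \<Longrightarrow> f x \<noteq> 0) \<Longrightarrow> logd f holomorphic_on A"
  unfolding logd_def[abs_def] by (intro holomorphic_intros) auto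

text \<open>Leibniz's rule for \<open>deriv f = logd f * f\<close>. This is the recursion of
  \<open>complete_bell_Suc\<close>, with the derivatives of \<open>logd f\<close> as
  arguments.\<close>

lemma higher_deriv_logd_mult:
  assumes A: "open A" "z \<in> A" and f: "f holomorphic_on A" "\<And>x. x \<in> A \<Longrightarrow> f x \<noteq> 0"
  shows "(deriv ^^ Suc m) f z = (\<Sum>i\<le>m. of_nat (m choose i) * (deriv ^^ i) (logd f) z * (deriv ^^ (m - i)) f z)"
proof -
  have hl: "logd f holomorphic_on A" using A f by (intro holomorphic_logd)
  have "(deriv ^^ Suc m) f z = (deriv ^^ m) (deriv f) z" by (simp add: funpow_Suc_right del: funpow.simps)
  also have "\<dots> = (deriv ^^ m) (\<lambda>x. logd f x * f x) z"
  proof (rule higher_deriv_transform_within_open[OF _ _ A])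
    show "(\<lambda>x. logd f x * f x) holomorphic_on A" by (intro holomorphic_on_mult hl f)
    show "deriv f x = logd f x * f x" if "x \<in> A" for x using f(2)[OF that] by (simp add: logd_def)
  qed (intro holomorphic_intros f A)
  also have "\<dots> = (\<Sum>i = 0..m. of_nat (m choose i) * (deriv ^^ i) (logd f) z * (deriv ^^ (m - i)) f z)"
    by (rule higher_deriv_mult[OF hl f(1) A])
  finally show ?thesis by (simp add: atMost_atLeast0)
qed

lemma higher_deriv_logd_rec:
  assumes A: "open A" "z \<in> A" and f: "f holomorphic_on A" "\<And>x. x \<in> A \<Longrightarrow> f x \<noteq> 0"
  shows "(deriv ^^ m) (logd f) z =
    ((deriv ^^ Suc m) f z - (\<Sum>i<m. of_nat (m choose i) * (deriv ^^ i) (logd f) z * (deriv ^^ (m - i)) f z)) / f z"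
  using higher_deriv_logd_mult[OF A f, of m] f(2)[OF A(2)]
  by (simp flip: lessThan_Suc_atMost del: funpow.simps)

text \<open>Solved for its top term, the recursion expresses the derivatives of
  \<open>logd f\<close> by those of \<open>f\<close>, which converge because the functions converge
  uniformly. No branch of a logarithm has to be chosen.\<close>

lemma logd_limit:
  assumes A: "open A" "z \<in> A" and lim: "uniform_limit A f g sequentially"
    and f: "\<And>n. f n holomorphic_on A" "\<And>n x. x \<in> A \<Longrightarrow> f n x \<noteq> 0"
    and g: "g holomorphic_on A" "\<And>x. x \<in> A \<Longrightarrow> g x \<noteq> 0"
  shows "(\<lambda>n. (deriv ^^ m) (logd (f n)) z) \<longlonglongrightarrow> (deriv ^^ m) (logd g) z"
proof (induction m rule: less_induct)
  case (less m)
  have d: "(\<lambda>n. (deriv ^^ k) (f n) z) \<longlonglongrightarrow> (deriv ^^ k) g z" for k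
    by (rule higher_deriv_complex_uniform_limit[OF lim]) (use A f in auto)
  have "(\<lambda>n. ((deriv ^^ Suc m) (f n) z - (\<Sum>i<m. of_nat (m choose i) * (deriv ^^ i) (logd (f n)) z * (deriv ^^ (m - i)) (f n) z)) / f n z)
    \<longlonglongrightarrow> ((deriv ^^ Suc m) g z - (\<Sum>i<m. of_nat (m choose i) * (deriv ^^ i) (logd g) z * (deriv ^^ (m - i)) g z)) / g z"
    using less d[of 0] A g(2) by (intro tendsto_intros d) auto
  then show ?case
    using higher_deriv_logd_rec[OF A, of "f _" m] higher_deriv_logd_rec[OF A, of g m] f g by simp
qed

lemma logd_mult:
  assumes "f field_differentiable at x" "g field_differentiable at x" "f x \<noteq> 0" "g x \<noteq> 0"
  shows "logd (\<lambda>x. f x * g x) x = logd f x + logd g x"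
  using assms by (simp add: logd_def deriv_mult field_simps)

lemma logd_prod:
  assumes "finite I" "\<And>i. i \<in> I \<Longrightarrow> f i field_differentiable at x" "\<And>i. i \<in> I \<Longrightarrow> f i x \<noteq> 0"
  shows "logd (\<lambda>x. \<Prod>i\<in>I. f i x) x = (\<Sum>i\<in>I. logd (f i) x)"
  using assms
proof (induction I rule: finite_induct)
  case empty
  then show ?case by (simp add: logd_def)
next
  case (insert i I)
  have "(\<lambda>x. \<Prod>i\<in>I. f i x) field_differentiable at x"
    using insert(1,4) by (induction I rule: finite_induct) (auto intro!: field_differentiable_mult)
  then show ?case using insert by (simp add: logd_mult)
qed

lemma higher_deriv_inverse_shift:
  assumes "x + c \<noteq> 0"
  shows "(deriv ^^ k) (\<lambda>x. 1 / (x + c)) x = (-1) ^ k * fact k / (x + c :: complex) ^ Suc k"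
  using assms
proof (induction k arbitrary: x)
  case (Suc k)
  have S: "open {x. x + c \<noteq> 0}"
    by (intro open_Collect_neq continuous_intros)
  have "(deriv ^^ Suc k) (\<lambda>x. 1 / (x + c)) x = deriv ((deriv ^^ k) (\<lambda>x. 1 / (x + c))) x" by simp
  also have "\<dots> = deriv (\<lambda>x. (-1) ^ k * fact k / (x + c) ^ Suc k) x"
  proof (rule deriv_cong_ev)
    have "eventually (\<lambda>x. x \<in> {x. x + c \<noteq> 0}) (nhds x)"
      using S Suc.prems by (intro eventually_nhds_in_open) auto
    then show "eventually (\<lambda>x. (deriv ^^ k) (\<lambda>x. 1 / (x + c)) x = (-1) ^ k * fact k / (x + c) ^ Suc k) (nhds x)"
      by eventually_elim (use Suc.IH in auto)
  qed simp
  also have "\<dots> = (-1) ^ Suc k * fact (Suc k) / (x + c) ^ Suc (Suc k)"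
  proof (rule DERIV_imp_deriv)
    have "((\<lambda>x. (-1) ^ k * fact k / (x + c) ^ Suc k) has_field_derivative
       (0 * (x + c) ^ Suc k - (-1) ^ k * fact k * (of_nat (Suc k) * (x + c) ^ k)) / ((x + c) ^ Suc k * (x + c) ^ Suc k)) (at x)"
      using Suc.prems by (auto intro!: derivative_eq_intros simp del: power_Suc of_nat_Suc)
    then show "((\<lambda>x. (-1) ^ k * fact k / (x + c) ^ Suc k) has_field_derivative
        (-1) ^ Suc k * fact (Suc k) / (x + c) ^ Suc (Suc k)) (at x)"
      using Suc.prems by (simp add: divide_simps del: of_nat_Suc) (simp add: mult_ac)
  qed
  finally show ?case .
qed simp

lemma complete_bell_0: "complete_bell 0 x = 1"
  by (simp add: complete_bell_def)

text \<open>The exponential E of the series X satisfies E' = X' E; the recursion compares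
  coefficients.\<close>

lemma complete_bell_Suc:
  "complete_bell (Suc m) x = (\<Sum>j\<le>m. of_nat (m choose j) * x (Suc j) * complete_bell (m - j) x)"
proof -
  define X where "X = Abs_fps (\<lambda>k. if k = 0 then 0 else x k / fact k)"
  define E where "E = fps_compose (fps_exp 1) X"
  have cb: "complete_bell k x = fact k * fps_nth E k" for k
    by (simp add: complete_bell_def E_def X_def)
  have "fps_deriv E = E * fps_deriv X"
    unfolding E_def by (subst fps_compose_deriv) (simp_all add: X_def)
  then have "fps_nth (fps_deriv E) m = fps_nth (fps_deriv X * E) m" by (simp add: mult.commute)
  then have "of_nat (Suc m) * fps_nth E (Suc m) = (\<Sum>j\<le>m. (of_nat (Suc j) * fps_nth X (Suc j)) * fps_nth E (m - j))"
    by (simp add: fps_mult_nth atMost_atLeast0)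
  then have "complete_bell (Suc m) x = fact m * (\<Sum>j\<le>m. (of_nat (Suc j) * fps_nth X (Suc j)) * fps_nth E (m - j))"
    by (simp only: cb fact_Suc of_nat_mult mult.assoc mult.left_commute mult.commute)
  also have "\<dots> = (\<Sum>j\<le>m. of_nat (m choose j) * x (Suc j) * complete_bell (m - j) x)"
    unfolding sum_distrib_left
  proof (rule sum.cong [OF refl])
    fix j assume j: "j \<in> {..m}"
    have "of_nat (Suc j) * fps_nth X (Suc j) = x (Suc j) / fact j"
      by (simp add: X_def del: of_nat_Suc)
    moreover have "(of_nat (m choose j) :: complex) = fact m / (fact j * fact (m - j))"
      using j by (simp add: binomial_fact)
    ultimately show "fact m * (of_nat (Suc j) * fps_nth X (Suc j) * fps_nth E (m - j)) =
        of_nat (m choose j) * x (Suc j) * complete_bell (m - j) x"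
      by (simp add: cb)
  qed
  finally show ?thesis .
qed

context half_plane
begin

section \<open>Eisenstein--Kronecker series and Bell polynomials\<close>

text \<open>\<open>G x\<close> is the product for \<open>2 sinh (x / 2) / x\<close>.\<close>

definition hfac :: "nat \<Rightarrow> complex \<Rightarrow> complex" where
  "hfac n x = 1 + x\<^sup>2 / (4 * of_real pi ^ 2 * of_nat (Suc n) ^ 2)"

definition G :: "complex \<Rightarrow> complex" where
  "G x = lim (\<lambda>N. \<Prod>n<N. hfac n x)"

lemma uniform_limit_G: "compact K \<Longrightarrow> uniform_limit K (\<lambda>N x. \<Prod>n<N. hfac n x) G sequentially"
proof -
  assume K: "compact K"
  have "bounded ((\<lambda>x. x\<^sup>2) ` K)"
    by (intro compact_imp_bounded compact_continuous_image continuous_intros K)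
  then obtain B where B: "\<And>x. x \<in> K \<Longrightarrow> norm (x\<^sup>2) \<le> B" unfolding bounded_iff by auto
  have "uniformly_convergent_on K (\<lambda>N x. \<Prod>n<N. hfac n x)"
  proof (rule uniformly_convergent_on_prod')
    show "continuous_on K (hfac n)" for n
      unfolding hfac_def by (intro continuous_intros) (simp_all del: of_nat_Suc)
    show "uniformly_convergent_on K (\<lambda>N x. \<Sum>n<N. norm (hfac n x - 1))"
    proof (rule Weierstrass_m_test')
      show "norm (norm (hfac n x - 1)) \<le> B / (4 * pi ^ 2) * (1 / real (Suc n) ^ 2)" if "x \<in> K" for n x
        using B[OF that] by (simp add: hfac_def norm_divide norm_mult norm_power del: of_nat_Suc)
           (simp add: divide_right_mono)
      show "summable (\<lambda>n. B / (4 * pi ^ 2) * (1 / real (Suc n) ^ 2))"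
        using inverse_power_summable[of 2, where 'a = real]
        by (intro summable_mult) (simp add: summable_Suc_iff[of "\<lambda>n. 1 / real n ^ 2"] inverse_eq_divide del: of_nat_Suc)
    qed
  qed (rule K)
  then show ?thesis unfolding G_def uniformly_convergent_uniform_limit_iff .
qed

lemma tendsto_G: "(\<lambda>N. \<Prod>n<N. hfac n x) \<longlonglongrightarrow> G x"
  using tendsto_uniform_limitI[OF uniform_limit_G[of "{x}"]] by simp

lemma holomorphic_G: "G holomorphic_on A"
proof (rule holomorphic_on_subset)
  show "G holomorphic_on UNIV"
  proof (rule holomorphic_uniform_sequence)
    show "(\<lambda>x. \<Prod>n<N. hfac n x) holomorphic_on UNIV" for N
      unfolding hfac_def by (intro holomorphic_intros) auto
    show "\<exists>d>0. cball x d \<subseteq> UNIV \<and> uniform_limit (cball x d) (\<lambda>N x. \<Prod>n<N. hfac n x) G sequentially" for x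
      by (intro exI[of _ 1]) (auto intro: uniform_limit_G)
  qed auto
qed auto

lemma G_0: "G 0 = 1"
  by (simp add: G_def hfac_def)

lemma sh_eq_G: "sh x = x * G x"
proof -
  define z where "z = x / (2 * of_real pi * \<i>)"
  have "(\<lambda>n. of_real pi * z * (\<Prod>k=1..n. 1 - z\<^sup>2 / of_nat k ^ 2)) \<longlonglongrightarrow> sin (of_real pi * z)"
    by (rule sin_product_formula_complex)
  moreover have "(\<Prod>k=1..n. 1 - z\<^sup>2 / of_nat k ^ 2) = (\<Prod>k<n. hfac k x)" for n
  proof -
    have "(\<Prod>k=1..n. 1 - z\<^sup>2 / of_nat k ^ 2) = (\<Prod>k<n. 1 - z\<^sup>2 / of_nat (Suc k) ^ 2)"
      by (rule prod.reindex_bij_witness[where i = Suc and j = "\<lambda>k. k - 1"]) auto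
    also have "\<dots> = (\<Prod>k<n. hfac k x)"
      by (rule prod.cong) (auto simp: z_def hfac_def power_divide power_mult_distrib simp del: of_nat_Suc)
    finally show ?thesis .
  qed
  ultimately have "(\<lambda>n. of_real pi * z * (\<Prod>k<n. hfac k x)) \<longlonglongrightarrow> sin (of_real pi * z)" by simp
  moreover have "(\<lambda>n. of_real pi * z * (\<Prod>k<n. hfac k x)) \<longlonglongrightarrow> of_real pi * z * G x"
    by (intro tendsto_mult_left tendsto_G)
  ultimately have "of_real pi * z * G x = sin (of_real pi * z)" using LIMSEQ_unique by blast
  moreover have "of_real pi * z = x / (2 * \<i>)" by (simp add: z_def)
  moreover have "sin (x / (2 * \<i>)) = sh x / (2 * \<i>)"
    by (simp add: sin_exp_eq sh_def field_simps)
  ultimately have "x / (2 * \<i>) * G x = sh x / (2 * \<i>)" by (simp only:)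
  then show ?thesis by simp
qed

lemma P_eq_G: "P x = x * G x * Phi x"
  by (simp add: P_def sh_eq_G)

lemma hfac_nonzero: "G x \<noteq> 0 \<Longrightarrow> hfac n x \<noteq> 0"
proof
  assume "G x \<noteq> 0" "hfac n x = 0"
  have "(\<lambda>N. \<Prod>n<N. hfac n x) \<longlonglongrightarrow> 0"
  proof (rule tendsto_eventually)
    show "\<forall>\<^sub>F N in sequentially. (\<Prod>n<N. hfac n x) = 0"
      using eventually_gt_at_top[of n] by eventually_elim (use \<open>hfac n x = 0\<close> in auto)
  qed
  then show False using tendsto_G[of x] \<open>G x \<noteq> 0\<close> LIMSEQ_unique by blast
qed

lemma fac_nonzero': "Phi x \<noteq> 0 \<Longrightarrow> fac n x \<noteq> 0"
proof
  assume "Phi x \<noteq> 0" "fac n x = 0"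
  have "(\<lambda>N. \<Prod>n<N. fac n x) \<longlonglongrightarrow> 0"
  proof (rule tendsto_eventually)
    show "\<forall>\<^sub>F N in sequentially. (\<Prod>n<N. fac n x) = 0"
      using eventually_gt_at_top[of n] by eventually_elim (use \<open>fac n x = 0\<close> in auto)
  qed
  then have "Phi0 x = 0" using tendsto_Phi0[of x] LIMSEQ_unique by blast
  then show False using \<open>Phi x \<noteq> 0\<close> by (simp add: Phi_def)
qed

lemma open_nonzero: "f holomorphic_on UNIV \<Longrightarrow> open {x. f x \<noteq> (0::complex)}"
  by (intro open_Collect_neq holomorphic_on_imp_continuous_on continuous_intros)

text \<open>\<open>hfac n\<close> factors as \<open>(x + w) * (x - w) / (- w\<^sup>2)\<close> for
  \<open>w\<close> the \<open>(n + 1)\<close>-fold period, so the logarithmic derivative of a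
  partial product is a symmetric partial sum over one row of the lattice without its centre.\<close>

lemma inner_limit:
  assumes "G z \<noteq> 0"
  shows "(\<lambda>N. \<Sum>n<N. (-1) ^ k * fact k / (z + of_int (int (Suc n)) * (2 * of_real pi * \<i>)) ^ Suc k +
      (-1) ^ k * fact k / (z + of_int (- int (Suc n)) * (2 * of_real pi * \<i>)) ^ Suc k) \<longlonglongrightarrow> (deriv ^^ k) (logd G) z"
proof -
  define A where "A = {x. G x \<noteq> 0} \<inter> ball z 1"
  have A: "open A" "z \<in> A" using assms open_nonzero[OF holomorphic_G] by (auto simp: A_def)
  define w where "w = (\<lambda>n. of_int (int (Suc n)) * (2 * of_real pi * \<i>))"
  have hf: "hfac n x \<noteq> 0" if "x \<in> A" for n x using that hfac_nonzero by (auto simp: A_def)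
  have hw: "hfac n x = (x + w n) * (x + - w n) / (- (w n)\<^sup>2)" and w0: "w n \<noteq> 0" for n x
    by (simp_all add: hfac_def w_def power2_eq_square field_simps del: of_nat_Suc)
  have nz: "x + w n \<noteq> 0 \<and> x + - w n \<noteq> 0" if "x \<in> A" for n x
    using hf[OF that, of n] unfolding hw by auto
  have "(\<lambda>N. (deriv ^^ k) (logd (\<lambda>x. \<Prod>n<N. hfac n x)) z) \<longlonglongrightarrow> (deriv ^^ k) (logd G) z"
  proof (rule logd_limit[OF A])
    show "uniform_limit A (\<lambda>N x. \<Prod>n<N. hfac n x) G sequentially"
      by (rule uniform_limit_on_subset[OF uniform_limit_G[of "cball z 1"]]) (auto simp: A_def)
    show "(\<lambda>x. \<Prod>n<N. hfac n x) holomorphic_on A" for N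
      unfolding hfac_def by (intro holomorphic_intros) auto
  qed (use hf holomorphic_G in \<open>auto simp: A_def\<close>)
  moreover have "(deriv ^^ k) (logd (\<lambda>x. \<Prod>n<N. hfac n x)) z = (\<Sum>n<N. (-1) ^ k * fact k / (z + w n) ^ Suc k + (-1) ^ k * fact k / (z + - w n) ^ Suc k)" for N
  proof -
    have "(deriv ^^ k) (logd (\<lambda>x. \<Prod>n<N. hfac n x)) z = (deriv ^^ k) (\<lambda>x. \<Sum>n<N. (1 / (x + w n) + 1 / (x + - w n))) z"
    proof (rule higher_deriv_transform_within_open[OF _ _ A])
      show "logd (\<lambda>x. \<Prod>n<N. hfac n x) holomorphic_on A"
        using hf by (intro holomorphic_logd A) (auto simp: hfac_def intro!: holomorphic_intros)
      show "(\<lambda>x. \<Sum>n<N. (1 / (x + w n) + 1 / (x + - w n))) holomorphic_on A"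
        using nz by (intro holomorphic_intros) auto
      fix x assume x: "x \<in> A"
      have d: "(hfac n has_field_derivative 2 * x / (- (w n)\<^sup>2)) (at x)" for n
        unfolding hw[abs_def] using w0[of n] by (auto intro!: derivative_eq_intros simp: field_simps)
      then have fd: "hfac n field_differentiable at x" for n by (auto simp: field_differentiable_def)
      have "logd (hfac n) x = 1 / (x + w n) + 1 / (x + - w n)" for n
        using nz[OF x, of n] w0[of n] unfolding logd_def DERIV_imp_deriv[OF d] hw
        by (simp add: divide_simps)
      then show "logd (\<lambda>x. \<Prod>n<N. hfac n x) x = (\<Sum>n<N. (1 / (x + w n) + 1 / (x + - w n)))"
        using logd_prod[of "{..<N}" hfac x] fd hf[OF x] by simp
    qed
    also have "\<dots> = (\<Sum>n<N. (deriv ^^ k) (\<lambda>x. 1 / (x + w n) + 1 / (x + - w n)) z)"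
      by (rule higher_deriv_sum[OF _ _ A]) (use nz in \<open>auto intro!: holomorphic_intros\<close>)
    also have "\<dots> = (\<Sum>n<N. (-1) ^ k * fact k / (z + w n) ^ Suc k + (-1) ^ k * fact k / (z + - w n) ^ Suc k)"
    proof (rule sum.cong [OF refl])
      fix n
      have "(deriv ^^ k) (\<lambda>x. 1 / (x + w n) + 1 / (x + - w n)) z =
         (deriv ^^ k) (\<lambda>x. 1 / (x + w n)) z + (deriv ^^ k) (\<lambda>x. 1 / (x + - w n)) z"
        by (rule higher_deriv_add[OF _ _ A]) (use nz in \<open>auto intro!: holomorphic_intros\<close>)
      then show "(deriv ^^ k) (\<lambda>x. 1 / (x + w n) + 1 / (x + - w n)) z =
         (-1) ^ k * fact k / (z + w n) ^ Suc k + (-1) ^ k * fact k / (z + - w n) ^ Suc k"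
        using nz[OF A(2), of n]
        by (simp only: higher_deriv_inverse_shift[of z "w n"] higher_deriv_inverse_shift[of z "- w n"] simp_thms)
    qed
    finally show ?thesis .
  qed
  ultimately have L: "(\<lambda>N. \<Sum>n<N. (-1) ^ k * fact k / (z + w n) ^ Suc k + (-1) ^ k * fact k / (z + - w n) ^ Suc k)
      \<longlonglongrightarrow> (deriv ^^ k) (logd G) z" by (simp only:)
  have w': "- w n = of_int (- int (Suc n)) * (2 * of_real pi * \<i>)" for n
    by (simp only: w_def of_int_minus mult_minus_left)
  show ?thesis using L unfolding w' unfolding w_def .
qed

text \<open>The \<open>k\<close>-th derivative of \<open>coth (x / 2) / 2\<close>.\<close>

definition ctk :: "nat \<Rightarrow> complex \<Rightarrow> complex" where
  "ctk k x = (deriv ^^ k) (logd G) x + (-1) ^ k * fact k / x ^ Suc k"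

lemma full_inner_limit:
  assumes "G z \<noteq> 0"
  shows "(\<lambda>N. \<Sum>a = - int N..int N. (-1) ^ k * fact k / (z + of_int a * (2 * of_real pi * \<i>)) ^ Suc k) \<longlonglongrightarrow> ctk k z"
  using tendsto_add[OF tendsto_const[of "(-1) ^ k * fact k / z ^ Suc k"] inner_limit[OF assms, of k]]
  unfolding sum_symmetric_int ctk_def by (simp add: add.commute del: power_Suc of_nat_Suc)

lemma G_uminus: "G (- x) = G x"
  by (simp add: G_def hfac_def)

lemma ctk_uminus:
  assumes "G z \<noteq> 0"
  shows "ctk k (- z) = - ((-1) ^ k * ctk k z)"
proof -
  have "(\<lambda>N. - ((-1) ^ k) * (\<Sum>a = - int N..int N. (-1) ^ k * fact k / (z + of_int a * (2 * of_real pi * \<i>)) ^ Suc k))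
     \<longlonglongrightarrow> - ((-1) ^ k) * ctk k z"
    by (intro tendsto_mult_left full_inner_limit assms)
  moreover have "- ((-1) ^ k) * (\<Sum>a = - int N..int N. (-1) ^ k * fact k / (z + of_int a * (2 * of_real pi * \<i>)) ^ Suc k) =
      (\<Sum>a = - int N..int N. (-1) ^ k * fact k / (- z + of_int a * (2 * of_real pi * \<i>)) ^ Suc k)" for N
    unfolding sum_distrib_left
  proof (rule sum.reindex_bij_witness[where i = uminus and j = uminus])
    fix a :: int
    have "(- z + of_int (- a) * (2 * of_real pi * \<i>)) ^ Suc k = (- (z + of_int a * (2 * of_real pi * \<i>))) ^ Suc k"
      by (rule arg_cong[where f = "\<lambda>x. x ^ Suc k"]) simp
    also have "\<dots> = (-1) ^ Suc k * (z + of_int a * (2 * of_real pi * \<i>)) ^ Suc k"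
      by (rule power_minus)
    finally have eq: "(- z + of_int (- a) * (2 * of_real pi * \<i>)) ^ Suc k =
        (-1) ^ Suc k * (z + of_int a * (2 * of_real pi * \<i>)) ^ Suc k" .
    have "(-1) ^ k * f / ((-1) ^ Suc k * D) = - ((-1) ^ k) * ((-1) ^ k * f / D)" for f D :: complex
      by (cases "even k") simp_all
    then show "(-1) ^ k * fact k / (- z + of_int (- a) * (2 * of_real pi * \<i>)) ^ Suc k =
        - ((-1) ^ k) * ((-1) ^ k * fact k / (z + of_int a * (2 * of_real pi * \<i>)) ^ Suc k)"
      by (simp only: eq)
  qed auto
  ultimately have "(\<lambda>N. \<Sum>a = - int N..int N. (-1) ^ k * fact k / (- z + of_int a * (2 * of_real pi * \<i>)) ^ Suc k)
     \<longlonglongrightarrow> - ((-1) ^ k) * ctk k z" by simp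
  then show ?thesis
    using full_inner_limit[of "- z" k] assms LIMSEQ_unique by (fastforce simp: G_uminus)
qed

text \<open>For even \<open>k\<close> the terms of opposite lattice points cancel at 0 and the
  derivative vanishes; for odd \<open>k\<close> the sign is already -1.\<close>

lemma higher_deriv_logd_G_0: "(-1) ^ k * (deriv ^^ k) (logd G) 0 = - (deriv ^^ k) (logd G) 0"
proof (cases "even k")
  case True
  have "(\<lambda>N. \<Sum>n<N. (-1) ^ k * fact k / (0 + of_int (int (Suc n)) * (2 * of_real pi * \<i>)) ^ Suc k +
      (-1) ^ k * fact k / (0 + of_int (- int (Suc n)) * (2 * of_real pi * \<i>)) ^ Suc k) \<longlonglongrightarrow> (deriv ^^ k) (logd G) 0"
    by (rule inner_limit) (simp add: G_0)
  moreover have "(-1) ^ k * fact k / (0 + of_int (int (Suc n)) * (2 * of_real pi * \<i>)) ^ Suc k +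
      (-1) ^ k * fact k / (0 + of_int (- int (Suc n)) * (2 * of_real pi * \<i>)) ^ Suc k = (0 :: complex)" for n
  proof -
    have "0 + of_int (- int (Suc n)) * (2 * of_real pi * \<i>) = - (0 + of_int (int (Suc n)) * (2 * of_real pi * \<i>))"
      by (simp only: of_int_minus add_0 mult_minus_left)
    moreover have "(- x) ^ Suc k = - (x ^ Suc k)" for x :: complex
      using True by (intro power_minus_odd) simp
    moreover have "f / D + f / (- D) = 0" for f D :: complex by simp
    ultimately show ?thesis by (simp only:)
  qed
  ultimately have "(\<lambda>N. 0) \<longlonglongrightarrow> (deriv ^^ k) (logd G) 0" by (simp only: sum.neutral_const)
  then have "(deriv ^^ k) (logd G) 0 = 0" by (simp add: LIMSEQ_const_iff)
  then show ?thesis by simp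
qed simp

lemma field_diff_UNIV: "f holomorphic_on UNIV \<Longrightarrow> f field_differentiable at x"
  by (simp add: holomorphic_on_open field_differentiable_def)

lemma sh_field_diff: "sh field_differentiable at x"
  using holomorphic_sh by (rule field_diff_UNIV)

lemma holomorphic_logd_sh: "logd sh holomorphic_on {x. sh x \<noteq> 0}"
  using open_nonzero[OF holomorphic_sh] by (intro holomorphic_logd holomorphic_sh) auto

lemma higher_deriv_logd_sh:
  assumes "sh x \<noteq> 0"
  shows "(deriv ^^ k) (logd sh) x = ctk k x"
proof -
  let ?A = "{x. sh x \<noteq> 0}"
  have A: "open ?A" "x \<in> ?A" using open_nonzero[OF holomorphic_sh] assms by auto
  have nz: "y \<noteq> 0 \<and> G y \<noteq> 0" if "y \<in> ?A" for y using that sh_eq_G[of y] by auto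
  have hG: "logd G holomorphic_on ?A" by (rule holomorphic_logd[OF A(1) holomorphic_G conjunct2[OF nz]])
  have hi: "(\<lambda>y. 1 / (y + 0)) holomorphic_on ?A"
    by (intro holomorphic_on_divide holomorphic_intros) (metis nz add_0_right)
  have "(deriv ^^ k) (logd sh) x = (deriv ^^ k) (\<lambda>y. logd G y + 1 / (y + 0)) x"
  proof (rule higher_deriv_transform_within_open[OF holomorphic_logd_sh _ A])
    show "(\<lambda>y. logd G y + 1 / (y + 0)) holomorphic_on ?A"
      by (intro holomorphic_on_add hG hi)
    fix y assume y: "y \<in> ?A"
    have "logd sh y = logd (\<lambda>x. x * G x) y"
      by (simp add: sh_eq_G[abs_def])
    also have "\<dots> = logd (\<lambda>x. x) y + logd G y"
      using nz[OF y] by (intro logd_mult field_diff_UNIV holomorphic_G) auto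
    finally show "logd sh y = logd G y + 1 / (y + 0)" by (simp add: logd_def)
  qed
  also have "\<dots> = (deriv ^^ k) (logd G) x + (deriv ^^ k) (\<lambda>y. 1 / (y + 0)) x"
    by (rule higher_deriv_add[OF hG hi A])
  also have "(deriv ^^ k) (\<lambda>y. 1 / (y + 0)) x = (-1) ^ k * fact k / (x + 0) ^ Suc k"
    using nz[OF A(2)] by (intro higher_deriv_inverse_shift) auto
  finally show ?thesis by (simp add: ctk_def)
qed

text \<open>Each factor of \<open>Phi\<close> collects the two rows of the lattice shifted by plus
  and minus \<open>of_nat (Suc n) * om\<close>, which reduces its logarithmic derivative to that of
  \<open>sh\<close>.\<close>

lemma fac_eq_sh: "fac n y = - exp (of_nat (Suc n) * om) * (sh (y + of_nat (Suc n) * om) * sh (y - of_nat (Suc n) * om))"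
proof -
  define w where "w = of_nat (Suc n) * om"
  have "sh (y + w) * sh (y - w) = exp y + exp (- y) - exp w - exp (- w)"
  proof -
    have "(y + w) / 2 + (y - w) / 2 = y" "(y + w) / 2 + - ((y - w) / 2) = w" "- ((y + w) / 2) + (y - w) / 2 = - w"
      "- ((y + w) / 2) + - ((y - w) / 2) = - y"
      by (simp_all add: field_simps)
    then have "exp ((y + w) / 2) * exp ((y - w) / 2) = exp y" "exp ((y + w) / 2) * exp (- ((y - w) / 2)) = exp w"
      "exp (- ((y + w) / 2)) * exp ((y - w) / 2) = exp (- w)" "exp (- ((y + w) / 2)) * exp (- ((y - w) / 2)) = exp (- y)"
      by (simp_all only: flip: exp_add)
    then show ?thesis unfolding sh_def by (simp only: left_diff_distrib right_diff_distrib) simp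
  qed
  moreover have "exp w * exp (- w) = 1" "exp y * exp (- y) = 1" by (simp_all add: exp_minus)
  ultimately show ?thesis unfolding fac_def w_def[symmetric] by algebra
qed

lemma higher_deriv_logd_fac:
  assumes "fac n x \<noteq> 0"
  shows "(deriv ^^ k) (logd (fac n)) x = ctk k (x + of_nat (Suc n) * om) + ctk k (x - of_nat (Suc n) * om)"
proof -
  define w where "w = of_nat (Suc n) * om"
  define A where "A = {x. fac n x \<noteq> 0}"
  have hfac: "fac n holomorphic_on UNIV" unfolding fac_def by (intro holomorphic_intros)
  have A: "open A" "x \<in> A" using assms open_nonzero[OF hfac] by (auto simp: A_def)
  have nz: "sh (y + w) \<noteq> 0" "sh (y - w) \<noteq> 0" if "y \<in> A" for y
    using that by (auto simp: A_def fac_eq_sh w_def)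
  have hol: "(\<lambda>y. logd sh (1 * y + v)) holomorphic_on A" if "\<And>y. y \<in> A \<Longrightarrow> sh (1 * y + v) \<noteq> 0" for v
    by (rule holomorphic_on_compose_gen[OF _ holomorphic_logd_sh, unfolded o_def]) (use that in \<open>auto intro!: holomorphic_intros\<close>)
  have fd: "(\<lambda>y. sh (y + v)) field_differentiable at y" for v y
    by (rule field_diff_UNIV, rule holomorphic_on_compose[OF _ holomorphic_sh, unfolded o_def]) (intro holomorphic_intros)
  have dsh: "deriv (\<lambda>y. sh (y + v)) y = deriv sh (y + v)" for v y
    by (rule DERIV_imp_deriv, subst DERIV_shift [symmetric], simp add: sh_field_diff DERIV_deriv_iff_field_differentiable)
  have "(deriv ^^ k) (logd (fac n)) x = (deriv ^^ k) (\<lambda>y. logd sh (1 * y + w) + logd sh (1 * y + - w)) x"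
  proof (rule higher_deriv_transform_within_open[OF _ _ A])
    show "logd (fac n) holomorphic_on A"
      using A hfac by (intro holomorphic_logd) (auto simp: A_def intro: holomorphic_on_subset)
    show "(\<lambda>y. logd sh (1 * y + w) + logd sh (1 * y + - w)) holomorphic_on A"
      using nz by (intro holomorphic_on_add hol) auto
    fix y assume y: "y \<in> A"
    have "logd (fac n) y = logd (\<lambda>y. (- exp w) * (sh (y + w) * sh (y + - w))) y"
      by (simp add: fac_eq_sh[abs_def] w_def)
    also have "\<dots> = logd (\<lambda>y. - exp w) y + logd (\<lambda>y. sh (y + w) * sh (y + - w)) y"
      using nz[OF y] by (intro logd_mult field_differentiable_mult fd field_differentiable_const) auto
    also have "logd (\<lambda>y. sh (y + w) * sh (y + - w)) y = logd (\<lambda>y. sh (y + w)) y + logd (\<lambda>y. sh (y + - w)) y"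
      using nz[OF y] by (intro logd_mult fd) auto
    finally show "logd (fac n) y = logd sh (1 * y + w) + logd sh (1 * y + - w)"
      by (simp only: logd_def dsh) simp
  qed
  also have "\<dots> = (deriv ^^ k) (\<lambda>y. logd sh (1 * y + w)) x + (deriv ^^ k) (\<lambda>y. logd sh (1 * y + - w)) x"
    using nz by (intro higher_deriv_add[OF _ _ A] hol) auto
  also have "(deriv ^^ k) (\<lambda>y. logd sh (1 * y + w)) x = 1 ^ k * (deriv ^^ k) (logd sh) (1 * x + w)"
    by (rule higher_deriv_compose_linear'[OF holomorphic_logd_sh A(1) open_nonzero[OF holomorphic_sh] A(2)])
       (use nz in auto)
  also have "(deriv ^^ k) (\<lambda>y. logd sh (1 * y + - w)) x = 1 ^ k * (deriv ^^ k) (logd sh) (1 * x + - w)"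
    by (rule higher_deriv_compose_linear'[OF holomorphic_logd_sh A(1) open_nonzero[OF holomorphic_sh] A(2)])
       (use nz in auto)
  finally show ?thesis
    using nz[OF A(2)] by (simp add: higher_deriv_logd_sh w_def)
qed

lemma outer_limit:
  assumes "Phi z \<noteq> 0"
  shows "(\<lambda>N. \<Sum>n<N. (deriv ^^ k) (logd (fac n)) z) \<longlonglongrightarrow> (deriv ^^ k) (logd Phi) z"
proof -
  define A where "A = {x. Phi x \<noteq> 0} \<inter> ball z 1"
  have A: "open A" "z \<in> A" using assms open_nonzero[OF holomorphic_Phi] by (auto simp: A_def)
  have ff: "fac n x \<noteq> 0" if "x \<in> A" for n x using that fac_nonzero' by (auto simp: A_def)
  have hfac: "fac n holomorphic_on B" for n B unfolding fac_def by (intro holomorphic_intros)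
  have P0: "Phi0 0 \<noteq> 0" by (simp add: Phi0_nonzero)
  have "(\<lambda>N. (deriv ^^ k) (logd (\<lambda>x. \<Prod>n<N. fac n x)) z) \<longlonglongrightarrow> (deriv ^^ k) (logd Phi0) z"
  proof (rule logd_limit[OF A])
    show "uniform_limit A (\<lambda>N x. \<Prod>n<N. fac n x) Phi0 sequentially"
      by (rule uniform_limit_on_subset[OF uniform_limit_Phi0[of "cball z 1"]]) (auto simp: A_def)
    show "(\<lambda>x. \<Prod>n<N. fac n x) holomorphic_on A" for N
      by (intro holomorphic_intros hfac)
    show "Phi0 x \<noteq> 0" if "x \<in> A" for x using that by (auto simp: A_def Phi_def)
  qed (use ff holomorphic_Phi0 in auto)
  moreover have "logd Phi = logd Phi0"
  proof
    fix x
    have "deriv Phi x = deriv Phi0 x / Phi0 0"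
      unfolding Phi_def[abs_def] by (rule deriv_cdivide_right) (intro field_diff_UNIV holomorphic_Phi0)
    then show "logd Phi x = logd Phi0 x" using P0 by (simp add: logd_def Phi_def)
  qed
  moreover have "(deriv ^^ k) (logd (\<lambda>x. \<Prod>n<N. fac n x)) z = (\<Sum>n<N. (deriv ^^ k) (logd (fac n)) z)" for N
  proof -
    have hl: "logd (fac n) holomorphic_on A" for n
      using ff A hfac by (intro holomorphic_logd) auto
    have "(deriv ^^ k) (logd (\<lambda>x. \<Prod>n<N. fac n x)) z = (deriv ^^ k) (\<lambda>x. \<Sum>n<N. logd (fac n) x) z"
    proof (rule higher_deriv_transform_within_open[OF _ _ A])
      show "logd (\<lambda>x. \<Prod>n<N. fac n x) holomorphic_on A"
        using ff by (intro holomorphic_logd A) (auto intro!: holomorphic_intros hfac)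
      show "(\<lambda>x. \<Sum>n<N. logd (fac n) x) holomorphic_on A"
        by (intro holomorphic_intros hl)
      fix x assume x: "x \<in> A"
      show "logd (\<lambda>x. \<Prod>n<N. fac n x) x = (\<Sum>n<N. logd (fac n) x)"
        using ff[OF x] by (intro logd_prod) (auto intro: field_diff_UNIV hfac)
    qed
    also have "\<dots> = (\<Sum>n<N. (deriv ^^ k) (logd (fac n)) z)"
      by (rule higher_deriv_sum[OF _ _ A]) (auto intro: hl)
    finally show ?thesis .
  qed
  ultimately show ?thesis by simp
qed

text \<open>Eisenstein summation by rows follows the product: row 0 without the origin belongs to
  \<open>G\<close>, the rows \<open>b\<close> and \<open>- b\<close> together to one factor of
  \<open>Phi\<close>. The terms without \<open>Z\<close> account for the subtracted values at 0, and
  \<open>ctk\<close> includes the term of the origin.\<close>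

theorem eisenstein_kronecker_eq:
  assumes Z: "P Z \<noteq> 0"
  shows "eisenstein_kronecker \<tau> (Suc k) Z = ctk k Z + (deriv ^^ k) (logd Phi) Z
     - (deriv ^^ k) (logd G) 0 - (deriv ^^ k) (logd Phi) 0"
proof -
  define c where "c = ((-1) ^ k * fact k :: complex)"
  have c0: "c \<noteq> 0" by (simp add: c_def)
  define K where "K = (deriv ^^ k) (logd G)"
  \<comment> \<open>\<open>I b\<close> is \<open>c\<close> times the limit of row \<open>b\<close>.
    Row 0 omits the lattice point 0, so derivatives of \<open>logd G\<close> stand there in place of
    \<open>ctk\<close>.\<close>
  define I where "I = (\<lambda>b::int. if b = 0 then K Z + (-1) ^ k * K 0 else ctk k (Z + of_int b * om) + (-1) ^ k * ctk k (of_int b * om))"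
  define inner where "inner = (\<lambda>(b::int) N. \<Sum>a = - int N..int N. if a = 0 \<and> b = 0 then 0 else
      (\<lambda>l. 1 / (Z + l) ^ Suc k + (-1) ^ (Suc k - 1) * (1 / l ^ Suc k)) (2 * of_real pi * \<i> * (of_int a + of_int b * \<tau>)))"
  have GZ: "G Z \<noteq> 0" "Z \<noteq> 0" "Phi Z \<noteq> 0" using Z by (auto simp: P_eq_G)
  have GZb: "G (Z + of_int b * om) \<noteq> 0" for b
  proof -
    have "P (Z + of_int b * om) \<noteq> 0" using P_shift_om[of Z b] Z by simp
    then show ?thesis by (simp add: P_eq_G)
  qed
  have Gb: "G (of_int b * om) \<noteq> 0" if "b \<noteq> 0" for b
  proof -
    have "sh (of_int b * om) \<noteq> 0"
      using that ell_pos by (simp add: sh_eq_0_iff exp_eq_1)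
    then show ?thesis by (simp add: sh_eq_G)
  qed
  have lam: "2 * of_real pi * \<i> * (of_int a + of_int b * \<tau>) = of_int b * om + of_int a * (2 * of_real pi * \<i>)" for a b
    by (simp add: om_def algebra_simps)
  have lim_inner: "(\<lambda>N. c * inner b N) \<longlonglongrightarrow> I b" for b
  proof (cases "b = 0")
    case False
    have "(\<lambda>N. (\<Sum>a = - int N..int N. (-1) ^ k * fact k / ((Z + of_int b * om) + of_int a * (2 * of_real pi * \<i>)) ^ Suc k) +
        (-1) ^ k * (\<Sum>a = - int N..int N. (-1) ^ k * fact k / (of_int b * om + of_int a * (2 * of_real pi * \<i>)) ^ Suc k)) \<longlonglongrightarrow> I b"
      using False unfolding I_def by (simp only: if_False) (intro tendsto_intros full_inner_limit GZb Gb)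
    moreover have "(\<Sum>a = - int N..int N. (-1) ^ k * fact k / ((Z + of_int b * om) + of_int a * (2 * of_real pi * \<i>)) ^ Suc k) +
        (-1) ^ k * (\<Sum>a = - int N..int N. (-1) ^ k * fact k / (of_int b * om + of_int a * (2 * of_real pi * \<i>)) ^ Suc k) = c * inner b N" for N
      unfolding inner_def lam sum_distrib_left sum.distrib[symmetric]
      by (rule sum.cong[OF refl], cases "even k")
         (simp_all add: False c_def add.assoc distrib_left right_diff_distrib del: power_Suc)
    ultimately show ?thesis by simp
  next
    case True
    have "(\<lambda>N. (\<Sum>n<N. (-1) ^ k * fact k / (Z + of_int (int (Suc n)) * (2 * of_real pi * \<i>)) ^ Suc k +
        (-1) ^ k * fact k / (Z + of_int (- int (Suc n)) * (2 * of_real pi * \<i>)) ^ Suc k) +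
        (-1) ^ k * (\<Sum>n<N. (-1) ^ k * fact k / (0 + of_int (int (Suc n)) * (2 * of_real pi * \<i>)) ^ Suc k +
        (-1) ^ k * fact k / (0 + of_int (- int (Suc n)) * (2 * of_real pi * \<i>)) ^ Suc k)) \<longlonglongrightarrow> I b"
      unfolding I_def K_def True by (simp only: simp_thms if_True) (intro tendsto_intros inner_limit GZ, simp add: G_0)
    moreover have "(\<Sum>n<N. (-1) ^ k * fact k / (Z + of_int (int (Suc n)) * (2 * of_real pi * \<i>)) ^ Suc k +
        (-1) ^ k * fact k / (Z + of_int (- int (Suc n)) * (2 * of_real pi * \<i>)) ^ Suc k) +
        (-1) ^ k * (\<Sum>n<N. (-1) ^ k * fact k / (0 + of_int (int (Suc n)) * (2 * of_real pi * \<i>)) ^ Suc k +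
        (-1) ^ k * fact k / (0 + of_int (- int (Suc n)) * (2 * of_real pi * \<i>)) ^ Suc k) = c * inner b N" for N
    proof -
      have alg: "s * F / A1 + s * F / A2 + s * (s * F / B1 + s * F / B2) =
          (s * F) * ((1 / A1 + s * (1 / B1)) + (1 / A2 + s * (1 / B2)))" for s F A1 A2 B1 B2 :: complex
        by (simp add: divide_inverse algebra_simps)
      have "inner b N = (\<Sum>n<N.
          (1 / (Z + of_int (int (Suc n)) * (2 * of_real pi * \<i>)) ^ Suc k +
            (-1) ^ k * (1 / (0 + of_int (int (Suc n)) * (2 * of_real pi * \<i>)) ^ Suc k)) +
          (1 / (Z + of_int (- int (Suc n)) * (2 * of_real pi * \<i>)) ^ Suc k +
            (-1) ^ k * (1 / (0 + of_int (- int (Suc n)) * (2 * of_real pi * \<i>)) ^ Suc k)))"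
        unfolding inner_def sum_symmetric_int lam
        by (simp add: True del: power_Suc of_nat_Suc of_int_of_nat_eq of_int_minus)
      then show ?thesis
        by (simp only: c_def sum_distrib_left flip: alg) (simp only: sum.distrib sum_distrib_left)
    qed
    ultimately show ?thesis by simp
  qed
  have lim_eq: "lim (inner b) = I b / c" for b
  proof (rule limI)
    have "(\<lambda>N. (c * inner b N) / c) \<longlonglongrightarrow> I b / c" by (intro tendsto_divide lim_inner tendsto_const c0)
    then show "inner b \<longlonglongrightarrow> I b / c" using c0 by simp
  qed
  have pair: "I (int (Suc n)) + I (- int (Suc n)) = (deriv ^^ k) (logd (fac n)) Z - (deriv ^^ k) (logd (fac n)) 0" for n
  proof -
    define w where "w = of_nat (Suc n) * om"
    have "G w \<noteq> 0" using Gb[of "int (Suc n)"] by (simp add: w_def)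
    \<comment> \<open>For even \<open>k\<close> both sides vanish because \<open>ctk k\<close> is
      odd.\<close>
    then have "(-1) ^ k * (ctk k w + ctk k (- w)) = - (ctk k w + ctk k (- w))"
      by (cases "even k") (simp_all add: ctk_uminus)
    moreover have "(deriv ^^ k) (logd (fac n)) Z = ctk k (Z + w) + ctk k (Z - w)"
      using GZ by (simp only: w_def higher_deriv_logd_fac fac_nonzero' not_False_eq_True)
    moreover have "(deriv ^^ k) (logd (fac n)) 0 = ctk k (0 + w) + ctk k (0 - w)"
      using fac_nonzero[of 0 n] by (simp only: w_def higher_deriv_logd_fac zero_in_strip not_False_eq_True)
    moreover have "of_int (int (Suc n)) * om = w" "of_int (- int (Suc n)) * om = - w"
      by (simp_all only: w_def of_int_minus of_int_of_nat_eq mult_minus_left)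
    ultimately show ?thesis by (simp add: I_def distrib_left del: of_nat_Suc of_int_of_nat_eq of_int_minus)
  qed
  have "(\<lambda>M. \<Sum>b = - int M..int M. lim (inner b)) \<longlonglongrightarrow>
     (K Z + (-1) ^ k * K 0 + ((deriv ^^ k) (logd Phi) Z - (deriv ^^ k) (logd Phi) 0)) / c"
  proof -
    have "(\<Sum>b = - int M..int M. lim (inner b)) =
       (K Z + (-1) ^ k * K 0 + ((\<Sum>n<M. (deriv ^^ k) (logd (fac n)) Z) - (\<Sum>n<M. (deriv ^^ k) (logd (fac n)) 0))) / c" for M
      unfolding lim_eq sum_divide_distrib[symmetric] sum_symmetric_int pair sum_subtractf by (simp add: I_def)
    moreover have "(\<lambda>M. (K Z + (-1) ^ k * K 0 + ((\<Sum>n<M. (deriv ^^ k) (logd (fac n)) Z) - (\<Sum>n<M. (deriv ^^ k) (logd (fac n)) 0))) / c) \<longlonglongrightarrow>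
      (K Z + (-1) ^ k * K 0 + ((deriv ^^ k) (logd Phi) Z - (deriv ^^ k) (logd Phi) 0)) / c"
      by (intro tendsto_intros outer_limit GZ c0) simp
    ultimately show ?thesis by simp
  qed
  then have es: "eisenstein_sum \<tau> (\<lambda>l. 1 / (Z + l) ^ Suc k + (-1) ^ (Suc k - 1) * (1 / l ^ Suc k)) =
      (K Z + (-1) ^ k * K 0 + ((deriv ^^ k) (logd Phi) Z - (deriv ^^ k) (logd Phi) 0)) / c"
    unfolding eisenstein_sum_def by (intro limI) (simp only: inner_def)
  have "eisenstein_kronecker \<tau> (Suc k) Z = c * (1 / Z ^ Suc k +
      (K Z + (-1) ^ k * K 0 + ((deriv ^^ k) (logd Phi) Z - (deriv ^^ k) (logd Phi) 0)) / c)"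
    unfolding eisenstein_kronecker_def es by (simp add: c_def)
  also have "\<dots> = c / Z ^ Suc k + (K Z + (-1) ^ k * K 0 + ((deriv ^^ k) (logd Phi) Z - (deriv ^^ k) (logd Phi) 0))"
    by (subst distrib_left) (simp only: times_divide_eq_right nonzero_mult_div_cancel_left[OF c0] mult_1_right)
  also have "(-1) ^ k * K 0 = - K 0" unfolding K_def by (rule higher_deriv_logd_G_0)
  finally show ?thesis by (simp add: ctk_def c_def K_def)
qed

text \<open>\<open>U t\<close> continues \<open>t / P t\<close> over 0, so \<open>QZ Z t\<close> is
  \<open>t * kron t Z\<close> with the value 1 filled in at \<open>t = 0\<close>.\<close>

definition U :: "complex \<Rightarrow> complex" where "U t = 1 / (G t * Phi t)"
definition QZ :: "complex \<Rightarrow> complex \<Rightarrow> complex" where "QZ Z t = P (Z + t) * U t / P Z"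

text \<open>The derivatives of \<open>logd (QZ Z)\<close> at 0 are the Eisenstein-Kronecker series:
  the factor \<open>P (Z + t)\<close> gives the values at \<open>Z\<close>, the factor
  \<open>U\<close> the subtracted values at 0. Since \<open>QZ Z 0 = 1\<close>, both sides obey the
  same recursion.\<close>

theorem bell_EK_eq:
  assumes Z: "P Z \<noteq> 0"
  shows "bell_EK \<tau> k Z = (deriv ^^ k) (QZ Z) 0"
proof -
  define A where "A = {t. G t \<noteq> 0} \<inter> {t. Phi t \<noteq> 0} \<inter> {t. P (Z + t) \<noteq> 0}"
  have hPZ: "(\<lambda>t. P (Z + t)) holomorphic_on B" for B by (intro holomorphic_intros)
  have A: "open A" "0 \<in> A"
    using Z open_nonzero[OF holomorphic_G] open_nonzero[OF holomorphic_Phi] open_nonzero[OF hPZ]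
    by (auto simp: A_def G_0)
  have Anz: "G t \<noteq> 0" "Phi t \<noteq> 0" "P (Z + t) \<noteq> 0" if "t \<in> A" for t using that by (auto simp: A_def)
  have hQ: "QZ Z holomorphic_on A"
    unfolding QZ_def[abs_def] U_def using Anz Z by (intro holomorphic_intros holomorphic_G) auto
  have Qnz: "QZ Z t \<noteq> 0" if "t \<in> A" for t using Anz[OF that] Z by (simp add: QZ_def U_def)
  have shift: "(\<lambda>t. f (1 * t + Z)) holomorphic_on A" if "f holomorphic_on {x. P x \<noteq> 0}" for f
    by (rule holomorphic_on_compose_gen[OF _ that, unfolded o_def])
       (use Anz in \<open>auto intro!: holomorphic_intros simp: add.commute\<close>)
  have hlsh: "logd sh holomorphic_on {x. P x \<noteq> 0}"
    by (rule holomorphic_on_subset[OF holomorphic_logd_sh]) (auto simp: P_def)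
  have oP: "open {x. P x \<noteq> 0}" by (rule open_nonzero[OF holomorphic_P])
  have hlPhi: "logd Phi holomorphic_on {x. P x \<noteq> 0}"
    using oP by (intro holomorphic_logd holomorphic_Phi) (auto simp: P_def)
  have hlG: "logd G holomorphic_on A" "logd Phi holomorphic_on A"
    using A Anz by (auto intro!: holomorphic_logd holomorphic_G holomorphic_Phi)
  have logdQ: "logd (QZ Z) t = (logd sh (1 * t + Z) + logd Phi (1 * t + Z)) - (logd G t + logd Phi t)" if t: "t \<in> A" for t
  proof -
    have dP: "((\<lambda>t. P (Z + t)) has_field_derivative deriv P (Z + t)) (at t)"
      by (auto intro!: derivative_eq_intros)
    have dG: "(G has_field_derivative deriv G t) (at t)" "(Phi has_field_derivative deriv Phi t) (at t)"
      by (auto intro!: holomorphic_derivI[of _ UNIV] holomorphic_G holomorphic_Phi)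
    have "(QZ Z has_field_derivative QZ Z t * (deriv P (Z + t) / P (Z + t) - deriv G t / G t - deriv Phi t / Phi t)) (at t)"
      unfolding QZ_def[abs_def] U_def using Anz[OF t] Z
      by (auto intro!: derivative_eq_intros dP dG) (simp add: field_simps)
    then have 1: "logd (QZ Z) t = logd P (Z + t) - logd G t - logd Phi t"
      using Qnz[OF t] by (simp add: logd_def DERIV_imp_deriv)
    have "logd P (Z + t) = logd (\<lambda>x. sh x * Phi x) (Z + t)" by (simp add: P_def[abs_def])
    also have "\<dots> = logd sh (Z + t) + logd Phi (Z + t)"
      using Anz[OF t] by (intro logd_mult field_diff_UNIV holomorphic_sh holomorphic_Phi) (auto simp: P_def)
    finally show ?thesis using 1 by (simp add: add.commute)
  qed
  have EK: "(deriv ^^ k) (logd (QZ Z)) 0 = eisenstein_kronecker \<tau> (Suc k) Z" for k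
  proof -
    have hlQ: "logd (QZ Z) holomorphic_on A" by (rule holomorphic_logd[OF A(1) hQ Qnz])
    have hr: "(\<lambda>t. (logd sh (1 * t + Z) + logd Phi (1 * t + Z)) - (logd G t + logd Phi t)) holomorphic_on A"
      by (intro holomorphic_on_diff holomorphic_on_add shift hlsh hlPhi hlG)
    have "(deriv ^^ k) (logd (QZ Z)) 0 = (deriv ^^ k) (\<lambda>t. (logd sh (1 * t + Z) + logd Phi (1 * t + Z)) - (logd G t + logd Phi t)) 0"
      by (rule higher_deriv_transform_within_open[OF hlQ hr A logdQ])
    also have "\<dots> = (deriv ^^ k) (\<lambda>t. logd sh (1 * t + Z) + logd Phi (1 * t + Z)) 0 - (deriv ^^ k) (\<lambda>t. logd G t + logd Phi t) 0"
      by (rule higher_deriv_diff[OF _ _ A]) (intro holomorphic_on_add shift hlsh hlPhi hlG)+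
    also have "(deriv ^^ k) (\<lambda>t. logd sh (1 * t + Z) + logd Phi (1 * t + Z)) 0 =
        (deriv ^^ k) (\<lambda>t. logd sh (1 * t + Z)) 0 + (deriv ^^ k) (\<lambda>t. logd Phi (1 * t + Z)) 0"
      by (rule higher_deriv_add[OF _ _ A]) (intro shift hlsh hlPhi)+
    also have "(deriv ^^ k) (\<lambda>t. logd G t + logd Phi t) 0 = (deriv ^^ k) (logd G) 0 + (deriv ^^ k) (logd Phi) 0"
      by (rule higher_deriv_add[OF hlG A])
    also have "(deriv ^^ k) (\<lambda>t. logd sh (1 * t + Z)) 0 = 1 ^ k * (deriv ^^ k) (logd sh) (1 * 0 + Z)"
      by (rule higher_deriv_compose_linear'[OF hlsh A(1) oP A(2)]) (use Anz in \<open>simp add: add.commute\<close>)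
    also have "(deriv ^^ k) (\<lambda>t. logd Phi (1 * t + Z)) 0 = 1 ^ k * (deriv ^^ k) (logd Phi) (1 * 0 + Z)"
      by (rule higher_deriv_compose_linear'[OF hlPhi A(1) oP A(2)]) (use Anz in \<open>simp add: add.commute\<close>)
    also have "(deriv ^^ k) (logd sh) (1 * 0 + Z) = ctk k Z"
      using Z by (simp add: higher_deriv_logd_sh P_def)
    finally show ?thesis by (simp add: eisenstein_kronecker_eq[OF Z])
  qed
  show ?thesis
    unfolding bell_EK_def
  proof (induction k rule: less_induct)
    case (less k)
    show ?case
    proof (cases k)
      case 0
      then show ?thesis using Z by (simp add: complete_bell_0 QZ_def U_def G_0)
    next
      case (Suc m)
      have "(deriv ^^ Suc m) (QZ Z) 0 = (\<Sum>i\<le>m. of_nat (m choose i) * (deriv ^^ i) (logd (QZ Z)) 0 * (deriv ^^ (m - i)) (QZ Z) 0)"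
        by (rule higher_deriv_logd_mult[OF A hQ Qnz])
      then show ?thesis
        unfolding Suc complete_bell_Suc EK using less Suc by (auto intro!: sum.cong)
    qed
  qed
qed

end

section \<open>Averages over the torus\<close>

lemma uniform_limit_prod_bounded:
  fixes f :: "'i \<Rightarrow> nat \<Rightarrow> 'a \<Rightarrow> complex"
  assumes "finite I" "\<And>i. i \<in> I \<Longrightarrow> uniform_limit S (f i) (g i) F" "\<And>i. i \<in> I \<Longrightarrow> bounded (g i ` S)"
  shows "uniform_limit S (\<lambda>n x. \<Prod>i\<in>I. f i n x) (\<lambda>x. \<Prod>i\<in>I. g i x) F \<and> bounded ((\<lambda>x. \<Prod>i\<in>I. g i x) ` S)"
  using assms
proof (induction I rule: finite_induct)
  case empty
  have "bounded ((\<lambda>x. 1 :: complex) ` S)" by (auto simp: bounded_iff intro!: exI[of _ 1])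
  then show ?case by (simp add: uniform_limit_const)
next
  case (insert i I)
  then have IH: "uniform_limit S (\<lambda>n x. \<Prod>i\<in>I. f i n x) (\<lambda>x. \<Prod>i\<in>I. g i x) F" "bounded ((\<lambda>x. \<Prod>i\<in>I. g i x) ` S)"
    by auto
  have "uniform_limit S (\<lambda>n x. f i n x * (\<Prod>i\<in>I. f i n x)) (\<lambda>x. g i x * (\<Prod>i\<in>I. g i x)) F"
    using insert IH by (intro uniform_lim_mult) auto
  moreover have "bounded ((\<lambda>x. g i x * (\<Prod>i\<in>I. g i x)) ` S)"
  proof -
    obtain B1 B2 where B: "\<And>x. x \<in> S \<Longrightarrow> norm (g i x) \<le> B1" "\<And>x. x \<in> S \<Longrightarrow> norm (\<Prod>i\<in>I. g i x) \<le> B2"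
      using insert(5)[of i] IH(2) unfolding bounded_iff by auto
    have "norm (g i x * (\<Prod>i\<in>I. g i x)) \<le> B1 * B2" if "x \<in> S" for x
      unfolding norm_mult using B[OF that] by (intro mult_mono) (auto intro: order_trans[OF norm_ge_zero])
    then show ?thesis unfolding bounded_iff by blast
  qed
  ultimately show ?case using insert by simp
qed

lemma uniform_limit_sum_finite:
  fixes f :: "'i \<Rightarrow> nat \<Rightarrow> 'a \<Rightarrow> complex"
  assumes "finite I" "\<And>i. i \<in> I \<Longrightarrow> uniform_limit S (f i) (g i) F"
  shows "uniform_limit S (\<lambda>n x. \<Sum>i\<in>I. f i n x) (\<lambda>x. \<Sum>i\<in>I. g i x) F"
  using assms by (induction I rule: finite_induct) (auto intro!: uniform_limit_add uniform_limit_const)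

text \<open>Fubini's theorem for a product of functions of one coordinate each, read off from the
  construction of \<open>lborel\<close> as a product measure over the basis vectors.\<close>

lemma integral_cbox_prod:
  fixes g :: "'n::finite \<Rightarrow> real \<Rightarrow> complex"
  assumes g: "\<And>j. continuous_on {a..b} (g j)"
  shows "integral (cbox (\<chi> j. a) (\<chi> j. b)) (\<lambda>t :: real ^ 'n. \<Prod>j\<in>UNIV. g j (t $ j)) = (\<Prod>j\<in>UNIV. integral {a..b} (g j))"
proof -
  let ?C = "cbox (\<chi> j. a) (\<chi> j. b) :: (real ^ 'n) set"
  let ?ax = "\<lambda>j :: 'n. axis j (1 :: real)"
  \<comment> \<open>The indicator extends the integrals to the whole line; \<open>j\<close> recovers
    the index of a basis vector, since the product measure is indexed by
    \<open>Basis\<close>.\<close>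
  define h where "h = (\<lambda>j s. indicator {a..b} s *\<^sub>R g j s)"
  define j where "j = (\<lambda>x :: real ^ 'n. THE i. x = ?ax i)"
  have j: "j (?ax i) = i" for i
    unfolding j_def by (rule the_equality) (auto simp: axis_eq_axis)
  have Basis: "Basis = range ?ax" by (auto simp: Basis_vec_def)
  have inj: "inj ?ax" by (auto simp: inj_on_def axis_eq_axis)
  have hi: "integrable lborel (h i)" for i
    unfolding h_def using g by (intro borel_integrable_compact) auto
  have "continuous_on ?C (\<lambda>t. g i (t $ i))" for i
    by (rule continuous_on_compose2[OF g]) (auto simp: mem_box_cart intro!: continuous_intros)
  then have "continuous_on ?C (\<lambda>t. \<Prod>i\<in>UNIV. g i (t $ i))" by (intro continuous_intros)
  then have si: "set_integrable lborel ?C (\<lambda>t. \<Prod>i\<in>UNIV. g i (t $ i))"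
    unfolding set_integrable_def by (intro borel_integrable_compact) auto
  have "integral ?C (\<lambda>t. \<Prod>i\<in>UNIV. g i (t $ i)) = (LINT t : ?C | lborel. (\<Prod>i\<in>UNIV. g i (t $ i)))"
    by (rule set_borel_integral_eq_integral(2)[OF si, symmetric])
  also have "\<dots> = (LINT t | lborel. (\<Prod>i\<in>UNIV. h i (t $ i)))"
    unfolding set_lebesgue_integral_def
  proof (rule Bochner_Integration.integral_cong[OF refl])
    fix t :: "real ^ 'n"
    show "indicator ?C t *\<^sub>R (\<Prod>i\<in>UNIV. g i (t $ i)) = (\<Prod>i\<in>UNIV. h i (t $ i))"
    proof (cases "t \<in> ?C")
      case True
      then show ?thesis by (auto simp: h_def mem_box_cart intro!: prod.cong)
    next
      case False
      then obtain i where "t $ i \<notin> {a..b}" by (auto simp: mem_box_cart)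
      then have "h i (t $ i) = 0" by (simp add: h_def)
      then have "(\<Prod>i\<in>UNIV. h i (t $ i)) = 0" by (intro prod_zero) auto
      then show ?thesis using False by simp
    qed
  qed
  also have "\<dots> = (LINT f | (\<Pi>\<^sub>M b\<in>Basis. interval_measure (\<lambda>x. x)). (\<Prod>i\<in>UNIV. h i ((\<Sum>b\<in>Basis. f b *\<^sub>R b) $ i)))"
  proof (subst lborel_def, rule integral_distr)
    show "(\<lambda>f. \<Sum>b\<in>Basis. f b *\<^sub>R b) \<in> (\<Pi>\<^sub>M b\<in>Basis. interval_measure (\<lambda>x. x)) \<rightarrow>\<^sub>M (borel :: (real ^ 'n) measure)"
      by measurable
    have "h i \<in> borel_measurable borel" for i using hi[of i] by (auto dest: borel_measurable_integrable)
    moreover have "(\<lambda>t :: real ^ 'n. t $ i) \<in> borel_measurable borel" for i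
      by (intro borel_measurable_continuous_onI continuous_intros)
    ultimately have "(\<lambda>t :: real ^ 'n. h i (t $ i)) \<in> borel_measurable borel" for i
      by (rule measurable_compose[rotated])
    then show "(\<lambda>t :: real ^ 'n. \<Prod>i\<in>UNIV. h i (t $ i)) \<in> borel_measurable borel"
      by (intro borel_measurable_prod) auto
  qed
  also have "\<dots> = (LINT f | (\<Pi>\<^sub>M b\<in>Basis. lborel). (\<Prod>b\<in>Basis. h (j b) (f b)))"
  proof (rule Bochner_Integration.integral_cong)
    show "(\<Pi>\<^sub>M b\<in>(Basis :: (real ^ 'n) set). interval_measure (\<lambda>x. x)) = (\<Pi>\<^sub>M b\<in>Basis. lborel)"
      by (simp add: lborel_eq_real)
    fix f :: "real ^ 'n \<Rightarrow> real"
    have "(\<Sum>b\<in>Basis. f b *\<^sub>R b) $ i = f (?ax i)" for i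
    proof -
      have "(\<Sum>b\<in>Basis. f b *\<^sub>R b) $ i = (\<Sum>b\<in>Basis. f b *\<^sub>R b) \<bullet> ?ax i"
        by (simp add: inner_axis)
      also have "\<dots> = f (?ax i)" by (rule inner_sum_left_Basis) (simp add: Basis)
      finally show ?thesis .
    qed
    then show "(\<Prod>i\<in>UNIV. h i ((\<Sum>b\<in>Basis. f b *\<^sub>R b) $ i)) = (\<Prod>b\<in>Basis. h (j b) (f b))"
      unfolding Basis prod.reindex[OF inj] by (simp add: j)
  qed
  also have "\<dots> = (\<Prod>b\<in>Basis. LINT s | lborel. h (j b) s)"
  proof -
    interpret product_sigma_finite "\<lambda>_ :: real ^ 'n. lborel :: real measure" by standard
    show ?thesis by (rule product_integral_prod) (auto intro: hi)
  qed
  also have "\<dots> = (\<Prod>i\<in>UNIV. LINT s | lborel. h i s)"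
    unfolding Basis prod.reindex[OF inj] by (simp add: j)
  also have "\<dots> = (\<Prod>i\<in>UNIV. integral {a..b} (g i))"
  proof (rule prod.cong[OF refl])
    fix i
    have "set_integrable lborel {a..b} (g i)" using hi[of i] by (simp add: set_integrable_def h_def)
    then show "(LINT s | lborel. h i s) = integral {a..b} (g i)"
      using set_borel_integral_eq_integral(2)[of "{a..b}" "g i"] by (simp add: set_lebesgue_integral_def h_def)
  qed
  finally show ?thesis .
qed

lemma integral_torus_exp:
  fixes m :: "'n::finite \<Rightarrow> int"
  shows "integral (cbox 0 (\<chi> j. 2 * pi)) (\<lambda>t :: real ^ 'n. exp (\<i> * (\<Sum>j\<in>UNIV. of_int (m j) * of_real (t $ j)))) =
    (if \<forall>j. m j = 0 then (2 * of_real pi) ^ CARD('n) else 0)"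
proof -
  have "(\<lambda>t :: real ^ 'n. exp (\<i> * (\<Sum>j\<in>UNIV. of_int (m j) * of_real (t $ j)))) =
      (\<lambda>t. \<Prod>j\<in>UNIV. exp (\<i> * of_int (m j) * of_real (t $ j)))"
    by (simp add: sum_distrib_left exp_sum mult.assoc)
  note f = this
  have e: "cbox 0 (\<chi> j. 2 * pi) = cbox (\<chi> j. 0) (\<chi> j. 2 * pi)" by (simp add: zero_vec_def)
  have "integral (cbox 0 (\<chi> j. 2 * pi)) (\<lambda>t :: real ^ 'n. exp (\<i> * (\<Sum>j\<in>UNIV. of_int (m j) * of_real (t $ j)))) =
      (\<Prod>j\<in>UNIV. integral {0..2 * pi} (\<lambda>s. exp (\<i> * of_int (m j) * of_real s)))"
    unfolding f e by (rule integral_cbox_prod) (intro continuous_intros)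
  also have "\<dots> = (\<Prod>j\<in>UNIV. if m j = 0 then 2 * of_real pi else 0)"
    by (intro prod.cong refl integral_unique integral_exp_period)
  also have "\<dots> = (if \<forall>j. m j = 0 then (2 * of_real pi) ^ CARD('n) else 0)"
    by (auto intro!: prod_zero)
  finally show ?thesis .
qed

lemma set_exp_weight:
  assumes "finite T"
  shows "set_exp (\<lambda>B. (\<Prod>i\<in>B. u i) * q B) T = (\<Prod>i\<in>T. u i) * set_exp q T"
proof -
  have "(\<Prod>B\<in>\<pi>. (\<Prod>i\<in>B. u i) * q B) = (\<Prod>i\<in>T. u i) * (\<Prod>B\<in>\<pi>. q B)" if "partition_on T \<pi>" for \<pi>
  proof -
    have T: "T = \<Union>\<pi>" using that by (rule partition_onD1)
    have fin: "\<And>B. B \<in> \<pi> \<Longrightarrow> finite B" using assms T by (auto intro: finite_subset)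
    have "(\<Prod>i\<in>T. u i) = (\<Prod>B\<in>\<pi>. \<Prod>i\<in>B. u i)"
      unfolding T using partition_onD2[OF that] fin
      by (subst prod.Union_disjoint) (auto simp: disjoint_def)
    then show ?thesis by (simp add: prod.distrib)
  qed
  then show ?thesis by (simp add: set_exp_def sum_distrib_left)
qed

context half_plane
begin

text \<open>The diagonal exponent \<open>z $ i\<close> need not lie in the strip, so its entry is
  not expanded and is placed at frequency 0. The other entries use the expansion of the half-strip
  that contains their exponent.\<close>

definition fcoeff :: "complex \<Rightarrow> (complex, 'n::{finite,linorder}) vec \<Rightarrow> 'n::{finite,linorder} \<Rightarrow> 'n::{finite,linorder} \<Rightarrow> int \<Rightarrow> complex" where
  "fcoeff c z i j n = (if i = j then (if n = 0 then kron c (z $ i) else 0)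
     else if i < j then alpha n c else alpha n c - 1)"

text \<open>On a torus of admissible radii the exponents \<open>X\<^sub>i\<^sub>j\<close> have constant real part.\<close>

definition texp :: "(complex, 'n::{finite,linorder}) vec \<Rightarrow> (real, 'n::{finite,linorder}) vec \<Rightarrow> (real, 'n::{finite,linorder}) vec \<Rightarrow> 'n::{finite,linorder} \<Rightarrow> 'n::{finite,linorder} \<Rightarrow> complex" where
  "texp z r t i j = z $ i + (of_real (ln (r $ i)) + \<i> * of_real (t $ i)) - (of_real (ln (r $ j)) + \<i> * of_real (t $ j))"

text \<open>The weight of a block inside the fiber of frequency \<open>n\<close>: singletons keep
  the unexpanded diagonal entry, larger blocks carry the cumulants of
  \<open>alpha_deriv_recurrence\<close>.\<close>

definition block_weight :: "complex \<Rightarrow> (complex, 'n::{finite,linorder}) vec \<Rightarrow> int \<Rightarrow> 'n::{finite,linorder} set \<Rightarrow> complex" where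
  "block_weight c z n B = (if card B = 1 then (if n = 0 then kron c (\<Sum>i\<in>B. z $ i) else 0)
     else (deriv ^^ (card B - 1)) (alpha n) c)"

definition block_sum :: "complex \<Rightarrow> (complex, 'n::{finite,linorder}) vec \<Rightarrow> nat \<Rightarrow> 'n::{finite,linorder} set \<Rightarrow> complex" where
  "block_sum c z N B = (\<Sum>n = - int N..int N. (\<Prod>i\<in>B. exp (of_int n * z $ i)) * block_weight c z n B)"

lemma admissible_log:
  assumes "admissible_radii \<tau> z r"
  shows "r $ j > 0"
    and "i < j \<Longrightarrow> 0 < Re (z $ i) + ln (r $ i) - ln (r $ j)" "i < j \<Longrightarrow> Re (z $ i) + ln (r $ i) - ln (r $ j) < ell"
    and "j < i \<Longrightarrow> Re (z $ i) + ln (r $ i) - ln (r $ j) < 0" "j < i \<Longrightarrow> - ell < Re (z $ i) + ln (r $ i) - ln (r $ j)"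
proof -
  have r: "\<And>j. r $ j > 0" using assms by (simp add: admissible_radii_def Let_def)
  then show "r $ j > 0" .
  have q: "1 / norm (exp (2 * of_real pi * \<i> * \<tau>)) = exp ell"
    by (simp add: ell_def exp_minus divide_inverse)
  have A: "1 < exp (Re (z $ i)) * r $ i / r $ j" "exp (Re (z $ i)) * r $ i / r $ j < exp ell"
    "1 < r $ i / (exp (Re (z $ j)) * r $ j)" "r $ i / (exp (Re (z $ j)) * r $ j) < exp ell" if "i < j" for i j
  proof -
    have "1 < norm (exp (z $ i)) * r $ i / r $ j \<and> norm (exp (z $ i)) * r $ i / r $ j < exp ell \<and>
        1 < r $ i / (norm (exp (z $ j)) * r $ j) \<and> r $ i / (norm (exp (z $ j)) * r $ j) < exp ell"
      using assms that unfolding admissible_radii_def Let_def q by blast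
    then show "1 < exp (Re (z $ i)) * r $ i / r $ j" "exp (Re (z $ i)) * r $ i / r $ j < exp ell"
        "1 < r $ i / (exp (Re (z $ j)) * r $ j)" "r $ i / (exp (Re (z $ j)) * r $ j) < exp ell"
      unfolding norm_exp_eq_Re by blast+
  qed
  have e1: "exp (Re (z $ i)) * r $ i / r $ j = exp (Re (z $ i) + ln (r $ i) - ln (r $ j))" for i j
    using r[of i] r[of j] by (simp add: exp_add exp_diff)
  have e2: "r $ i / (exp (Re (z $ j)) * r $ j) = exp (- (Re (z $ j) + ln (r $ j) - ln (r $ i)))" for i j
    using r[of i] r[of j] by (simp add: exp_add exp_diff exp_minus field_simps)
  show "i < j \<Longrightarrow> 0 < Re (z $ i) + ln (r $ i) - ln (r $ j)" "i < j \<Longrightarrow> Re (z $ i) + ln (r $ i) - ln (r $ j) < ell"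
    using A(1,2)[of i j] unfolding e1 by simp_all
  show "j < i \<Longrightarrow> Re (z $ i) + ln (r $ i) - ln (r $ j) < 0" "j < i \<Longrightarrow> - ell < Re (z $ i) + ln (r $ i) - ln (r $ j)"
    using A(3,4)[of j i] unfolding e2 by simp_all
qed

text \<open>After expansion over permutations \<sigma> and frequency maps \<open>f\<close>, a term
  survives integration only if \<open>f\<close> is invariant under \<sigma>. For fixed
  \<open>f\<close> the survivors form a \<open>fiber_matrix\<close> determinant, which
  \<open>set_exp_eps\<close> turns into a product over fibers; \<open>set_exp_sum\<close> then
  collects the maps \<open>f\<close>. Truncation keeps all sums finite.\<close>

lemma integral_det_truncated:
  fixes z :: "(complex, 'n::{finite,linorder}) vec" and r :: "(real, 'n::{finite,linorder}) vec"
  assumes c: "c \<in> pstrip"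
  shows "integral (cbox 0 (\<chi> j. 2 * pi)) (\<lambda>t. det (\<chi> i j. \<Sum>n = - int N..int N. fcoeff c z i j n * exp (of_int n * texp z r t i j))) =
    (2 * of_real pi) ^ CARD('n) * set_exp (block_sum c z N) UNIV"
proof -
  let ?I = "{- int N..int N}" and ?C = "cbox 0 (\<chi> j. 2 * pi) :: (real, 'n) vec set"
  let ?S = "{\<sigma>. \<sigma> permutes (UNIV :: 'n set)}" and ?F = "(UNIV :: 'n set) \<rightarrow>\<^sub>E ?I"
  let ?D = "\<lambda>\<sigma> f. \<Prod>i\<in>UNIV. if f i = f (\<sigma> i) then fcoeff c z i (\<sigma> i) (f i) else 0"
  let ?E = "\<lambda>f. \<Prod>i\<in>UNIV. exp (of_int (f i) * z $ i)"
  define L where "L = (\<lambda>j. complex_of_real (ln (r $ j)))"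
  \<comment> \<open>The total frequency in the angle \<open>t $ i\<close>: row \<open>i\<close>
    contributes \<open>f i\<close>, and the row that \<sigma> sends to \<open>i\<close> contributes
    the negative of its own value.\<close>
  define m where "m = (\<lambda>\<sigma> (f :: 'n \<Rightarrow> int) i. f i - f (inv \<sigma> i))"
  define K where "K = (\<lambda>\<sigma> (f :: 'n \<Rightarrow> int). of_int (sign \<sigma>) * (\<Prod>i\<in>UNIV. fcoeff c z i (\<sigma> i) (f i)) *
      ?E f * exp (\<Sum>i\<in>UNIV. of_int (m \<sigma> f i) * L i))"
  let ?e = "\<lambda>\<sigma> f t. exp (\<i> * (\<Sum>i\<in>UNIV. of_int (m \<sigma> f i) * of_real (t $ i)))"
  have exps: "(\<Prod>i\<in>UNIV. exp (of_int (f i) * texp z r t i (\<sigma> i))) =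
      ?E f * exp (\<Sum>i\<in>UNIV. of_int (m \<sigma> f i) * L i) *
      ?e \<sigma> f t" if \<sigma>: "\<sigma> permutes UNIV" for \<sigma> f t
  proof -
    have shift: "(\<Sum>i\<in>UNIV. of_int (f i) * w (\<sigma> i)) = (\<Sum>i\<in>UNIV. of_int (f (inv \<sigma> i)) * w i)" for w :: "'n \<Rightarrow> complex"
      using sum.permute[OF \<sigma>, of "\<lambda>i. of_int (f (inv \<sigma> i)) * w i"] permutes_inverses(2)[OF \<sigma>] by (simp add: o_def)
    have "(\<Sum>i\<in>UNIV. of_int (f i) * texp z r t i (\<sigma> i)) =
        (\<Sum>i\<in>UNIV. of_int (f i) * z $ i) +
        ((\<Sum>i\<in>UNIV. of_int (f i) * (L i + \<i> * of_real (t $ i))) - (\<Sum>i\<in>UNIV. of_int (f i) * (L (\<sigma> i) + \<i> * of_real (t $ \<sigma> i))))"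
      by (simp add: texp_def L_def distrib_left right_diff_distrib sum.distrib sum_subtractf)
    also have "(\<Sum>i\<in>UNIV. of_int (f i) * (L (\<sigma> i) + \<i> * of_real (t $ \<sigma> i))) = (\<Sum>i\<in>UNIV. of_int (f (inv \<sigma> i)) * (L i + \<i> * of_real (t $ i)))"
      by (rule shift)
    also have "(\<Sum>i\<in>UNIV. of_int (f i) * (L i + \<i> * of_real (t $ i))) - (\<Sum>i\<in>UNIV. of_int (f (inv \<sigma> i)) * (L i + \<i> * of_real (t $ i))) =
        (\<Sum>i\<in>UNIV. of_int (m \<sigma> f i) * L i) + \<i> * (\<Sum>i\<in>UNIV. of_int (m \<sigma> f i) * of_real (t $ i))"
      unfolding sum_subtractf[symmetric] sum_distrib_left sum.distrib[symmetric]
      by (rule sum.cong) (simp_all add: m_def algebra_simps)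
    finally show ?thesis by (simp add: exp_sum[symmetric] exp_add mult.assoc)
  qed
  have det: "det (\<chi> i j. \<Sum>n\<in>?I. fcoeff c z i j n * exp (of_int n * texp z r t i j)) =
     (\<Sum>\<sigma>\<in>?S. \<Sum>f\<in>?F. K \<sigma> f * ?e \<sigma> f t)" for t
    unfolding det_def vec_lambda_beta
  proof (rule sum.cong[OF refl])
    fix \<sigma> assume "\<sigma> \<in> ?S"
    then have \<sigma>: "\<sigma> permutes UNIV" by simp
    have "(\<Prod>i\<in>UNIV. \<Sum>n\<in>?I. fcoeff c z i (\<sigma> i) n * exp (of_int n * texp z r t i (\<sigma> i))) =
       (\<Sum>f\<in>?F. \<Prod>i\<in>UNIV. fcoeff c z i (\<sigma> i) (f i) * exp (of_int (f i) * texp z r t i (\<sigma> i)))"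
      by (rule prod_sum_PiE) auto
    then show "of_int (sign \<sigma>) * (\<Prod>i\<in>UNIV. \<Sum>n\<in>?I. fcoeff c z i (\<sigma> i) n * exp (of_int n * texp z r t i (\<sigma> i))) =
       (\<Sum>f\<in>?F. K \<sigma> f * ?e \<sigma> f t)"
      by (simp add: sum_distrib_left prod.distrib exps[OF \<sigma>] K_def mult_ac)
  qed
  have finF: "finite ?F" by (intro finite_PiE) auto
  have finS: "finite ?S" by (intro finite_permutations) auto
  have int: "(\<lambda>t. K \<sigma> f * ?e \<sigma> f t) integrable_on ?C" for \<sigma> f
    by (intro integrable_continuous continuous_intros)
  have "integral ?C (\<lambda>t. det (\<chi> i j. \<Sum>n\<in>?I. fcoeff c z i j n * exp (of_int n * texp z r t i j))) =
      (\<Sum>\<sigma>\<in>?S. \<Sum>f\<in>?F. K \<sigma> f * integral ?C (\<lambda>t. ?e \<sigma> f t))"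
    unfolding det using finF finS int by (simp add: integral_sum integrable_sum)
  also have "\<dots> = (\<Sum>\<sigma>\<in>?S. \<Sum>f\<in>?F. (2 * of_real pi) ^ CARD('n) * (?E f *
      (of_int (sign \<sigma>) * ?D \<sigma> f)))"
  proof (intro sum.cong refl)
    fix \<sigma> f assume "\<sigma> \<in> ?S"
    then have \<sigma>: "\<sigma> permutes UNIV" by simp
    have iff: "(\<forall>i. m \<sigma> f i = 0) \<longleftrightarrow> (\<forall>i. f i = f (\<sigma> i))"
      unfolding m_def using permutes_inverses[OF \<sigma>] by (metis eq_iff_diff_eq_0)
    show "K \<sigma> f * integral ?C (\<lambda>t. ?e \<sigma> f t) =
      (2 * of_real pi) ^ CARD('n) * (?E f *
      (of_int (sign \<sigma>) * ?D \<sigma> f))"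
    proof (cases "\<forall>i. f i = f (\<sigma> i)")
      case True
      then have m0: "\<forall>i. m \<sigma> f i = 0" using iff by simp
      have "?D \<sigma> f = (\<Prod>i\<in>UNIV. fcoeff c z i (\<sigma> i) (f i))"
        using True by (intro prod.cong) auto
      then show ?thesis unfolding integral_torus_exp using m0 by (simp add: K_def)
    next
      case False
      then have z: "?D \<sigma> f = 0"
        by (intro prod_zero) auto
      have "\<not> (\<forall>i. m \<sigma> f i = 0)" using False iff by blast
      then show ?thesis unfolding integral_torus_exp z by (simp only: if_False mult_zero_right)
    qed
  qed
  also have "\<dots> = (2 * of_real pi) ^ CARD('n) * (\<Sum>f\<in>?F. ?E f *
      (\<Sum>\<sigma>\<in>?S. of_int (sign \<sigma>) * ?D \<sigma> f))"
    by (subst sum.swap) (simp add: sum_distrib_left)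
  also have "(\<Sum>f\<in>?F. ?E f *
      (\<Sum>\<sigma>\<in>?S. of_int (sign \<sigma>) * ?D \<sigma> f)) =
      (\<Sum>f\<in>?F. \<Prod>n\<in>?I. set_exp (\<lambda>B. (\<Prod>i\<in>B. exp (of_int n * z $ i)) * block_weight c z n B) {i\<in>UNIV. f i = n})"
  proof (rule sum.cong[OF refl])
    fix f assume f: "f \<in> ?F"
    \<comment> \<open>Chosen so that the diagonal entry \<open>alpha (f i) c + y i\<close> of the
      fiber matrix is the diagonal \<open>fcoeff\<close>.\<close>
    define y where "y = (\<lambda>i. (if f i = 0 then kron c (z $ i) else 0) - alpha (f i) c)"
    have "(\<Sum>\<sigma>\<in>?S. of_int (sign \<sigma>) * ?D \<sigma> f) =
       det (fiber_matrix f y (\<lambda>n. alpha n c))"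
      unfolding det_def fiber_matrix_def vec_lambda_beta
      by (intro sum.cong arg_cong2[where f = "(*)"] prod.cong refl) (auto simp: fcoeff_def y_def)
    also have "\<dots> = (\<Prod>n\<in>?I. alpha n c * (\<Prod>i | f i = n. y i + 1) + (1 - alpha n c) * (\<Prod>i | f i = n. y i))"
      by (rule det_fiber_matrix) (use f in auto)
    also have "\<dots> = (\<Prod>n\<in>?I. set_exp (block_weight c z n) {i\<in>UNIV. f i = n})"
    proof (rule prod.cong[OF refl])
      fix n
      define p where "p = (\<lambda>k::nat. (deriv ^^ (k - 1)) (alpha n) c)"
      have "set_exp (block_weight c z n) {i\<in>UNIV. f i = n} =
         alpha n c * (\<Prod>i\<in>{i\<in>UNIV. f i = n}. block_weight c z n {i} - p 1 + 1) +
         (1 - alpha n c) * (\<Prod>i\<in>{i\<in>UNIV. f i = n}. block_weight c z n {i} - p 1)"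
      proof (rule set_exp_eps)
        show "alpha n c = (\<Sum>j\<le>k. of_nat (k choose j) * p (Suc j) * (if j = k then 1 else alpha n c))" for k
          unfolding p_def using alpha_deriv_recurrence[OF c, of n k] by simp
      qed (auto simp: block_weight_def p_def)
      moreover have "block_weight c z n {i} - p 1 = y i" if "f i = n" for i
        using that by (simp add: block_weight_def p_def y_def)
      ultimately show "alpha n c * (\<Prod>i | f i = n. y i + 1) + (1 - alpha n c) * (\<Prod>i | f i = n. y i) =
         set_exp (block_weight c z n) {i\<in>UNIV. f i = n}"
        by simp
    qed
    finally have 1: "(\<Sum>\<sigma>\<in>?S. of_int (sign \<sigma>) * ?D \<sigma> f) =
       (\<Prod>n\<in>?I. set_exp (block_weight c z n) {i\<in>UNIV. f i = n})" .
    have "?E f = (\<Prod>n\<in>?I. \<Prod>i\<in>{i\<in>UNIV. f i = n}. exp (of_int (f i) * z $ i))"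
      using f by (intro prod.group [symmetric]) auto
    also have "\<dots> = (\<Prod>n\<in>?I. \<Prod>i\<in>{i\<in>UNIV. f i = n}. exp (of_int n * z $ i))"
      by (intro prod.cong refl) auto
    finally show "?E f *
      (\<Sum>\<sigma>\<in>?S. of_int (sign \<sigma>) * ?D \<sigma> f) =
      (\<Prod>n\<in>?I. set_exp (\<lambda>B. (\<Prod>i\<in>B. exp (of_int n * z $ i)) * block_weight c z n B) {i\<in>UNIV. f i = n})"
      unfolding 1 by (simp add: set_exp_weight prod.distrib)
  qed
  also have "\<dots> = set_exp (block_sum c z N) UNIV"
    unfolding block_sum_def[abs_def] by (rule set_exp_sum[symmetric]) auto
  finally show ?thesis .
qed

lemma kron_continuous:
  assumes "P c \<noteq> 0" "\<And>t. t \<in> A \<Longrightarrow> P (f t) \<noteq> 0" "continuous_on A f"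
  shows "continuous_on A (\<lambda>t. kron c (f t))"
  unfolding kron_def using assms by (intro continuous_intros) auto

lemma P_nonzero_Re: "\<bar>Re x\<bar> < ell \<Longrightarrow> Re x \<noteq> 0 \<Longrightarrow> P x \<noteq> 0"
  by (simp add: P_eq_0_strip strip_def exp_ne_1_Re)

lemma P_texp_nonzero:
  assumes adm: "admissible_radii \<tau> z r" and z: "\<And>i. P (z $ i) \<noteq> 0"
  shows "P (texp z r t i j) \<noteq> 0"
proof -
  have Re: "Re (texp z r t i j) = Re (z $ i) + ln (r $ i) - ln (r $ j)" by (simp add: texp_def)
  consider "i < j" | "j < i" | "i = j" by (metis linorder_neqE)
  then show ?thesis
  proof cases
    case 3
    then show ?thesis using z by (simp add: texp_def)
  next
    case 1
    show ?thesis by (rule P_nonzero_Re) (use Re admissible_log(2,3)[OF adm 1] in auto)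
  next
    case 2
    show ?thesis by (rule P_nonzero_Re) (use Re admissible_log(4,5)[OF adm 2] in auto)
  qed
qed

text \<open>On the torus the off-diagonal exponents keep a constant real part in the proper
  half-strip, so the truncated determinants converge uniformly and their integrals converge.\<close>

lemma integral_det_kron:
  fixes z :: "(complex, 'n::{finite,linorder}) vec"
  assumes adm: "admissible_radii \<tau> z r" and z: "\<And>i. P (z $ i) \<noteq> 0" and c: "c \<in> pstrip"
  shows "(\<lambda>N. (2 * of_real pi) ^ CARD('n) * set_exp (block_sum c z N) UNIV) \<longlonglongrightarrow>
    integral (cbox 0 (\<chi> j. 2 * pi)) (\<lambda>t. det (\<chi> i j. kron c (texp z r t i j)))"
proof -
  let ?C = "cbox 0 (\<chi> j. 2 * pi) :: (real, 'n) vec set"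
  define e where "e = (\<lambda>i j N t. \<Sum>n = - int N..int N. fcoeff c z i j n * exp (of_int n * texp z r t i j))"
  have Re: "Re (texp z r t i j) = Re (z $ i) + ln (r $ i) - ln (r $ j)" for t i j by (simp add: texp_def)
  have ct: "continuous_on A (\<lambda>t. texp z r t i j)" for A i j
    unfolding texp_def by (intro continuous_intros)
  have ck: "continuous_on ?C (\<lambda>t. kron c (texp z r t i j))" for i j
    using P_pstrip[OF c] P_texp_nonzero[OF adm z] by (intro kron_continuous ct) auto
  have ul: "uniform_limit ?C (e i j) (\<lambda>t. kron c (texp z r t i j)) sequentially" for i j
  proof (rule uniform_limitI)
    fix \<epsilon> :: real assume \<epsilon>: "\<epsilon> > 0"
    consider "i < j" | "j < i" | "i = j" by (metis linorder_neqE)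
    then show "\<forall>\<^sub>F N in sequentially. \<forall>t\<in>?C. dist (e i j N t) (kron c (texp z r t i j)) < \<epsilon>"
    proof cases
      case 1
      from uniform_limitD[OF uniform_limit_kron_plus[OF c admissible_log(2,3)[OF adm 1]] \<epsilon>]
      show ?thesis
        by eventually_elim (use 1 less_imp_neq[OF 1] in \<open>simp add: Re e_def fcoeff_def\<close>)
    next
      case 2
      define \<rho> where "\<rho> = - (Re (z $ i) + ln (r $ i) - ln (r $ j))"
      have "0 < \<rho>" "\<rho> < ell" using admissible_log(4,5)[OF adm 2] by (simp_all add: \<rho>_def)
      from uniform_limitD[OF uniform_limit_kron_minus[OF c this] \<epsilon>]
      show ?thesis
        by eventually_elim (use less_not_sym[OF 2] less_imp_neq[OF 2] in \<open>simp add: Re e_def fcoeff_def \<rho>_def\<close>)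
    next
      case 3
      have "e i j N t = kron c (texp z r t i j)" for N t
      proof -
        have "e i j N t = (\<Sum>n = - int N..int N. if n = 0 then kron c (z $ i) else 0)"
          unfolding e_def by (rule sum.cong) (auto simp: fcoeff_def 3)
        also have "\<dots> = kron c (z $ i)" by simp
        finally show ?thesis by (simp add: texp_def 3)
      qed
      then show ?thesis using \<epsilon> by simp
    qed
  qed
  have ul': "uniform_limit ?C (\<lambda>N t. det (\<chi> i j. e i j N t)) (\<lambda>t. det (\<chi> i j. kron c (texp z r t i j))) sequentially"
    unfolding det_def vec_lambda_beta
  proof (rule uniform_limit_sum_finite)
    fix \<sigma> :: "'n \<Rightarrow> 'n"
    have "uniform_limit ?C (\<lambda>N t. \<Prod>i\<in>UNIV. e i (\<sigma> i) N t) (\<lambda>t. \<Prod>i\<in>UNIV. kron c (texp z r t i (\<sigma> i))) sequentially \<and>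
      bounded ((\<lambda>t. \<Prod>i\<in>UNIV. kron c (texp z r t i (\<sigma> i))) ` ?C)"
      by (rule uniform_limit_prod_bounded)
         (use ul ck in \<open>auto intro!: compact_imp_bounded compact_continuous_image\<close>)
    then show "uniform_limit ?C (\<lambda>N t. of_int (sign \<sigma>) * (\<Prod>i\<in>UNIV. e i (\<sigma> i) N t))
        (\<lambda>t. of_int (sign \<sigma>) * (\<Prod>i\<in>UNIV. kron c (texp z r t i (\<sigma> i)))) sequentially"
      by (intro bounded_linear_uniform_limit_intros) auto
  qed (simp add: finite_permutations)
  have cont': "continuous_on ?C (\<lambda>t. det (\<chi> i j. e i j N t))" for N
    unfolding det_def vec_lambda_beta e_def by (intro continuous_intros ct)
  obtain I J where IJ: "\<And>N. ((\<lambda>t. det (\<chi> i j. e i j N t)) has_integral I N) ?C"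
    "((\<lambda>t. det (\<chi> i j. kron c (texp z r t i j))) has_integral J) ?C" "I \<longlonglongrightarrow> J"
    by (rule uniform_limit_integral_cbox[OF ul' cont' sequentially_bot]) (rule that)
  have "I N = (2 * of_real pi) ^ CARD('n) * set_exp (block_sum c z N) UNIV" for N
    using integral_unique[OF IJ(1)] integral_det_truncated[OF c, where N = N and z = z and r = r] by (simp add: e_def)
  then have I: "I = (\<lambda>N. (2 * of_real pi) ^ CARD('n) * set_exp (block_sum c z N) UNIV)" by (rule ext)
  show ?thesis using IJ(3) unfolding I integral_unique[OF IJ(2)] .
qed

end

section \<open>The residue\<close>

lemma set_exp_cong:
  assumes "\<And>B. B \<subseteq> T \<Longrightarrow> B \<noteq> {} \<Longrightarrow> p B = q B"
  shows "set_exp p T = set_exp q T"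
  unfolding set_exp_def
  by (intro sum.cong prod.cong refl assms) (auto dest: partition_onD1 partition_onD3)

lemma set_exp_tendsto:
  fixes f :: "'x \<Rightarrow> 'a set \<Rightarrow> complex"
  assumes "\<And>B. B \<subseteq> T \<Longrightarrow> B \<noteq> {} \<Longrightarrow> ((\<lambda>x. f x B) \<longlongrightarrow> g B) F"
  shows "((\<lambda>x. set_exp (f x) T) \<longlongrightarrow> set_exp g T) F"
  unfolding set_exp_def
  by (intro tendsto_sum tendsto_prod assms) (auto dest: partition_onD1 partition_onD3)

context half_plane
begin

lemma eventually_P_nonzero: "eventually (\<lambda>c. P (c + a) \<noteq> 0) (at 0)"
proof -
  obtain x where "P (a + 1 * x) \<noteq> 0" using P_not_identically_0[of 1 a] by auto
  then have "\<forall>\<^sub>F c in at 0. P (c + a) \<noteq> 0 \<and> c \<in> UNIV"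
    by (intro non_zero_neighbour_alt[of "\<lambda>c. P (c + a)" UNIV 0 x]) (auto intro!: holomorphic_intros simp: add.commute)
  then show ?thesis by simp
qed

text \<open>Each of finitely many functions of \<open>c\<close> is entire and not identically zero,
  so its zeros are isolated; the empty \<open>T\<close> gives \<open>P c \<noteq> 0\<close>, hence
  \<open>c \<in> pstrip\<close>.\<close>

lemma eventually_generic:
  fixes z :: "complex ^ 'n::finite"
  shows "eventually (\<lambda>c. c \<in> pstrip \<and> (\<forall>T. P (c + (\<Sum>i\<in>T. z $ i)) \<noteq> 0)) (at 0)"
proof -
  have "eventually (\<lambda>c. c \<in> strip) (at 0)"
    using open_strip by (intro eventually_at_in_open') auto
  moreover have "eventually (\<lambda>c. \<forall>T. P (c + (\<Sum>i\<in>T. z $ i)) \<noteq> 0) (at 0)"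
    by (intro eventually_all_finite eventually_P_nonzero)
  ultimately show ?thesis
  proof eventually_elim
    case (elim c)
    have "P c \<noteq> 0" using elim(2)[rule_format, of "{}"] by simp
    then show ?case using elim by (auto simp: pstrip_def P_eq_0_strip)
  qed
qed

definition fgt :: "(complex, 'n::{finite,linorder}) vec \<Rightarrow> (complex, 'n::{finite,linorder}) vec \<Rightarrow> complex" where
  "fgt z w = (\<Prod>(i, j)\<in>pairs UNIV. P (z $ i + w $ i - (z $ j + w $ j)) * P (w $ j - w $ i)) /
     (\<Prod>i\<in>UNIV. \<Prod>j\<in>UNIV. P (z $ i + w $ i - w $ j))"

text \<open>For \<open>x = z + w\<close> and \<open>y = w\<close> the Frobenius formula contains the
  theta factors of the integrand up to oddness. Reversing arguments costs the sign \<open>e\<close>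
  once in the numerator and once in the denominator.\<close>

lemma varpi_eq: "varpi \<tau> z w = P (\<Sum>k\<in>UNIV. z $ k) * fgt z w"
proof -
  let ?S = "pairs (UNIV :: 'a set)"
  have S: "{(i, j). i < j} = ?S" by (simp add: pairs_def)
  define e :: complex where "e = (-1) ^ card ?S"
  define A where "A = (\<Prod>(i, j)\<in>?S. P (z $ i + w $ i - (z $ j + w $ j)))"
  define B where "B = (\<Prod>(i, j)\<in>?S. P (w $ j - w $ i))"
  define C where "C = (\<Prod>(i, j)\<in>?S. P (z $ i + w $ i - w $ j))"
  define D where "D = (\<Prod>(i, j)\<in>?S. P (z $ j + w $ j - w $ i))"
  have neg: "(\<Prod>(i, j)\<in>?S. - g i j) = e * (\<Prod>(i, j)\<in>?S. g i j)" for g :: "'a \<Rightarrow> 'a \<Rightarrow> complex"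
    using prod_uminus[of "\<lambda>(i, j). g i j" ?S] by (simp add: e_def case_prod_unfold)
  have B': "(\<Prod>(i, j)\<in>?S. P (w $ i - w $ j)) = e * B"
    unfolding B_def neg[symmetric] P_uminus[symmetric] by simp
  have D': "(\<Prod>(i, j)\<in>?S. P (w $ i - z $ j - w $ j)) = e * D"
    unfolding D_def neg[symmetric] P_uminus[symmetric] by (simp add: algebra_simps)
  have "varpi \<tau> z w = P (\<Sum>k\<in>UNIV. z $ k) * ((A * (e * B)) / ((\<Prod>i\<in>UNIV. P (z $ i)) * (C * (e * D))))"
    unfolding varpi_def theta_eq_P S B'[symmetric] D'[symmetric] A_def C_def
    by (simp add: prod.distrib[symmetric] case_prod_unfold algebra_simps)
  also have "\<dots> = P (\<Sum>k\<in>UNIV. z $ k) * ((A * B) / ((\<Prod>i\<in>UNIV. P (z $ i)) * (C * D)))"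
    by (simp add: e_def)
  also have "(A * B) / ((\<Prod>i\<in>UNIV. P (z $ i)) * (C * D)) = fgt z w"
    unfolding fgt_def prod_square_pairs[OF finite] A_def B_def C_def D_def
    by (simp add: prod.distrib[symmetric] case_prod_unfold)
  finally show ?thesis .
qed

definition wpt :: "(real, 'n::{finite,linorder}) vec \<Rightarrow> (real, 'n::{finite,linorder}) vec \<Rightarrow> (complex, 'n::{finite,linorder}) vec" where
  "wpt r t = (\<chi> j. of_real (ln (r $ j)) + \<i> * of_real (t $ j))"

definition avg :: "(complex, 'n::{finite,linorder}) vec \<Rightarrow> (real, 'n::{finite,linorder}) vec \<Rightarrow> complex" where
  "avg z r = integral (cbox 0 (\<chi> j. 2 * pi)) (\<lambda>t. fgt z (wpt r t)) / (2 * of_real pi) ^ CARD('n)"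

lemma torus_integral_eq: "torus_integral \<tau> z r = P (\<Sum>k\<in>UNIV. z $ k) * avg z r"
proof -
  let ?I = "integral (cbox 0 (\<chi> j. 2 * pi)) (\<lambda>t. fgt z (wpt r t))"
  have eq: "(1 / (2 * of_real pi * \<i>)) ^ CARD('a) * (x * \<i> ^ CARD('a)) = x / (2 * of_real pi) ^ CARD('a)" for x :: complex
    by (simp add: power_divide power_mult_distrib)
  have "torus_integral \<tau> z r = (1 / (2 * of_real pi * \<i>)) ^ CARD('a) * ((P (\<Sum>k\<in>UNIV. z $ k) * ?I) * \<i> ^ CARD('a))"
    unfolding torus_integral_def varpi_eq wpt_def[symmetric] by simp
  then show ?thesis unfolding eq by (simp add: avg_def)
qed

lemma average_limit:
  fixes z :: "(complex, 'n::{finite,linorder}) vec"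
  assumes adm: "admissible_radii \<tau> z r" and z: "\<And>i. P (z $ i) \<noteq> 0" and c: "c \<in> pstrip"
    and gen: "\<And>T. P (c + (\<Sum>i\<in>T. z $ i)) \<noteq> 0"
  shows "(\<lambda>N. set_exp (block_sum c z N) UNIV) \<longlonglongrightarrow> P (c + (\<Sum>i\<in>UNIV. z $ i)) / P c * avg z r"
proof -
  have det: "det (\<chi> i j. kron c (texp z r t i j)) = P (c + (\<Sum>i\<in>UNIV. z $ i)) / P c * fgt z (wpt r t)" for t
  proof -
    define x y where "x = (\<lambda>i. z $ i + wpt r t $ i)" and "y = (\<lambda>i. wpt r t $ i)"
    have xy: "x i - y j = texp z r t i j" for i j
      by (simp add: x_def y_def texp_def wpt_def)
    have "(\<chi> i j. kron c (texp z r t i j)) = frob c x y UNIV"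
      by (simp add: frob_def xy)
    moreover have "det (frob c x y UNIV) = P (c + (\<Sum>i\<in>UNIV. x i - y i)) / P c *
      ((\<Prod>(i, j)\<in>pairs UNIV. P (x i - x j) * P (y j - y i)) / (\<Prod>i\<in>UNIV. \<Prod>j\<in>UNIV. P (x i - y j)))"
    proof (rule frobenius_determinant)
      show "P (x i - y j) \<noteq> 0" for i j unfolding xy using P_texp_nonzero[OF adm z] .
      show "P (c + (\<Sum>i\<in>T. x i - y i)) \<noteq> 0" for T using gen[of T] by (simp add: x_def y_def)
    qed
    ultimately show ?thesis by (simp add: fgt_def x_def y_def)
  qed
  have "(\<lambda>N. ((2 * of_real pi) ^ CARD('n) * set_exp (block_sum c z N) UNIV) / (2 * of_real pi) ^ CARD('n)) \<longlonglongrightarrow>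
     (P (c + (\<Sum>i\<in>UNIV. z $ i)) / P c * integral (cbox 0 (\<chi> j. 2 * pi)) (\<lambda>t. fgt z (wpt r t))) / (2 * of_real pi) ^ CARD('n)"
    using integral_det_kron[OF adm z c] unfolding det by (intro tendsto_divide tendsto_const) auto
  then show ?thesis by (simp add: avg_def)
qed

text \<open>The radii do not occur in the sequence of \<open>average_limit\<close>, and the
  prefactor of the average in its limit is nonzero for generic \<open>c\<close>.\<close>

lemma torus_integral_independent:
  fixes z :: "(complex, 'n::{finite,linorder}) vec"
  assumes "admissible_radii \<tau> z r" "admissible_radii \<tau> z r'" and z: "\<And>i. P (z $ i) \<noteq> 0"
  shows "torus_integral \<tau> z r = torus_integral \<tau> z r'"
proof -
  obtain c where c: "c \<in> pstrip" "\<And>T. P (c + (\<Sum>i\<in>T. z $ i)) \<noteq> 0"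
    using eventually_happens'[OF _ eventually_generic[of z]] by auto
  have "P (c + (\<Sum>i\<in>UNIV. z $ i)) / P c * avg z r = P (c + (\<Sum>i\<in>UNIV. z $ i)) / P c * avg z r'"
    using average_limit[OF assms(1) z c] average_limit[OF assms(2) z c] by (rule LIMSEQ_unique)
  then have "avg z r = avg z r'" using c(2)[of UNIV] P_pstrip[OF c(1)] by simp
  then show ?thesis by (simp add: torus_integral_eq)
qed

text \<open>Adding the inequalities for the exponents along an ascending, respectively descending, cycle
  through the elements of the block bounds the sum from below and above.\<close>

lemma admissible_block:
  fixes z :: "(complex, 'n::{finite,linorder}) vec"
  assumes adm: "admissible_radii \<tau> z r" and B: "card B \<ge> 2"
  shows "\<bar>\<Sum>i\<in>B. Re (z $ i)\<bar> < ell"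
proof -
  define s where "s = (\<lambda>i. ln (r $ i))"
  have asc: "Re (z $ i) > s j - s i" "Re (z $ i) < ell + s j - s i" if "i < j" for i j
    using admissible_log(2,3)[OF adm that] by (simp_all add: s_def)
  have desc: "Re (z $ i) < s j - s i" "Re (z $ i) > s j - s i - ell" if "j < i" for i j
    using admissible_log(4,5)[OF adm that] by (simp_all add: s_def)
  have lower: "(\<Sum>i\<in>S. Re (z $ i)) > s M - s (Min S)" if "finite S" "S \<noteq> {}" "\<And>i. i \<in> S \<Longrightarrow> i < M" for S M
    using that
  proof (induction S arbitrary: M rule: finite_linorder_max_induct)
    case (insert b S)
    show ?case
    proof (cases "S = {}")
      case True
      then show ?thesis using asc(1)[of b M] insert by simp
    next
      case False
      have "Min S < b" using insert False by auto
      then have "Min (insert b S) = Min S"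
        by (simp only: Min_insert[OF insert(1) False] min_absorb2[OF less_imp_le[OF \<open>Min S < b\<close>]])
      moreover have "b \<notin> S" using insert by auto
      moreover have "s b - s (Min S) < (\<Sum>i\<in>S. Re (z $ i))"
        using insert.IH[of b] False insert(2) by auto
      moreover have "s M - s b < Re (z $ b)" using asc(1)[of b M] insert.prems by auto
      ultimately show ?thesis using insert(1) by simp
    qed
  qed simp
  have upper: "(\<Sum>i\<in>S. Re (z $ i)) < s m - s (Max S)" if "finite S" "S \<noteq> {}" "\<And>i. i \<in> S \<Longrightarrow> m < i" for S m
    using that
  proof (induction S rule: finite_linorder_max_induct)
    case (insert b S)
    show ?case
    proof (cases "S = {}")
      case True
      then show ?thesis using desc(1)[of m b] insert by simp
    next
      case False
      have "Max S < b" using insert False by auto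
      then have "Max (insert b S) = b"
        by (simp only: Max_insert[OF insert(1) False] max_absorb1[OF less_imp_le[OF \<open>Max S < b\<close>]])
      moreover have "b \<notin> S" using insert by auto
      ultimately show ?thesis using insert.IH desc(1)[of "Max S" b] insert False \<open>Max S < b\<close> by auto
    qed
  qed simp
  have fB: "finite B" "B \<noteq> {}" using B by auto
  define M where "M = Max B"
  define m where "m = Min B"
  have Mm: "M \<in> B" "m \<in> B" using fB by (auto simp: M_def m_def)
  have "m \<noteq> M"
  proof
    assume "m = M"
    then have "x = m" if "x \<in> B" for x using Min_le[OF fB(1) that] Max_ge[OF fB(1) that] by (simp add: M_def m_def)
    then have "B \<subseteq> {m}" by auto
    then show False using card_mono[of "{m}" B] B by simp
  qed
  then have mM: "m < M" using Min_le[OF fB(1) Mm(1)] by (simp add: m_def)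
  have S1: "finite (B - {M})" "m \<in> B - {M}" using fB Mm mM by auto
  have "Min (B - {M}) = m"
    using S1 fB by (intro Min_eqI) (auto simp: m_def)
  moreover have "i < M" if "i \<in> B - {M}" for i
    using le_neq_trans[OF Max_ge[OF fB(1), of i]] that by (auto simp: M_def)
  ultimately have "(\<Sum>i\<in>B - {M}. Re (z $ i)) > s M - s m" using lower[of "B - {M}" M] S1 by auto
  then have L: "(\<Sum>i\<in>B. Re (z $ i)) > - ell"
    using sum.remove[OF fB(1) Mm(1), of "\<lambda>i. Re (z $ i)"] desc(2)[OF mM] by simp
  have S2: "finite (B - {m})" "M \<in> B - {m}" using fB Mm mM by auto
  have "Max (B - {m}) = M"
    using S2 fB by (intro Max_eqI) (auto simp: M_def)
  moreover have "m < i" if "i \<in> B - {m}" for i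
    using le_neq_trans[OF Min_le[OF fB(1), of i]] that by (auto simp: m_def)
  ultimately have "(\<Sum>i\<in>B - {m}. Re (z $ i)) < s m - s M" using upper[of "B - {m}" m] S2 by auto
  then have "(\<Sum>i\<in>B. Re (z $ i)) < ell"
    using sum.remove[OF fB(1) Mm(2), of "\<lambda>i. Re (z $ i)"] asc(2)[OF mM] by simp
  then show ?thesis using L by simp
qed

text \<open>\<open>admissible_block\<close> puts the sum over at least two elements into the strip,
  where the differentiated expansion applies with positive order \<open>card B - 1\<close>. For a
  singleton only frequency 0 is present.\<close>

lemma block_sum_limit:
  fixes z :: "(complex, 'n::{finite,linorder}) vec"
  assumes adm: "admissible_radii \<tau> z r" and z: "P (\<Sum>i\<in>B. z $ i) \<noteq> 0" and c: "c \<in> pstrip" and B: "B \<noteq> {}"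
  shows "(\<lambda>N. block_sum c z N B) \<longlonglongrightarrow> (deriv ^^ (card B - 1)) (\<lambda>c. kron c (\<Sum>i\<in>B. z $ i)) c"
proof (cases "card B = 1")
  case True
  then obtain i where i: "B = {i}" by (auto simp: card_1_singleton_iff)
  have "block_sum c z N B = kron c (z $ i)" for N
  proof -
    have "block_sum c z N B = (\<Sum>n = - int N..int N. if n = 0 then kron c (z $ i) else 0)"
      unfolding block_sum_def by (rule sum.cong) (auto simp: block_weight_def i)
    then show ?thesis by simp
  qed
  then show ?thesis by (simp add: i)
next
  case False
  have "card B \<noteq> 0" using B by simp
  then have B2: "card B \<ge> 2" using False by linarith
  have "Re (\<Sum>i\<in>B. z $ i) = (\<Sum>i\<in>B. Re (z $ i))" by simp
  then have "(\<Sum>i\<in>B. z $ i) \<in> strip" using admissible_block[OF adm B2] by (simp add: strip_def)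
  then have "(\<Sum>i\<in>B. z $ i) \<in> pstrip" using z by (auto simp: pstrip_def P_eq_0_strip)
  moreover have "(\<Prod>i\<in>B. exp (of_int n * z $ i)) * block_weight c z n B =
      (deriv ^^ (card B - 1)) (alpha n) c * exp (of_int n * (\<Sum>i\<in>B. z $ i))" for n
    using False by (simp add: block_weight_def exp_sum sum_distrib_left)
  ultimately show ?thesis
    using kron_deriv_expansion[OF c, of "\<Sum>i\<in>B. z $ i" "card B - 1"] B2 by (simp add: block_sum_def)
qed

lemma holomorphic_QZ_U:
  "U holomorphic_on {t. G t \<noteq> 0 \<and> Phi t \<noteq> 0}" "open {t. G t \<noteq> 0 \<and> Phi t \<noteq> 0}"
proof -
  show "U holomorphic_on {t. G t \<noteq> 0 \<and> Phi t \<noteq> 0}"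
    unfolding U_def[abs_def] by (intro holomorphic_intros holomorphic_G) auto
  have "{t. G t \<noteq> 0 \<and> Phi t \<noteq> 0} = {t. G t \<noteq> 0} \<inter> {t. Phi t \<noteq> 0}" by auto
  then show "open {t. G t \<noteq> 0 \<and> Phi t \<noteq> 0}"
    using open_nonzero[OF holomorphic_G] open_nonzero[OF holomorphic_Phi] by auto
qed

text \<open>\<open>t * kron t Z\<close> continues to \<open>QZ Z\<close>, with value 1 at 0, so
  \<open>kron\<close> is \<open>1 / t\<close> plus a regular function \<rho>. Passing from
  \<open>QZ Z\<close> to \<rho> lowers the order of the Taylor coefficients by one, which is the
  origin of the denominators \<open>card B\<close>.\<close>

lemma regular_part:
  assumes Z: "P Z \<noteq> 0"
  obtains \<rho> where "\<rho> holomorphic_on {t. G t \<noteq> 0 \<and> Phi t \<noteq> 0}"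
    "\<And>c k. P c \<noteq> 0 \<Longrightarrow> (deriv ^^ k) (\<lambda>c. kron c Z) c = (-1) ^ k * fact k / c ^ Suc k + (deriv ^^ k) \<rho> c"
    "\<And>k. (deriv ^^ k) \<rho> 0 = bell_EK \<tau> (Suc k) Z / of_nat (Suc k)"
proof -
  define A where "A = {t. G t \<noteq> 0 \<and> Phi t \<noteq> 0}"
  have A: "open A" "0 \<in> A" using holomorphic_QZ_U(2) by (auto simp: A_def G_0)
  have hQ: "QZ Z holomorphic_on A"
    unfolding QZ_def[abs_def] A_def using Z by (intro holomorphic_intros holomorphic_QZ_U) auto
  obtain \<rho> where \<rho>: "\<rho> holomorphic_on A" "\<And>t. t \<in> A \<Longrightarrow> QZ Z t - 1 = t * \<rho> t"
  proof (rule holomorphic_quotient[OF A(1), of "\<lambda>t. QZ Z t - 1" "\<lambda>t. t"])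
    show "QZ Z t - 1 = 0 \<and> deriv (\<lambda>t. t) t \<noteq> 0" if "t = 0" for t
      using that Z by (simp add: QZ_def U_def G_0)
  qed (use hQ in \<open>auto intro!: holomorphic_intros\<close>)
  show ?thesis
  proof (rule that)
    show "\<rho> holomorphic_on {t. G t \<noteq> 0 \<and> Phi t \<noteq> 0}" using \<rho>(1) by (simp add: A_def)
    fix k
    show "(deriv ^^ k) (\<lambda>c. kron c Z) c = (-1) ^ k * fact k / c ^ Suc k + (deriv ^^ k) \<rho> c" if "P c \<noteq> 0" for c
    proof -
      define A' where "A' = {c. P c \<noteq> 0}"
      have A': "open A'" "c \<in> A'" using that open_nonzero[OF holomorphic_P] by (auto simp: A'_def)
      have sub: "A' \<subseteq> A" "\<And>t. t \<in> A' \<Longrightarrow> t + 0 \<noteq> 0" by (auto simp: A'_def A_def P_eq_G)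
      have hi: "(\<lambda>t. 1 / (t + 0)) holomorphic_on A'"
        using sub(2) by (intro holomorphic_intros) auto
      have h\<rho>: "\<rho> holomorphic_on A'" using \<rho>(1) sub(1) by (rule holomorphic_on_subset)
      have hk: "(\<lambda>c. kron c Z) holomorphic_on A'"
        unfolding kron_def using Z by (intro holomorphic_intros) (auto simp: A'_def)
      have "(deriv ^^ k) (\<lambda>c. kron c Z) c = (deriv ^^ k) (\<lambda>t. 1 / (t + 0) + \<rho> t) c"
      proof (rule higher_deriv_transform_within_open[OF hk _ A'])
        show "(\<lambda>t. 1 / (t + 0) + \<rho> t) holomorphic_on A'" by (intro holomorphic_on_add hi h\<rho>)
        fix t assume t: "t \<in> A'"
        then have "t \<in> A" "t \<noteq> 0" using sub by auto
        have "kron t Z = QZ Z t / t"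
          using t Z by (simp add: kron_def QZ_def U_def P_eq_G add.commute mult_ac)
        also have "QZ Z t = 1 + t * \<rho> t" using \<rho>(2)[OF \<open>t \<in> A\<close>] by (simp add: algebra_simps)
        finally show "kron t Z = 1 / (t + 0) + \<rho> t" using \<open>t \<noteq> 0\<close> by (simp add: add_divide_distrib)
      qed
      also have "\<dots> = (deriv ^^ k) (\<lambda>t. 1 / (t + 0)) c + (deriv ^^ k) \<rho> c"
        by (rule higher_deriv_add[OF hi h\<rho> A'])
      also have "(deriv ^^ k) (\<lambda>t. 1 / (t + 0)) c = (-1) ^ k * fact k / (c + 0) ^ Suc k"
        using sub(2)[OF A'(2)] by (rule higher_deriv_inverse_shift)
      finally show ?thesis by simp
    qed
    have "bell_EK \<tau> (Suc k) Z = (deriv ^^ Suc k) (QZ Z) 0" by (rule bell_EK_eq[OF Z])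
    also have "\<dots> = (deriv ^^ Suc k) (\<lambda>t. 1 + t * \<rho> t) 0"
      by (rule higher_deriv_transform_within_open[OF hQ _ A])
         (use \<rho> in \<open>auto intro!: holomorphic_intros simp: algebra_simps\<close>)
    also have "\<dots> = (deriv ^^ Suc k) (\<lambda>t. 1) 0 + (deriv ^^ Suc k) (\<lambda>t. t * \<rho> t) 0"
      by (rule higher_deriv_add[OF _ _ A]) (auto intro!: holomorphic_intros \<rho>)
    also have "(deriv ^^ Suc k) (\<lambda>t :: complex. 1) 0 = (0 :: complex)"
      by (simp only: higher_deriv_const) simp
    also have "(deriv ^^ Suc k) (\<lambda>t. t * \<rho> t) 0 =
        (\<Sum>i = 0..Suc k. of_nat (Suc k choose i) * (deriv ^^ i) (\<lambda>t. t) 0 * (deriv ^^ (Suc k - i)) \<rho> 0)"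
      by (rule higher_deriv_mult[OF _ \<rho>(1) A]) (auto intro!: holomorphic_intros)
    also have "\<dots> = (\<Sum>i\<in>{1}. of_nat (Suc k choose i) * (deriv ^^ i) (\<lambda>t. t) 0 * (deriv ^^ (Suc k - i)) \<rho> 0)"
      by (rule sum.mono_neutral_right) auto
    also have "\<dots> = of_nat (Suc k) * (deriv ^^ k) \<rho> 0" by simp
    finally show "(deriv ^^ k) \<rho> 0 = bell_EK \<tau> (Suc k) Z / of_nat (Suc k)"
      by (simp del: of_nat_Suc)
  qed
qed

text \<open>The polar parts cancel except for the terms with a single singleton block.\<close>

lemma set_exp_polar:
  assumes "finite S" "c \<noteq> 0"
  shows "set_exp (\<lambda>B. (-1) ^ (card B - 1) * fact (card B - 1) / c ^ card B) S =
    (if S = {} then 1 else if card S = 1 then 1 / c else 0 :: complex)"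
proof -
  define p where "p = (\<lambda>k::nat. (-1) ^ (k - 1) * fact (k - 1) / c ^ k)"
  \<comment> \<open>\<open>p\<close> lists the derivatives at 0 of \<open>ln (1 + t / c)\<close>,
    and \<open>e\<close> those of \<open>1 + t / c\<close>.\<close>
  define e where "e = (\<lambda>k::nat. if k = 0 then 1 else if k = 1 then 1 / c else 0)"
  have "set_exp (\<lambda>B. p (card B)) S = e (card S)"
  proof (rule set_exp_card[OF assms(1)])
    fix k
    show "e (Suc k) = (\<Sum>j\<le>k. of_nat (k choose j) * p (Suc j) * e (k - j))"
    proof (cases k)
      case 0
      then show ?thesis by (simp add: e_def p_def)
    next
      case (Suc l)
      have "(\<Sum>j\<le>k. of_nat (k choose j) * p (Suc j) * e (k - j)) =
          (\<Sum>j\<in>{l, k}. of_nat (k choose j) * p (Suc j) * e (k - j))"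
        by (rule sum.mono_neutral_right) (auto simp: Suc e_def)
      also have "\<dots> = of_nat (Suc l) * p (Suc l) * (1 / c) + p (Suc (Suc l))"
        by (simp add: Suc e_def)
      also have "\<dots> = 0" using assms(2) by (simp add: p_def divide_simps)
      finally show ?thesis by (simp add: e_def Suc)
    qed
  qed (simp add: e_def)
  then show ?thesis using assms(1) by (auto simp: p_def e_def)
qed

text \<open>Block weights split into a polar part \<open>s\<close> and a regular part
  \<open>d\<close>. In the polar factor only the empty set and the singletons survive, so the
  average is a regular term plus \<open>1 / c\<close> times a regular sum. Multiplying by
  \<open>c\<close> and letting \<open>c\<close> tend to 0 isolates that sum, whose index
  \<open>j\<close> is the surviving singleton.\<close>

theorem torus_integral_formula:
  fixes z :: "(complex, 'n::{finite,linorder}) vec"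
  assumes adm: "admissible_radii \<tau> z r" and z: "\<And>B. B \<noteq> {} \<Longrightarrow> P (\<Sum>i\<in>B. z $ i) \<noteq> 0"
  shows "torus_integral \<tau> z r =
    (\<Sum>j\<in>UNIV. set_exp (\<lambda>B. bell_EK \<tau> (card B) (\<Sum>i\<in>B. z $ i) / of_nat (card B)) (UNIV - {j}))"
proof -
  let ?Z = "\<lambda>B. \<Sum>i\<in>B. z $ i"
  let ?A = "{t. G t \<noteq> 0 \<and> Phi t \<noteq> 0}"
  have zi: "P (z $ i) \<noteq> 0" for i using z[of "{i}"] by simp
  define reg where "reg = (\<lambda>B \<rho>. B \<noteq> {} \<longrightarrow> (\<rho> holomorphic_on ?A \<and>
    (\<forall>c k. P c \<noteq> 0 \<longrightarrow> (deriv ^^ k) (\<lambda>c. kron c (?Z B)) c = (-1) ^ k * fact k / c ^ Suc k + (deriv ^^ k) \<rho> c) \<and>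
    (\<forall>k. (deriv ^^ k) \<rho> 0 = bell_EK \<tau> (Suc k) (?Z B) / of_nat (Suc k))))"
  have "\<exists>\<rho>. reg B \<rho>" for B
  proof (cases "B = {}")
    case False
    show ?thesis
      by (rule regular_part[OF z[OF False]], rule exI) (unfold reg_def, blast)
  qed (simp add: reg_def)
  then obtain \<rho> where reg: "\<And>B. reg B (\<rho> B)" using choice[of reg] by blast
  have \<rho>: "\<And>B. B \<noteq> {} \<Longrightarrow> \<rho> B holomorphic_on ?A"
    "\<And>B c k. B \<noteq> {} \<Longrightarrow> P c \<noteq> 0 \<Longrightarrow> (deriv ^^ k) (\<lambda>c. kron c (?Z B)) c = (-1) ^ k * fact k / c ^ Suc k + (deriv ^^ k) (\<rho> B) c"
    "\<And>B k. B \<noteq> {} \<Longrightarrow> (deriv ^^ k) (\<rho> B) 0 = bell_EK \<tau> (Suc k) (?Z B) / of_nat (Suc k)"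
    using reg unfolding reg_def by blast+
  define s where "s = (\<lambda>c (B :: 'n set). (-1) ^ (card B - 1) * fact (card B - 1) / c ^ card B :: complex)"
  define d where "d = (\<lambda>c B. (deriv ^^ (card B - 1)) (\<rho> B) c)"
  have main: "P (c + ?Z UNIV) / P c * avg z r =
      set_exp (d c) UNIV + (1 / c) * (\<Sum>j\<in>UNIV. set_exp (d c) (UNIV - {j}))"
    if c: "c \<in> pstrip" "\<And>T. P (c + ?Z T) \<noteq> 0" for c
  proof -
    have Pc: "P c \<noteq> 0" using c by (intro P_pstrip)
    then have c0: "c \<noteq> 0" by auto
    have "(\<lambda>N. set_exp (block_sum c z N) UNIV) \<longlonglongrightarrow> set_exp (\<lambda>B. (deriv ^^ (card B - 1)) (\<lambda>c. kron c (?Z B)) c) UNIV"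
      using block_sum_limit[OF adm z c(1)] by (intro set_exp_tendsto) auto
    then have "P (c + ?Z UNIV) / P c * avg z r = set_exp (\<lambda>B. (deriv ^^ (card B - 1)) (\<lambda>c. kron c (?Z B)) c) UNIV"
      using average_limit[OF adm zi c] LIMSEQ_unique by blast
    also have "\<dots> = set_exp (\<lambda>B. s c B + d c B) UNIV"
    proof (rule set_exp_cong)
      fix B :: "'n set" assume B: "B \<noteq> {}"
      then have "card B \<noteq> 0" by simp
      then have "Suc (card B - 1) = card B" by linarith
      then show "(deriv ^^ (card B - 1)) (\<lambda>c. kron c (?Z B)) c = s c B + d c B"
        using \<rho>(2)[OF B Pc, of "card B - 1"] unfolding s_def d_def by (simp only:)
    qed
    also have "\<dots> = (\<Sum>S\<in>Pow UNIV. set_exp (s c) S * set_exp (d c) (UNIV - S))"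
      by (rule set_exp_add) simp
    also have "\<dots> = (\<Sum>S\<in>insert {} ((\<lambda>j. {j}) ` UNIV). set_exp (s c) S * set_exp (d c) (UNIV - S))"
    proof (rule sum.mono_neutral_right)
      show "\<forall>S\<in>Pow UNIV - insert {} ((\<lambda>j. {j}) ` UNIV). set_exp (s c) S * set_exp (d c) (UNIV - S) = 0"
      proof
        fix S :: "'n set" assume S: "S \<in> Pow UNIV - insert {} ((\<lambda>j. {j}) ` UNIV)"
        then have "S \<noteq> {}" "card S \<noteq> 1" by (auto simp: card_1_singleton_iff)
        then have "set_exp (s c) S = 0"
          unfolding s_def set_exp_polar[OF finite c0] by simp
        then show "set_exp (s c) S * set_exp (d c) (UNIV - S) = 0" by simp
      qed
    qed auto
    also have "\<dots> = set_exp (d c) UNIV + (\<Sum>j\<in>UNIV. set_exp (s c) {j} * set_exp (d c) (UNIV - {j}))"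
      by (subst sum.insert) (auto simp: sum.reindex inj_on_def)
    also have "\<dots> = set_exp (d c) UNIV + (\<Sum>j\<in>UNIV. (1 / c) * set_exp (d c) (UNIV - {j}))"
    proof -
      have "set_exp (s c) {j} = 1 / c" for j
        unfolding s_def using c0 by (subst set_exp_polar) auto
      then show ?thesis by (simp only:)
    qed
    finally show ?thesis by (simp only: sum_distrib_left)
  qed
  have U0: "(U \<longlongrightarrow> 1) (at 0)" and d0: "\<And>B :: 'n set. B \<noteq> {} \<Longrightarrow> ((\<lambda>c. d c B) \<longlongrightarrow> d 0 B) (at 0)"
  proof -
    have op: "open ?A" "0 \<in> ?A" using holomorphic_QZ_U(2) by (auto simp: G_0)
    have lim: "(f \<longlongrightarrow> f 0) (at 0)" if "f holomorphic_on ?A" for f :: "complex \<Rightarrow> complex"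
      using holomorphic_on_imp_continuous_on[OF that] op continuous_on_eq_continuous_at isCont_def by blast
    show "(U \<longlongrightarrow> 1) (at 0)" using lim[OF holomorphic_QZ_U(1)] by (simp add: U_def G_0)
    fix B :: "'n set" assume "B \<noteq> {}"
    then show "((\<lambda>c. d c B) \<longlongrightarrow> d 0 B) (at 0)"
      unfolding d_def using op \<rho>(1) by (intro lim holomorphic_higher_deriv) auto
  qed
  have dlim: "((\<lambda>c. set_exp (d c) T) \<longlongrightarrow> set_exp (d 0) T) (at 0)" for T :: "'n set"
    by (intro set_exp_tendsto d0)
  have "isCont (\<lambda>c. P (c + ?Z UNIV)) 0"
    using continuous_P[of UNIV "\<lambda>c. c + ?Z UNIV"] by (simp add: continuous_on_eq_continuous_at continuous_intros)
  then have "((\<lambda>c. P (c + ?Z UNIV)) \<longlongrightarrow> P (0 + ?Z UNIV)) (at 0)" by (simp only: isCont_def)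
  \<comment> \<open>\<open>U c\<close> equals \<open>c / P c\<close> away from the zeros of
    \<open>P\<close>, so this is the left side of \<open>main\<close> multiplied by
    \<open>c\<close>, continued to \<open>c = 0\<close>.\<close>
  then have L1: "((\<lambda>c. P (c + ?Z UNIV) * U c * avg z r) \<longlongrightarrow> P (0 + ?Z UNIV) * 1 * avg z r) (at 0)"
    by (intro tendsto_intros U0)
  have L2: "((\<lambda>c. c * set_exp (d c) UNIV + (\<Sum>j\<in>UNIV. set_exp (d c) (UNIV - {j}))) \<longlongrightarrow>
     0 * set_exp (d 0) UNIV + (\<Sum>j\<in>UNIV. set_exp (d 0) (UNIV - {j}))) (at 0)"
    by (intro tendsto_intros dlim)
  have ev: "eventually (\<lambda>c. P (c + ?Z UNIV) * U c * avg z r =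
      c * set_exp (d c) UNIV + (\<Sum>j\<in>UNIV. set_exp (d c) (UNIV - {j}))) (at 0)"
    using eventually_generic[of z]
  proof eventually_elim
    case (elim c)
    then have Pc: "P c \<noteq> 0" by (intro P_pstrip) auto
    then have "c \<noteq> 0" "U c = c / P c" by (auto simp: U_def P_eq_G)
    then have "P (c + ?Z UNIV) * U c * avg z r = c * (P (c + ?Z UNIV) / P c * avg z r)" by simp
    also have "\<dots> = c * (set_exp (d c) UNIV + (1 / c) * (\<Sum>j\<in>UNIV. set_exp (d c) (UNIV - {j})))"
      using elim by (subst main) auto
    finally show ?case using \<open>c \<noteq> 0\<close> by (simp add: distrib_left)
  qed
  have "P (0 + ?Z UNIV) * 1 * avg z r = 0 * set_exp (d 0) UNIV + (\<Sum>j\<in>UNIV. set_exp (d 0) (UNIV - {j}))"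
    by (rule tendsto_unique[OF at_neq_bot L1[unfolded tendsto_cong[OF ev]] L2])
  then have "torus_integral \<tau> z r = (\<Sum>j\<in>UNIV. set_exp (d 0) (UNIV - {j}))"
    by (simp add: torus_integral_eq)
  also have "\<dots> = (\<Sum>j\<in>UNIV. set_exp (\<lambda>B. bell_EK \<tau> (card B) (?Z B) / of_nat (card B)) (UNIV - {j}))"
  proof (intro sum.cong refl set_exp_cong)
    fix B :: "'n set" assume B: "B \<noteq> {}"
    then have "card B \<noteq> 0" by simp
    then have "Suc (card B - 1) = card B" by linarith
    then show "d 0 B = bell_EK \<tau> (card B) (?Z B) / of_nat (card B)"
      using \<rho>(3)[OF B, of "card B - 1"] unfolding d_def by (simp only:)
  qed
  finally show ?thesis .
qed

end

section \<open>Meromorphic functions of several variables\<close>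

lemma holomorphic_Cn_const: "open U \<Longrightarrow> holomorphic_Cn (\<lambda>z. c) U"
  unfolding holomorphic_Cn_def by (auto intro!: exI[of _ "\<lambda>_. 0"])

lemma holomorphic_Cn_component: "open U \<Longrightarrow> holomorphic_Cn (\<lambda>z. z $ i) U"
  unfolding holomorphic_Cn_def
  by (auto intro!: exI[of _ "\<lambda>v. v $ i"] bounded_linear_imp_has_derivative bounded_linear_vec_nth)

lemma holomorphic_Cn_add:
  assumes "holomorphic_Cn f U" "holomorphic_Cn g U"
  shows "holomorphic_Cn (\<lambda>z. f z + g z) U"
  unfolding holomorphic_Cn_def
proof (intro conjI ballI)
  fix z assume z: "z \<in> U"
  obtain D E where D: "(f has_derivative D) (at z)" "\<And>c v. D (c *s v) = c * D v"
    and E: "(g has_derivative E) (at z)" "\<And>c v. E (c *s v) = c * E v"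
    using assms z unfolding holomorphic_Cn_def by metis
  show "\<exists>D. ((\<lambda>z. f z + g z) has_derivative D) (at z) \<and> (\<forall>c v. D (c *s v) = c * D v)"
    by (rule exI[of _ "\<lambda>h. D h + E h"])
       (use D E in \<open>auto intro!: has_derivative_add simp: distrib_left\<close>)
qed (use assms in \<open>simp add: holomorphic_Cn_def\<close>)

lemma holomorphic_Cn_mult:
  assumes "holomorphic_Cn f U" "holomorphic_Cn g U"
  shows "holomorphic_Cn (\<lambda>z. f z * g z) U"
  unfolding holomorphic_Cn_def
proof (intro conjI ballI)
  fix z assume z: "z \<in> U"
  obtain D E where D: "(f has_derivative D) (at z)" "\<And>c v. D (c *s v) = c * D v"
    and E: "(g has_derivative E) (at z)" "\<And>c v. E (c *s v) = c * E v"
    using assms z unfolding holomorphic_Cn_def by metis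
  have "((\<lambda>z. f z * g z) has_derivative (\<lambda>h. f z * E h + D h * g z)) (at z)"
    by (rule has_derivative_mult[OF D(1) E(1)])
  moreover have "f z * E (c *s v) + D (c *s v) * g z = c * (f z * E v + D v * g z)" for c v
    by (simp add: D(2) E(2) algebra_simps)
  ultimately show "\<exists>D. ((\<lambda>z. f z * g z) has_derivative D) (at z) \<and> (\<forall>c v. D (c *s v) = c * D v)"
    by blast
qed (use assms in \<open>simp add: holomorphic_Cn_def\<close>)

lemma holomorphic_Cn_sum:
  assumes "open U" "\<And>i. i \<in> I \<Longrightarrow> holomorphic_Cn (f i) U"
  shows "holomorphic_Cn (\<lambda>z. \<Sum>i\<in>I. f i z) U"
  using assms(2)
  by (induction I rule: infinite_finite_induct)
     (auto intro: holomorphic_Cn_const[OF assms(1)] holomorphic_Cn_add)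

lemma holomorphic_Cn_prod:
  assumes "open U" "\<And>i. i \<in> I \<Longrightarrow> holomorphic_Cn (f i) U"
  shows "holomorphic_Cn (\<lambda>z. \<Prod>i\<in>I. f i z) U"
  using assms(2)
  by (induction I rule: infinite_finite_induct)
     (auto intro: holomorphic_Cn_const[OF assms(1)] holomorphic_Cn_mult)

lemma holomorphic_Cn_compose:
  assumes "holomorphic_Cn g U" "f holomorphic_on UNIV"
  shows "holomorphic_Cn (\<lambda>z. f (g z)) U"
  unfolding holomorphic_Cn_def
proof (intro conjI ballI)
  fix z assume z: "z \<in> U"
  obtain D where D: "(g has_derivative D) (at z)" "\<And>c v. D (c *s v) = c * D v"
    using assms z unfolding holomorphic_Cn_def by metis
  have "(f has_derivative (\<lambda>h. deriv f (g z) * h)) (at (g z))"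
    using holomorphic_derivI[OF assms(2)] by (simp add: has_field_derivative_def)
  from has_derivative_compose[OF D(1) this]
  show "\<exists>D. ((\<lambda>z. f (g z)) has_derivative D) (at z) \<and> (\<forall>c v. D (c *s v) = c * D v)"
    using D(2) by (intro exI[of _ "\<lambda>h. deriv f (g z) * D h"]) auto
qed (use assms in \<open>simp add: holomorphic_Cn_def\<close>)

lemma holomorphic_Cn_subset:
  "holomorphic_Cn f U \<Longrightarrow> open V \<Longrightarrow> V \<subseteq> U \<Longrightarrow> holomorphic_Cn f V"
  unfolding holomorphic_Cn_def by auto

lemma holomorphic_Cn_continuous: "holomorphic_Cn f U \<Longrightarrow> continuous_on U f"
  unfolding holomorphic_Cn_def
  by (meson continuous_at_imp_continuous_on has_derivative_continuous)

lemma line_has_derivative: "((\<lambda>s. a + s *s v) has_derivative (\<lambda>h. h *s v)) (at s)"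
  for v :: "complex ^ 'n::finite"
proof -
  have "bounded_linear (\<lambda>s :: complex. s *s v)"
    by (intro linear_conv_bounded_linear[THEN iffD1] linearI)
       (simp_all add: vec_eq_iff distrib_right)
  then show ?thesis
    by (auto intro!: derivative_eq_intros bounded_linear_imp_has_derivative)
qed

lemma holomorphic_Cn_line:
  assumes "holomorphic_Cn f U"
  shows "(\<lambda>s. f (a + s *s v)) holomorphic_on {s. a + s *s v \<in> U}"
  unfolding holomorphic_on_def
proof
  fix s assume "s \<in> {s. a + s *s v \<in> U}"
  then obtain D where D: "(f has_derivative D) (at (a + s *s v))" "\<And>c v. D (c *s v) = c * D v"
    using assms unfolding holomorphic_Cn_def by blast
  have "((\<lambda>s. f (a + s *s v)) has_derivative (\<lambda>h. D (h *s v))) (at s)"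
    by (rule has_derivative_compose[OF line_has_derivative D(1)])
  moreover have "(\<lambda>h. D (h *s v)) = (*) (D v)" by (simp add: fun_eq_iff D(2) mult.commute)
  ultimately have "((\<lambda>s. f (a + s *s v)) has_field_derivative D v) (at s)"
    by (simp only: has_field_derivative_def)
  then show "(\<lambda>s. f (a + s *s v)) field_differentiable at s within {s. a + s *s v \<in> U}"
    using field_differentiable_def field_differentiable_at_within by blast
qed

lemma continuous_line: "continuous_on A (\<lambda>s. a + s *s v)"
  for v :: "complex ^ 'n::finite"
  by (intro continuous_at_imp_continuous_on ballI has_derivative_continuous[OF line_has_derivative])

text \<open>On the complex line through \<open>w\<close> and \<open>z\<close> the parameters that
  stay in the ball form a convex set, and the restricted function vanishes near the parameter 0 of
  \<open>w\<close>.\<close>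

lemma holomorphic_Cn_identity:
  assumes f: "holomorphic_Cn f (ball a e)" and W: "open W" "w \<in> W" "W \<subseteq> ball a e"
    and zero: "\<And>z. z \<in> W \<Longrightarrow> f z = 0" and z: "z \<in> ball a e"
  shows "f z = 0"
proof -
  let ?l = "\<lambda>s. w + s *s (z - w)"
  define S where "S = {s. ?l s \<in> ball a e}"
  define T where "T = {s. ?l s \<in> W}"
  have op: "open {s. ?l s \<in> V}" if "open V" for V
    using open_vimage[OF that, of ?l] continuous_line[of UNIV w "z - w"] by (simp add: vimage_def)
  have S: "open S" unfolding S_def by (rule op) simp
  have T: "open T" unfolding T_def by (rule op[OF W(1)])
  have "convex S"
    unfolding convex_def
  proof (intro ballI allI impI)
    fix s t and u v :: real
    assume s: "s \<in> S" and t: "t \<in> S" and uv: "0 \<le> u" "0 \<le> v" "u + v = 1"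
    have "?l (u *\<^sub>R s + v *\<^sub>R t) = u *\<^sub>R ?l s + v *\<^sub>R ?l t"
    proof -
      have "u *\<^sub>R w + v *\<^sub>R w = w" using uv(3) by (metis scaleR_left_distrib scaleR_one)
      then show ?thesis
        by (simp add: vec_eq_iff algebra_simps)
    qed
    then show "u *\<^sub>R s + v *\<^sub>R t \<in> S"
      using s t uv convexD[OF convex_ball, of "?l s" a e "?l t" u v] by (simp add: S_def)
  qed
  have "f (?l 1) = 0"
  proof (rule analytic_continuation_open[of T S "\<lambda>s. f (?l s)" "\<lambda>_. 0" 1])
    have "?l 0 = w" by (simp add: vec_eq_iff)
    then have "0 \<in> T" using W(2) by (simp add: T_def)
    then show "T \<noteq> {}" by auto
    show "connected S" using \<open>convex S\<close> by (rule convex_connected)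
    show "(\<lambda>s. f (?l s)) holomorphic_on S" unfolding S_def by (rule holomorphic_Cn_line[OF f])
    have "?l 1 = z" by (simp add: vec_eq_iff)
    then show "1 \<in> S" using z by (simp add: S_def)
  qed (use S T W zero in \<open>auto simp: S_def T_def\<close>)
  moreover have "?l 1 = z" by (simp add: vec_eq_iff)
  ultimately show ?thesis by simp
qed

lemma dense_nonzeroD:
  assumes "U \<subseteq> closure {z\<in>U. h z \<noteq> (0::complex)}" "open V" "V \<subseteq> U" "V \<noteq> {}"
  obtains z where "z \<in> V" "h z \<noteq> 0"
proof -
  have "V \<inter> closure {z\<in>U. h z \<noteq> 0} \<noteq> {}" using assms by auto
  then have "V \<inter> {z\<in>U. h z \<noteq> 0} \<noteq> {}"
    using open_Int_closure_eq_empty[OF assms(2)] by blast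
  then show ?thesis using that by auto
qed

text \<open>The interior of the set of agreement has open closure: near a point of the closure,
  cross-multiplying the two quotients gives a holomorphic function that vanishes on an open set,
  hence on a ball, and both denominators are nonzero on a dense part of it. A nonempty clopen set is
  the whole space.\<close>

lemma meromorphic_Cn_identity:
  assumes f: "meromorphic_Cn f" and g: "meromorphic_Cn g"
    and W: "open W" "W \<noteq> {}" "\<And>z. z \<in> W \<Longrightarrow> f z = g z"
  shows "\<exists>U. open U \<and> closure U = UNIV \<and> (\<forall>z\<in>U. f z = g z)"
proof -
  define U where "U = interior {z. f z = g z}"
  have U: "open U" "\<And>z. z \<in> U \<Longrightarrow> f z = g z" using interior_subset by (auto simp: U_def)
  have "open (closure U)"
    unfolding open_contains_ball
  proof
    fix a assume a: "a \<in> closure U"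
    obtain U1 g1 h1 where 1: "a \<in> U1" "holomorphic_Cn g1 U1" "holomorphic_Cn h1 U1"
      "U1 \<subseteq> closure {z\<in>U1. h1 z \<noteq> 0}" "\<And>z. z \<in> U1 \<Longrightarrow> h1 z \<noteq> 0 \<Longrightarrow> f z = g1 z / h1 z"
      using f unfolding meromorphic_Cn_def by meson
    obtain U2 g2 h2 where 2: "a \<in> U2" "holomorphic_Cn g2 U2" "holomorphic_Cn h2 U2"
      "U2 \<subseteq> closure {z\<in>U2. h2 z \<noteq> 0}" "\<And>z. z \<in> U2 \<Longrightarrow> h2 z \<noteq> 0 \<Longrightarrow> g z = g2 z / h2 z"
      using g unfolding meromorphic_Cn_def by meson
    have op: "open U1" "open U2" using 1 2 by (simp_all add: holomorphic_Cn_def)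
    then obtain e where e: "e > 0" "ball a e \<subseteq> U1 \<inter> U2"
      using 1(1) 2(1) by (meson IntI open_Int open_contains_ball)
    let ?B = "ball a e"
    have nz: "\<exists>z\<in>V. h1 z \<noteq> 0 \<and> h2 z \<noteq> 0" and opnz: "open {z\<in>V. h1 z \<noteq> 0 \<and> h2 z \<noteq> 0}"
      if V: "open V" "V \<subseteq> ?B" "V \<noteq> {}" for V
    proof -
      have cont: "continuous_on V h1" "continuous_on V h2"
        using holomorphic_Cn_continuous[OF 1(3)] holomorphic_Cn_continuous[OF 2(3)] V e
        by (meson continuous_on_subset le_inf_iff order_trans)+
      have o1: "open (V \<inter> h1 -` (- {0}))" "open (V \<inter> h2 -` (- {0}))"
        using cont V(1) by (auto intro!: continuous_open_preimage)
      obtain z where z: "z \<in> V" "h1 z \<noteq> 0"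
        using dense_nonzeroD[OF 1(4) V(1) _ V(3)] V(2) e by blast
      obtain z' where "z' \<in> V \<inter> h1 -` (- {0})" "h2 z' \<noteq> 0"
        using dense_nonzeroD[OF 2(4) o1(1)] z V(2) e by blast
      then show "\<exists>z\<in>V. h1 z \<noteq> 0 \<and> h2 z \<noteq> 0" by auto
      have "{z\<in>V. h1 z \<noteq> 0 \<and> h2 z \<noteq> 0} = (V \<inter> h1 -` (- {0})) \<inter> (V \<inter> h2 -` (- {0}))" by auto
      then show "open {z\<in>V. h1 z \<noteq> 0 \<and> h2 z \<noteq> 0}" using o1 by auto
    qed
    define k where "k = (\<lambda>z. g1 z * h2 z + (-1) * (g2 z * h1 z))"
    have "holomorphic_Cn k ?B"
      unfolding k_def
      using 1 2 e by (intro holomorphic_Cn_add holomorphic_Cn_mult holomorphic_Cn_const)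
        (auto intro: holomorphic_Cn_subset)
    define V where "V = ?B \<inter> U"
    have V: "open V" "V \<subseteq> ?B" "V \<noteq> {}"
    proof -
      show "open V" "V \<subseteq> ?B" using U by (auto simp: V_def)
      have "a \<in> ?B \<inter> closure U" using a e by simp
      then show "V \<noteq> {}" unfolding V_def using open_Int_closure_eq_empty[of ?B U] by blast
    qed
    define V' where "V' = {z\<in>V. h1 z \<noteq> 0 \<and> h2 z \<noteq> 0}"
    obtain w where w: "w \<in> V'" using nz[OF V] by (auto simp: V'_def)
    have "k z = 0" if "z \<in> V'" for z
    proof -
      have z: "z \<in> U" "z \<in> U1" "z \<in> U2" "h1 z \<noteq> 0" "h2 z \<noteq> 0" using that V e by (auto simp: V'_def V_def)
      have "g1 z / h1 z = g2 z / h2 z" using 1(5) 2(5) U(2) z by metis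
      then show ?thesis using z by (simp add: k_def field_simps)
    qed
    then have k: "k z = 0" if "z \<in> ?B" for z
      using holomorphic_Cn_identity[OF \<open>holomorphic_Cn k ?B\<close> opnz[OF V, folded V'_def] w] V that
      by (auto simp: V'_def)
    have B: "open ?B" "?B \<subseteq> ?B" "?B \<noteq> {}" using e by auto
    have agree: "{z\<in>?B. h1 z \<noteq> 0 \<and> h2 z \<noteq> 0} \<subseteq> U"
      unfolding U_def
    proof (rule interior_maximal)
      show "{z\<in>?B. h1 z \<noteq> 0 \<and> h2 z \<noteq> 0} \<subseteq> {z. f z = g z}"
      proof
        fix z assume z: "z \<in> {z\<in>?B. h1 z \<noteq> 0 \<and> h2 z \<noteq> 0}"
        then have "f z = g1 z / h1 z" "g z = g2 z / h2 z" using 1(5) 2(5) e by auto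
        moreover have "g1 z * h2 z = g2 z * h1 z" using k[of z] z by (simp add: k_def)
        ultimately show "z \<in> {z. f z = g z}" using z by (simp add: frac_eq_eq)
      qed
    qed (rule opnz[OF B])
    have "?B \<subseteq> closure U"
    proof
      fix x assume x: "x \<in> ?B"
      show "x \<in> closure U"
        unfolding closure_iff_nhds_not_empty
      proof (intro allI impI)
        fix A X assume "X \<subseteq> A" "open X" "x \<in> X"
        then have "open (X \<inter> ?B)" "X \<inter> ?B \<subseteq> ?B" "X \<inter> ?B \<noteq> {}" using x by auto
        from nz[OF this] obtain y where "y \<in> X \<inter> ?B" "h1 y \<noteq> 0" "h2 y \<noteq> 0" by blast
        then show "U \<inter> A \<noteq> {}" using agree \<open>X \<subseteq> A\<close> by blast
      qed
    qed
    then show "\<exists>e>0. ball a e \<subseteq> closure U" using e(1) by blast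
  qed
  moreover have "W \<subseteq> U" unfolding U_def using W by (intro interior_maximal) auto
  then have "closure U \<noteq> {}" using W(2) closure_subset by blast
  ultimately have "closure U = UNIV" using clopen[of "closure U"] by simp
  then show ?thesis using U by blast
qed

context half_plane
begin

text \<open>A global numerator and denominator of the right-hand side.\<close>

definition hden :: "complex ^ 'n::finite \<Rightarrow> complex" where
  "hden z = (\<Prod>B\<in>UNIV - {{}}. P (\<Sum>i\<in>B. z $ i))"

text \<open>Leibniz's rule for \<open>P Z\<close> times the \<open>k\<close>-th derivative of
  \<open>QZ Z\<close> at 0; unlike that derivative it is entire in \<open>Z\<close>.\<close>

definition bnum :: "nat \<Rightarrow> complex \<Rightarrow> complex" where
  "bnum k Z = (\<Sum>i = 0..k. of_nat (k choose i) * (deriv ^^ i) P Z * (deriv ^^ (k - i)) U 0)"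

lemma bell_EK_eq_quotient:
  assumes Z: "P Z \<noteq> 0"
  shows "bell_EK \<tau> k Z = bnum k Z / P Z"
proof -
  define A where "A = {t. G t \<noteq> 0 \<and> Phi t \<noteq> 0}"
  have A: "open A" "0 \<in> A" using holomorphic_QZ_U(2) by (auto simp: A_def G_0)
  have hU: "U holomorphic_on A" unfolding A_def by (rule holomorphic_QZ_U)
  have hP: "(\<lambda>t. P (1 * t + Z)) holomorphic_on A" by (intro holomorphic_intros)
  have "bell_EK \<tau> k Z = (deriv ^^ k) (QZ Z) 0" by (rule bell_EK_eq[OF Z])
  also have "QZ Z = (\<lambda>t. (1 / P Z) * (P (1 * t + Z) * U t))"
    by (simp add: QZ_def fun_eq_iff add.commute)
  also have "(deriv ^^ k) (\<lambda>t. (1 / P Z) * (P (1 * t + Z) * U t)) 0 = (1 / P Z) * (deriv ^^ k) (\<lambda>t. P (1 * t + Z) * U t) 0"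
    by (rule higher_deriv_cmult[OF _ A(2,1)]) (intro holomorphic_on_mult hU hP)
  also have "(deriv ^^ k) (\<lambda>t. P (1 * t + Z) * U t) 0 =
     (\<Sum>i = 0..k. of_nat (k choose i) * (deriv ^^ i) (\<lambda>t. P (1 * t + Z)) 0 * (deriv ^^ (k - i)) U 0)"
    by (rule higher_deriv_mult[OF hP hU A])
  also have "\<dots> = bnum k Z"
    unfolding bnum_def
  proof (intro sum.cong refl arg_cong2[where f = "(*)"])
    fix i
    have "(deriv ^^ i) (\<lambda>t. P (1 * t + Z)) 0 = 1 ^ i * (deriv ^^ i) P (1 * 0 + Z)"
      by (rule higher_deriv_compose_linear'[of P UNIV UNIV]) (auto intro: holomorphic_P)
    then show "(deriv ^^ i) (\<lambda>t. P (1 * t + Z)) 0 = (deriv ^^ i) P Z" by simp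
  qed
  finally show ?thesis by simp
qed

lemma holomorphic_bnum: "bnum k holomorphic_on UNIV"
  unfolding bnum_def by (intro holomorphic_intros holomorphic_higher_deriv holomorphic_P) auto

definition gwsum :: "complex ^ 'n::finite \<Rightarrow> complex" where
  "gwsum z = (\<Sum>j\<in>UNIV. set_exp (\<lambda>B. bell_EK \<tau> (card B) (\<Sum>i\<in>B. z $ i) / of_nat (card B)) (UNIV - {j}))"

text \<open>Each partition is brought to the common denominator \<open>hden\<close> by the factors
  \<open>P\<close> of the nonempty sets that are not among its blocks.\<close>

definition gnum :: "complex ^ 'n::finite \<Rightarrow> complex" where
  "gnum z = (\<Sum>j\<in>UNIV. \<Sum>\<pi> | partition_on (UNIV - {j}) \<pi>.
     (\<Prod>B\<in>\<pi>. bnum (card B) (\<Sum>i\<in>B. z $ i) * (1 / of_nat (card B))) * (\<Prod>B\<in>(UNIV - {{}}) - \<pi>. P (\<Sum>i\<in>B. z $ i)))"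

lemma hden_nonzeroD: "hden z \<noteq> 0 \<Longrightarrow> B \<noteq> {} \<Longrightarrow> P (\<Sum>i\<in>B. z $ i) \<noteq> 0"
  unfolding hden_def by auto

lemma gwsum_eq: "hden z \<noteq> 0 \<Longrightarrow> gwsum z = gnum z / hden z"
proof -
  assume h: "hden z \<noteq> 0"
  let ?Z = "\<lambda>B. \<Sum>i\<in>B. z $ i"
  have "(\<Prod>B\<in>\<pi>. bell_EK \<tau> (card B) (?Z B) / of_nat (card B)) =
     ((\<Prod>B\<in>\<pi>. bnum (card B) (?Z B) * (1 / of_nat (card B))) * (\<Prod>B\<in>(UNIV - {{}}) - \<pi>. P (?Z B))) / hden z"
    if "partition_on (UNIV - {j}) \<pi>" for j \<pi>
  proof -
    have ne: "B \<noteq> {}" if "B \<in> \<pi>" for B using that \<open>partition_on (UNIV - {j}) \<pi>\<close> partition_onD3 by blast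
    have sub: "\<pi> \<subseteq> UNIV - {{}}" using ne by auto
    have hd: "hden z = (\<Prod>B\<in>(UNIV - {{}}) - \<pi>. P (?Z B)) * (\<Prod>B\<in>\<pi>. P (?Z B))"
      unfolding hden_def by (rule prod.subset_diff[OF sub]) simp
    have "(\<Prod>B\<in>\<pi>. bell_EK \<tau> (card B) (?Z B) / of_nat (card B)) =
       (\<Prod>B\<in>\<pi>. bnum (card B) (?Z B) * (1 / of_nat (card B)) / P (?Z B))"
      by (rule prod.cong) (auto simp: bell_EK_eq_quotient hden_nonzeroD[OF h] ne)
    also have "\<dots> = (\<Prod>B\<in>\<pi>. bnum (card B) (?Z B) * (1 / of_nat (card B))) / (\<Prod>B\<in>\<pi>. P (?Z B))"
      by (rule prod_dividef)
    finally show ?thesis using h unfolding hd by (simp add: field_simps)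
  qed
  then show ?thesis
    unfolding gwsum_def gnum_def set_exp_def sum_divide_distrib by (intro sum.cong refl) auto
qed

lemma holomorphic_Cn_hden: "holomorphic_Cn hden UNIV"
  unfolding hden_def[abs_def]
  by (intro holomorphic_Cn_prod holomorphic_Cn_compose[OF _ holomorphic_P] holomorphic_Cn_sum holomorphic_Cn_component) auto

lemma holomorphic_Cn_gnum: "holomorphic_Cn gnum UNIV"
  unfolding gnum_def[abs_def]
  by (intro holomorphic_Cn_sum holomorphic_Cn_mult holomorphic_Cn_prod holomorphic_Cn_const
      holomorphic_Cn_compose[OF _ holomorphic_P] holomorphic_Cn_compose[OF _ holomorphic_bnum] holomorphic_Cn_component) auto

lemma eventually_P_line: "b \<noteq> 0 \<Longrightarrow> eventually (\<lambda>s. P (a + b * s) \<noteq> 0) (at 0)"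
proof -
  assume "b \<noteq> 0"
  then obtain x where "P (a + b * x) \<noteq> 0" using P_not_identically_0[of b a] by auto
  then have "\<forall>\<^sub>F s in at 0. P (a + b * s) \<noteq> 0 \<and> s \<in> UNIV"
    by (intro non_zero_neighbour_alt[of "\<lambda>s. P (a + b * s)" UNIV 0 x]) (auto intro!: holomorphic_intros)
  then show ?thesis by simp
qed

lemma hden_dense: "(UNIV :: (complex ^ 'n::finite) set) \<subseteq> closure {z\<in>UNIV. hden z \<noteq> 0}"
proof
  fix a :: "(complex, 'n) vec"
  \<comment> \<open>Along the direction with all coordinates 1 the sum over \<open>B\<close> has
    slope \<open>card B\<close>, which is nonzero for every nonempty \<open>B\<close>.\<close>
  let ?l = "\<lambda>s. a + s *s (\<chi> i. 1)"
  have "eventually (\<lambda>s. hden (?l s) \<noteq> 0) (at 0)"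
  proof -
    have "eventually (\<lambda>s. \<forall>B\<in>UNIV - {{}}. P (\<Sum>i\<in>B. ?l s $ i) \<noteq> 0) (at 0)"
    proof (rule eventually_ball_finite)
      show "\<forall>B\<in>UNIV - {{}}. \<forall>\<^sub>F s in at 0. P (\<Sum>i\<in>B. ?l s $ i) \<noteq> 0"
      proof
        fix B :: "'n set" assume "B \<in> UNIV - {{}}"
        then have "of_nat (card B) \<noteq> (0 :: complex)" by simp
        from eventually_P_line[OF this, of "\<Sum>i\<in>B. a $ i"]
        show "\<forall>\<^sub>F s in at 0. P (\<Sum>i\<in>B. ?l s $ i) \<noteq> 0" by (simp add: sum.distrib)
      qed
    qed simp
    then show ?thesis by eventually_elim (simp add: hden_def)
  qed
  then have ev: "eventually (\<lambda>s. ?l s \<in> {z\<in>UNIV. hden z \<noteq> 0}) (at 0)" by simp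
  have "isCont ?l 0" using continuous_line[of UNIV a "\<chi> i. 1"] by (simp add: continuous_on_eq_continuous_at)
  then have "(?l \<longlongrightarrow> ?l 0) (at 0)" by (simp only: isCont_def)
  moreover have "?l 0 = a" by (simp add: vec_eq_iff)
  ultimately have lim: "(?l \<longlongrightarrow> a) (at 0)" by simp
  show "a \<in> closure {z\<in>UNIV. hden z \<noteq> 0}"
    by (rule Lim_in_closed_set[OF closed_closure eventually_mono[OF ev] _ lim])
       (auto intro: closure_subset[THEN subsetD])
qed

lemma meromorphic_Cn_gw:
  assumes "\<And>z. hden z \<noteq> 0 \<Longrightarrow> f z = gwsum z"
  shows "meromorphic_Cn f"
  unfolding meromorphic_Cn_def
proof
  fix a
  show "\<exists>U g h. a \<in> U \<and> holomorphic_Cn g U \<and> holomorphic_Cn h U \<and> U \<subseteq> closure {z \<in> U. h z \<noteq> 0} \<and>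
      (\<forall>z\<in>U. h z \<noteq> 0 \<longrightarrow> f z = g z / h z)"
    by (intro exI[of _ UNIV] exI[of _ gnum] exI[of _ hden] conjI ballI impI hden_dense
        holomorphic_Cn_gnum holomorphic_Cn_hden) (simp_all add: assms gwsum_eq)
qed

section \<open>Existence and uniqueness of the pairing\<close>

lemma exists_gw_pairing: "\<exists>f :: (complex, 'n::{finite,linorder}) vec \<Rightarrow> complex. is_gw_pairing \<tau> f"
proof
  \<comment> \<open>The integral is prescribed wherever circles exist and no
    \<open>P (z $ i)\<close> vanishes, which includes zeros of \<open>hden\<close>, where
    \<open>torus_integral_formula\<close> does not apply. There \<open>f\<close> has to be the
    integral itself; by \<open>torus_integral_independent\<close> the chosen radii do not
    matter.\<close>
  define f where "f = (\<lambda>z :: (complex, 'n) vec. if (\<forall>i. P (z $ i) \<noteq> 0) \<and> (\<exists>r. admissible_radii \<tau> z r)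
     then torus_integral \<tau> z (SOME r. admissible_radii \<tau> z r) else gwsum z)"
  have f: "f z = torus_integral \<tau> z r" if "admissible_radii \<tau> z r" "\<And>i. P (z $ i) \<noteq> 0" for z r
  proof -
    have "admissible_radii \<tau> z (SOME r. admissible_radii \<tau> z r)" using that(1) by (rule someI)
    moreover have "f z = torus_integral \<tau> z (SOME r. admissible_radii \<tau> z r)"
      unfolding f_def by (rule if_P) (use that in blast)
    ultimately show ?thesis using torus_integral_independent[OF _ that(1) that(2)] by simp
  qed
  have "f z = gwsum z" if h: "hden z \<noteq> 0" for z
  proof (cases "\<exists>r. admissible_radii \<tau> z r")
    case True
    then obtain r where r: "admissible_radii \<tau> z r" by blast
    have "P (z $ i) \<noteq> 0" for i using hden_nonzeroD[OF h, of "{i}"] by simp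
    then have "f z = torus_integral \<tau> z r" using f[OF r] by blast
    also have "\<dots> = gwsum z" unfolding gwsum_def by (rule torus_integral_formula[OF r hden_nonzeroD[OF h]])
    finally show ?thesis .
  next
    case False
    then show ?thesis unfolding f_def by (intro if_not_P) blast
  qed
  then have "meromorphic_Cn f" by (rule meromorphic_Cn_gw)
  then show "is_gw_pairing \<tau> f" using f by (simp add: is_gw_pairing_def theta_eq_P)
qed

lemma open_admissible: "open {z :: (complex, 'n::{finite,linorder}) vec. admissible_radii \<tau> z r}"
proof (cases "\<forall>j. 0 < r $ j")
  case True
  have eq: "{z :: (complex, 'n) vec. admissible_radii \<tau> z r} = (\<Inter>i\<in>UNIV. \<Inter>j\<in>UNIV.
      (if i < j then {z. 1 < norm (exp (z $ i)) * r $ i / r $ j} \<inter>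
         {z. norm (exp (z $ i)) * r $ i / r $ j < 1 / norm (exp (2 * of_real pi * \<i> * \<tau>))} \<inter>
         {z. 1 < r $ i / (norm (exp (z $ j)) * r $ j)} \<inter>
         {z. r $ i / (norm (exp (z $ j)) * r $ j) < 1 / norm (exp (2 * of_real pi * \<i> * \<tau>))} else UNIV))"
    using True by (auto simp: admissible_radii_def Let_def split: if_splits)
  have nz: "norm (exp x) * r $ j \<noteq> 0" "r $ j \<noteq> 0" for x :: complex and j
    using True by (simp_all add: less_imp_neq[symmetric])
  show ?thesis
    unfolding eq
    by (intro open_INT finite ballI) (auto intro!: open_Int open_Collect_less continuous_intros simp: nz)
next
  case False
  then have "{z :: (complex, 'n) vec. admissible_radii \<tau> z r} = {}" by (auto simp: admissible_radii_def Let_def)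
  then show ?thesis by simp
qed

lemma admissible_0: "\<exists>r. admissible_radii \<tau> (0 :: (complex, 'n::{finite,linorder}) vec) r"
proof -
  define k where "k = (\<lambda>i :: 'n. card {j. j < i})"
  \<comment> \<open>The radii decrease by the factor \<open>exp (- d)\<close> from each index to the
    next; the added 1 keeps every ratio strictly below \<open>exp ell\<close>.\<close>
  define d where "d = ell / (CARD('n) + 1)"
  define r where "r = (\<chi> i. exp (- d * real (k i)))"
  have d: "d > 0" using ell_pos by (simp add: d_def)
  have q: "1 / norm (exp (2 * of_real pi * \<i> * \<tau>)) = exp ell"
    by (simp add: ell_def exp_minus divide_inverse)
  have kk: "k i < k j" if "i < j" for i j
    unfolding k_def using that by (intro psubset_card_mono) auto
  have kn: "k j \<le> CARD('n)" for j unfolding k_def by (intro card_mono) auto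
  have rr: "r $ i / r $ j = exp (d * (real (k j) - real (k i)))" for i j
    by (simp add: r_def algebra_simps flip: exp_diff)
  have "1 < r $ i / r $ j \<and> r $ i / r $ j < exp ell" if "i < j" for i j
  proof -
    have "d * (real (k j) - real (k i)) \<le> d * real CARD('n)"
      using d kn[of j] by (intro mult_left_mono) auto
    also have "\<dots> < ell" using ell_pos by (simp add: d_def field_simps)
    finally show ?thesis using kk[OF that] d unfolding rr by simp
  qed
  then have "admissible_radii \<tau> 0 r"
    unfolding admissible_radii_def Let_def q by (simp add: r_def)
  then show ?thesis by blast
qed

text \<open>The radii admissible for \<open>z = 0\<close> stay admissible on an open set; off the
  zeros of \<open>hden\<close> the integral formula applies there, and the identity theorem extends
  the agreement.\<close>

lemma gw_pairing_eq:
  fixes f :: "(complex, 'n::{finite,linorder}) vec \<Rightarrow> complex"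
  assumes f: "is_gw_pairing \<tau> f"
  shows "meromorphic_eq f gwsum"
proof -
  have mf: "meromorphic_Cn f" using f by (simp add: is_gw_pairing_def)
  have mg: "meromorphic_Cn (gwsum :: (complex, 'n) vec \<Rightarrow> complex)" by (rule meromorphic_Cn_gw) simp
  obtain r where r: "admissible_radii \<tau> (0 :: (complex, 'n) vec) r" using admissible_0 by blast
  let ?O = "{z :: (complex, 'n) vec. admissible_radii \<tau> z r}"
  define W where "W = ?O \<inter> hden -` (- {0})"
  have "open (UNIV \<inter> hden -` (- {0 :: complex}) :: ((complex, 'n) vec) set)"
    using holomorphic_Cn_continuous[OF holomorphic_Cn_hden] by (intro continuous_open_preimage) auto
  then have "open W" unfolding W_def using open_admissible[of r] by auto
  moreover have "W \<noteq> {}"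
  proof -
    have "?O \<noteq> {}" using r by blast
    from dense_nonzeroD[OF hden_dense open_admissible[of r] subset_UNIV this]
    obtain z where "z \<in> ?O" "hden z \<noteq> 0" .
    then show ?thesis by (auto simp: W_def)
  qed
  moreover have "f z = gwsum z" if "z \<in> W" for z
  proof -
    have h: "hden z \<noteq> 0" and adm: "admissible_radii \<tau> z r" using that by (auto simp: W_def)
    have "P (z $ i) \<noteq> 0" for i using hden_nonzeroD[OF h, of "{i}"] by simp
    then have "f z = torus_integral \<tau> z r" using f adm by (simp add: is_gw_pairing_def theta_eq_P)
    also have "\<dots> = gwsum z" unfolding gwsum_def by (rule torus_integral_formula[OF adm hden_nonzeroD[OF h]])
    finally show ?thesis .
  qed
  ultimately show ?thesis
    unfolding meromorphic_eq_def using mf mg meromorphic_Cn_identity[OF mf mg, of W] by blast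
qed

end

theorem theorem1p1:
  fixes \<tau> :: complex
  assumes "Im \<tau> > 0"
  shows "(\<exists>P :: complex ^ ('n :: {finite, linorder}) \<Rightarrow> complex. is_gw_pairing \<tau> P) \<and>
    (\<forall>P :: complex ^ ('n :: {finite, linorder}) \<Rightarrow> complex. is_gw_pairing \<tau> P \<longrightarrow>
       meromorphic_eq P
         (\<lambda>z. \<Sum>j\<in>UNIV. \<Sum>\<pi> | partition_on (UNIV - {j}) \<pi>.
            \<Prod>B\<in>\<pi>. bell_EK \<tau> (card B) (\<Sum>i\<in>B. z $ i) / of_nat (card B)))"
proof -
  interpret half_plane \<tau> by standard (rule assms)
  have "gwsum = (\<lambda>z :: (complex, 'n) vec. \<Sum>j\<in>UNIV. \<Sum>\<pi> | partition_on (UNIV - {j}) \<pi>.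
      \<Prod>B\<in>\<pi>. bell_EK \<tau> (card B) (\<Sum>i\<in>B. z $ i) / of_nat (card B))"
    by (simp add: gwsum_def set_exp_def fun_eq_iff)
  then show ?thesis using exists_gw_pairing gw_pairing_eq by metis
qed

end
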